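(* For a given $\ell\in\mathbb{Z}_+$, $\ell$-$\mathcal L$PF and $\mathcal L$PF are NP-hard on dually chordal graphs and on doubly chordal graphs. Consequently, GDF and GPF are also NP-hard on dually chordal graphs and on doubly chordal graphs.
   Context: Graphs are finite, simple, undirected; $N[v]$ is the closed neighborhood; $f(U)=\sum_{x\in U}f(x)$; $[0,\ell]=\{0,\dots,\ell\}$; $F$ is a symbol meaning "free". A vertex $u\in N[v]$ is a maximum neighbor of $v$ if $N[w]\subseteq N[u]$ for every $w\in N[v]$. For an ordering $(v_1,\dots,v_n)$ of $V(G)$, let $G_i=G[\{v_i,\dots,v_n\}]$; it is an order of maximum neighborhoods if for each $i$, $v_i$ has a maximum neighbor in $G_i$. A graph is dually chordal if it admits an order of maximum neighborhoods; it is chordal if every cycle of length at least 4 has a chord; it is doubly chordal if it is chordal and dually chordal. $\mathcal L$PF: given $G=(V,E)$, $\ell\in\mathbb{Z}_+$, $\mathbf k\in\mathbb{Z}_+^V$, $\mathbf t\in\{0,F\}^V$, compute the maximum of $f(V)$ over $f:V\to[0,\ell]$ with $f(N[v])\leq k(v)$ for all $v$ and $f(v)=0$ whenever $t(v)=0$; $\ell$-$\mathcal L$PF is its restriction to a fixed $\ell$. GDF (resp. GPF): given $G$ and $\mathbf k,\mathbf u\in\mathbb{Z}_+^V$, compute the minimum (resp. maximum) of $f(V)$ over $f:V\to\mathbb{Z}_+$ with $f(v)\leq u(v)$ and $f(N[v])\geq k(v)$ (resp. $f(N[v])\leq k(v)$) for all $v\in V$.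
   Formalization: The claim is stated for ℓ ≥ 1: for ℓ = 0 the only feasible function is f = 0, the maximum is always 0, and the problem is trivially solvable, so it is not NP-hard unless P = NP. *)

theory Defs
  imports
    "HOL-Library.Extended_Nat"
    "HOL-Computational_Algebra.Polynomial"
begin

subsection \<open>Turing machines, NP and polynomial-time reductions\<close>

text \<open>
  Multi-tape machines with two-way infinite tapes. States and symbols are initial segments of the
  naturals; state 0 is initial, state 1 is the only halting (accepting) state, symbol 0 is the
  blank, and the symbols 1 and 2 stand for the input bits False and True. A transition
  \<open>(q, rs, q', as)\<close> applies in state \<open>q\<close> when the heads read \<open>rs\<close>; it writes the symbols and
  performs the head moves given by \<open>as\<close>, one entry per tape.
\<close>

datatype move = MLeft | MStay | MRight

record tm =
  tm_tapes :: nat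
  tm_states :: nat
  tm_symbols :: nat
  tm_trans :: "(nat \<times> nat list \<times> nat \<times> (nat \<times> move) list) set"

definition turing_machine :: "tm \<Rightarrow> bool" where
  "turing_machine M \<longleftrightarrow>
     tm_tapes M \<ge> 1 \<and> tm_states M \<ge> 2 \<and> tm_symbols M \<ge> 3 \<and>
     (\<forall>(q, rs, q', as) \<in> tm_trans M.
        q < tm_states M \<and> q \<noteq> 1 \<and> q' < tm_states M \<and>
        length rs = tm_tapes M \<and> set rs \<subseteq> {..<tm_symbols M} \<and>
        length as = tm_tapes M \<and> fst ` set as \<subseteq> {..<tm_symbols M})"

definition deterministic :: "tm \<Rightarrow> bool" where
  "deterministic M \<longleftrightarrow>
     (\<forall>q rs a b. (q, rs, a) \<in> tm_trans M \<longrightarrow> (q, rs, b) \<in> tm_trans M \<longrightarrow> a = b)"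

text \<open>A tape is given by its cell contents and the position of its head.\<close>

type_synonym tape = "(int \<Rightarrow> nat) \<times> int"
type_synonym config = "nat \<times> tape list"

fun read_tape :: "tape \<Rightarrow> nat" where
  "read_tape (t, h) = t h"

fun move_head :: "move \<Rightarrow> int \<Rightarrow> int" where
  "move_head MLeft h = h - 1"
| "move_head MStay h = h"
| "move_head MRight h = h + 1"

fun act_tape :: "nat \<times> move \<Rightarrow> tape \<Rightarrow> tape" where
  "act_tape (s, m) (t, h) = (t(h := s), move_head m h)"

definition tm_step :: "tm \<Rightarrow> config \<Rightarrow> config \<Rightarrow> bool" where
  "tm_step M c c' \<longleftrightarrow>
     (\<exists>q' as. (fst c, map read_tape (snd c), q', as) \<in> tm_trans M \<and>
              c' = (q', map2 act_tape as (snd c)))"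

definition word_tape :: "bool list \<Rightarrow> int \<Rightarrow> nat" where
  "word_tape w i = (if 0 \<le> i \<and> i < int (length w) then (if w ! nat i then 2 else 1) else 0)"

definition tm_init :: "tm \<Rightarrow> bool list \<Rightarrow> config" where
  "tm_init M x = (0, (word_tape x, 0) # replicate (tm_tapes M - 1) (word_tape [], 0))"

definition accepts_within :: "tm \<Rightarrow> bool list \<Rightarrow> nat \<Rightarrow> bool" where
  "accepts_within M x T \<longleftrightarrow> (\<exists>n\<le>T. \<exists>ts. (tm_step M ^^ n) (tm_init M x) (1, ts))"

text \<open>The output is left on the first tape, which also held the input.\<close>

definition outputs_within :: "tm \<Rightarrow> bool list \<Rightarrow> bool list \<Rightarrow> nat \<Rightarrow> bool" where
  "outputs_within M x y T \<longleftrightarrow>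
     (\<exists>n\<le>T. \<exists>ts. (tm_step M ^^ n) (tm_init M x) (1, ts) \<and> fst (hd ts) = word_tape y)"

definition NP :: "bool list set set" where
  "NP = {L. \<exists>M (p :: nat poly). turing_machine M \<and>
              (\<forall>x. x \<in> L \<longleftrightarrow> accepts_within M x (poly p (length x)))}"

definition polytime_computable :: "(bool list \<Rightarrow> bool list) \<Rightarrow> bool" where
  "polytime_computable r \<longleftrightarrow>
     (\<exists>M (p :: nat poly). turing_machine M \<and> deterministic M \<and>
              (\<forall>x. outputs_within M x (r x) (poly p (length x))))"


subsection \<open>Graphs\<close>

record 'a graph =
  verts :: "'a set"
  edges :: "'a set set"

definition simple_graph :: "'a graph \<Rightarrow> bool" where
  "simple_graph G \<longleftrightarrow> finite (verts G) \<and>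
     (\<forall>e \<in> edges G. \<exists>u \<in> verts G. \<exists>v \<in> verts G. u \<noteq> v \<and> e = {u, v})"

definition induced :: "'a graph \<Rightarrow> 'a set \<Rightarrow> 'a graph" where
  "induced G U = \<lparr>verts = verts G \<inter> U, edges = {e \<in> edges G. e \<subseteq> U}\<rparr>"

definition closed_nbhd :: "'a graph \<Rightarrow> 'a \<Rightarrow> 'a set" where
  "closed_nbhd G v = {u \<in> verts G. u = v \<or> {u, v} \<in> edges G}"

definition maximum_neighbor :: "'a graph \<Rightarrow> 'a \<Rightarrow> 'a \<Rightarrow> bool" where
  "maximum_neighbor G v u \<longleftrightarrow>
     u \<in> closed_nbhd G v \<and> (\<forall>w \<in> closed_nbhd G v. closed_nbhd G w \<subseteq> closed_nbhd G u)"

definition maximum_neighborhood_order :: "'a graph \<Rightarrow> 'a list \<Rightarrow> bool" where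
  "maximum_neighborhood_order G vs \<longleftrightarrow> distinct vs \<and> set vs = verts G \<and>
     (\<forall>i < length vs. \<exists>u. maximum_neighbor (induced G (set (drop i vs))) (vs ! i) u)"

definition dually_chordal :: "'a graph \<Rightarrow> bool" where
  "dually_chordal G \<longleftrightarrow> (\<exists>vs. maximum_neighborhood_order G vs)"

definition is_cycle :: "'a graph \<Rightarrow> 'a list \<Rightarrow> bool" where
  "is_cycle G cs \<longleftrightarrow> length cs \<ge> 3 \<and> distinct cs \<and> set cs \<subseteq> verts G \<and>
     (\<forall>i < length cs. {cs ! i, cs ! (Suc i mod length cs)} \<in> edges G)"

definition has_chord :: "'a graph \<Rightarrow> 'a list \<Rightarrow> bool" where
  "has_chord G cs \<longleftrightarrow>
     (\<exists>i j. i < length cs \<and> j < length cs \<and> i \<noteq> j \<and>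
            j \<noteq> Suc i mod length cs \<and> i \<noteq> Suc j mod length cs \<and> {cs ! i, cs ! j} \<in> edges G)"

definition chordal :: "'a graph \<Rightarrow> bool" where
  "chordal G \<longleftrightarrow> (\<forall>cs. is_cycle G cs \<longrightarrow> length cs \<ge> 4 \<longrightarrow> has_chord G cs)"

definition doubly_chordal :: "'a graph \<Rightarrow> bool" where
  "doubly_chordal G \<longleftrightarrow> chordal G \<and> dually_chordal G"


subsection \<open>Encoding of numbers and graphs by bit strings\<close>

text \<open>Binary representation, least significant bit first, without leading zeros.\<close>

fun binary :: "nat \<Rightarrow> bool list" where
  "binary n = (if n = 0 then [] else odd n # binary (n div 2))"

declare binary.simps [simp del]

text \<open>Self-delimiting: every bit is preceded by True, and False ends the number.\<close>

definition encode_nat :: "nat \<Rightarrow> bool list" where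
  "encode_nat n = concat (map (\<lambda>b. [True, b]) (binary n)) @ [False]"

definition encode_nats :: "nat list \<Rightarrow> bool list" where
  "encode_nats ns = concat (map encode_nat ns)"

text \<open>The order of the graph followed by its adjacency matrix, row by row.\<close>

definition graph_code :: "nat graph \<Rightarrow> nat list" where
  "graph_code G = (let n = card (verts G) in
     n # concat (map (\<lambda>i. map (\<lambda>j. if {i, j} \<in> edges G then 1 else 0) [0..<n]) [0..<n]))"

definition vector_code :: "nat graph \<Rightarrow> (nat \<Rightarrow> nat) \<Rightarrow> nat list" where
  "vector_code G k = map k [0..<card (verts G)]"


subsection \<open>NP-hardness of optimization problems on graph classes\<close>

text \<open>
  An optimization problem is treated through its decision version: an instance \<open>i\<close> comes with a
  bound \<open>B\<close>, and \<open>meets i B\<close> says that the optimum of \<open>i\<close> is at least \<open>B\<close> (maximization) or at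
  most \<open>B\<close> (minimization). Input graphs have vertex set \<open>{0,...,n-1}\<close>.
\<close>

record 'i opt_problem =
  graph_of :: "'i \<Rightarrow> nat graph"
  code_of :: "'i \<Rightarrow> nat list"
  meets :: "'i \<Rightarrow> nat \<Rightarrow> bool"

definition instances :: "'i opt_problem \<Rightarrow> (nat graph \<Rightarrow> bool) \<Rightarrow> 'i set" where
  "instances P C = {i. simple_graph (graph_of P i) \<and>
     verts (graph_of P i) = {..<card (verts (graph_of P i))} \<and> C (graph_of P i)}"

definition instance_strings :: "'i opt_problem \<Rightarrow> (nat graph \<Rightarrow> bool) \<Rightarrow> bool list set" where
  "instance_strings P C = {encode_nats (code_of P i @ [B]) | i B. i \<in> instances P C}"

definition yes_strings :: "'i opt_problem \<Rightarrow> (nat graph \<Rightarrow> bool) \<Rightarrow> bool list set" where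
  "yes_strings P C = {encode_nats (code_of P i @ [B]) | i B. i \<in> instances P C \<and> meets P i B}"

text \<open>
  Every language in NP has a polynomial-time many-one reduction to the decision version, producing
  only instances whose graph belongs to the class \<open>C\<close>.
\<close>

definition NP_hard_on :: "'i opt_problem \<Rightarrow> (nat graph \<Rightarrow> bool) \<Rightarrow> bool" where
  "NP_hard_on P C \<longleftrightarrow>
     (\<forall>L \<in> NP. \<exists>r. polytime_computable r \<and>
        (\<forall>x. r x \<in> instance_strings P C \<and> (x \<in> L \<longleftrightarrow> r x \<in> yes_strings P C)))"


subsection \<open>The packing and domination problems\<close>

datatype label = Zero | Free

fun label_code :: "label \<Rightarrow> nat" where
  "label_code Zero = 0"
| "label_code Free = 1"

definition lpf_feasible ::
  "nat \<Rightarrow> 'a graph \<Rightarrow> ('a \<Rightarrow> nat) \<Rightarrow> ('a \<Rightarrow> label) \<Rightarrow> ('a \<Rightarrow> nat) \<Rightarrow> bool" where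
  "lpf_feasible l G k t f \<longleftrightarrow>
     (\<forall>v \<in> verts G. f v \<le> l \<and> sum f (closed_nbhd G v) \<le> k v \<and> (t v = Zero \<longrightarrow> f v = 0))"

definition lpf_max :: "nat \<Rightarrow> 'a graph \<Rightarrow> ('a \<Rightarrow> nat) \<Rightarrow> ('a \<Rightarrow> label) \<Rightarrow> nat" where
  "lpf_max l G k t = Max {sum f (verts G) | f. lpf_feasible l G k t f}"

definition gpf_feasible ::
  "'a graph \<Rightarrow> ('a \<Rightarrow> nat) \<Rightarrow> ('a \<Rightarrow> nat) \<Rightarrow> ('a \<Rightarrow> nat) \<Rightarrow> bool" where
  "gpf_feasible G k u f \<longleftrightarrow> (\<forall>v \<in> verts G. f v \<le> u v \<and> sum f (closed_nbhd G v) \<le> k v)"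

definition gpf_max :: "'a graph \<Rightarrow> ('a \<Rightarrow> nat) \<Rightarrow> ('a \<Rightarrow> nat) \<Rightarrow> nat" where
  "gpf_max G k u = Max {sum f (verts G) | f. gpf_feasible G k u f}"

definition gdf_feasible ::
  "'a graph \<Rightarrow> ('a \<Rightarrow> nat) \<Rightarrow> ('a \<Rightarrow> nat) \<Rightarrow> ('a \<Rightarrow> nat) \<Rightarrow> bool" where
  "gdf_feasible G k u f \<longleftrightarrow> (\<forall>v \<in> verts G. f v \<le> u v \<and> k v \<le> sum f (closed_nbhd G v))"

text \<open>The minimum is infinite when there is no feasible function.\<close>

definition gdf_min :: "'a graph \<Rightarrow> ('a \<Rightarrow> nat) \<Rightarrow> ('a \<Rightarrow> nat) \<Rightarrow> enat" where
  "gdf_min G k u = Inf {enat (sum f (verts G)) | f. gdf_feasible G k u f}"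

definition fixed_LPF :: "nat \<Rightarrow> (nat graph \<times> (nat \<Rightarrow> nat) \<times> (nat \<Rightarrow> label)) opt_problem" where
  "fixed_LPF l = \<lparr>
     graph_of = (\<lambda>(G, k, t). G),
     code_of = (\<lambda>(G, k, t). graph_code G @ vector_code G k @ vector_code G (label_code \<circ> t)),
     meets = (\<lambda>(G, k, t) B. B \<le> lpf_max l G k t)\<rparr>"

definition LPF :: "(nat graph \<times> nat \<times> (nat \<Rightarrow> nat) \<times> (nat \<Rightarrow> label)) opt_problem" where
  "LPF = \<lparr>
     graph_of = (\<lambda>(G, l, k, t). G),
     code_of = (\<lambda>(G, l, k, t).
       graph_code G @ [l] @ vector_code G k @ vector_code G (label_code \<circ> t)),
     meets = (\<lambda>(G, l, k, t) B. B \<le> lpf_max l G k t)\<rparr>"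

definition GDF :: "(nat graph \<times> (nat \<Rightarrow> nat) \<times> (nat \<Rightarrow> nat)) opt_problem" where
  "GDF = \<lparr>
     graph_of = (\<lambda>(G, k, u). G),
     code_of = (\<lambda>(G, k, u). graph_code G @ vector_code G k @ vector_code G u),
     meets = (\<lambda>(G, k, u) B. gdf_min G k u \<le> enat B)\<rparr>"

definition GPF :: "(nat graph \<times> (nat \<Rightarrow> nat) \<times> (nat \<Rightarrow> nat)) opt_problem" where
  "GPF = \<lparr>
     graph_of = (\<lambda>(G, k, u). G),
     code_of = (\<lambda>(G, k, u). graph_code G @ vector_code G k @ vector_code G u),
     meets = (\<lambda>(G, k, u) B. B \<le> gpf_max G k u)\<rparr>"

end

theory Submission imports Defs begin

text \<open>
  Everything takes place on split graphs with universal vertices, which are doubly chordal. In such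
  a graph the clique carries the weights, and every independent vertex imposes a bound on the sum of
  the weights over an arbitrary subset of the clique. This is enough to express a computation of a
  nondeterministic machine: the clique is divided into groups of mutually exclusive alternatives
  (the transition applied at a time, the symbol in a cell of the tableau), group vertices and the
  bound on the total weight force weight one on every group, so that a weighting is a transversal of
  the groups, and a clause vertex forbids that all literals of a locally inconsistent set are chosen.
  In packing instances a clause is joined to its literals and bounds their weight; in covering
  instances it is joined to the alternatives that contradict one of its literals and demands one.

  Measuring tape cells relative to the head makes the tableau so uniform that an entry of the
  adjacency matrix depends only on the kinds of the two vertices and on whether a few affine
  functions of their coordinates take values in -1, 0, 1. The machine that writes the matrix keeps
  the value of each such function as the position of a head, moved in step with the loop counters.
\<close>

section \<open>Split graphs with universal vertices\<close>

definition universal_vertex :: "'a graph \<Rightarrow> 'a \<Rightarrow> bool" where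
  "universal_vertex G u \<longleftrightarrow> u \<in> verts G \<and> (\<forall>v\<in>verts G. v \<noteq> u \<longrightarrow> {u, v} \<in> edges G)"

lemma maximum_neighbor_universal:
  assumes "universal_vertex G u" "u \<in> U" "v \<in> U" "U \<subseteq> verts G"
  shows "maximum_neighbor (induced G U) v u"
proof -
  have "closed_nbhd (induced G U) u = U"
    using assms by (auto simp: universal_vertex_def closed_nbhd_def induced_def insert_commute)
  moreover have "u \<in> closed_nbhd (induced G U) v"
    using assms by (auto simp: universal_vertex_def closed_nbhd_def induced_def)
  moreover have "closed_nbhd (induced G U) w \<subseteq> U" for w
    by (auto simp: closed_nbhd_def induced_def)
  ultimately show ?thesis by (simp add: maximum_neighbor_def)
qed

lemma dually_chordal_if_universal:
  assumes "finite (verts G)" and u: "universal_vertex G u"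
  shows "dually_chordal G"
proof -
  obtain ws where ws: "set ws = verts G - {u}" "distinct ws"
    using finite_distinct_list[of "verts G - {u}"] assms(1) by auto
  let ?vs = "ws @ [u]"
  have verts: "set ?vs = verts G" using ws u by (auto simp: universal_vertex_def)
  have "maximum_neighbor (induced G (set (drop i ?vs))) (?vs ! i) u" if "i < length ?vs" for i
  proof (rule maximum_neighbor_universal[OF u])
    show "u \<in> set (drop i ?vs)" using that by simp
    show "?vs ! i \<in> set (drop i ?vs)"
      using that by (metis Cons_nth_drop_Suc list.set_intros(1))
    show "set (drop i ?vs) \<subseteq> verts G" using set_drop_subset[of i ?vs] verts by simp
  qed
  then show ?thesis
    using ws verts unfolding dually_chordal_def maximum_neighborhood_order_def
    by (intro exI[of _ ?vs]) auto
qed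

definition split_by :: "'a graph \<Rightarrow> 'a set \<Rightarrow> bool" where
  "split_by G Q \<longleftrightarrow>
     (\<forall>u v. u \<in> verts G \<inter> Q \<longrightarrow> v \<in> verts G \<inter> Q \<longrightarrow> u \<noteq> v \<longrightarrow> {u, v} \<in> edges G) \<and>
     (\<forall>u v. {u, v} \<in> edges G \<longrightarrow> u \<in> Q \<or> v \<in> Q)"

lemma has_chord_in_clique:
  assumes "split_by G Q" "is_cycle G cs" "i < length cs" "j < length cs" "i \<noteq> j"
    and "j \<noteq> Suc i mod length cs" "i \<noteq> Suc j mod length cs" "cs ! i \<in> Q" "cs ! j \<in> Q"
  shows "has_chord G cs"
proof -
  have "cs ! i \<noteq> cs ! j" "cs ! i \<in> verts G" "cs ! j \<in> verts G"
    using assms by (auto simp: is_cycle_def nth_eq_iff_index_eq)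
  then have "{cs ! i, cs ! j} \<in> edges G" using assms(1,8,9) by (simp add: split_by_def)
  then show ?thesis using assms unfolding has_chord_def by blast
qed

lemma chordal_if_split:
  assumes split: "split_by G Q"
  shows "chordal G"
  unfolding chordal_def
proof (intro allI impI)
  fix cs assume cycle: "is_cycle G cs" and len: "4 \<le> length cs"
  let ?m = "length cs"
  have "cs \<noteq> []" using len by auto
  note chord = has_chord_in_clique[OF split cycle]
  have consecutive: "cs ! i \<in> Q \<or> cs ! (Suc i mod ?m) \<in> Q" if "i < ?m" for i
    using that cycle split by (auto simp: is_cycle_def split_by_def)
  have last_mod: "Suc (?m - 1) mod ?m = 0"
    using len by (metis Suc_diff_1 less_le_trans mod_self zero_less_numeral)
  consider "cs ! 0 \<notin> Q" | "cs ! 2 \<notin> Q" | "cs ! 0 \<in> Q" "cs ! 2 \<in> Q" by blast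
  then show "has_chord G cs"
  proof cases
    assume "cs ! 0 \<notin> Q"
    then have "cs ! 1 \<in> Q" "cs ! (?m - 1) \<in> Q"
      using consecutive[of 0] consecutive[of "?m - 1"] last_mod len \<open>cs \<noteq> []\<close>
      by auto
    then show ?thesis using len last_mod by (intro chord[of 1 "?m - 1"]) auto
  next
    assume "cs ! 2 \<notin> Q"
    then have "cs ! 1 \<in> Q" "cs ! 3 \<in> Q"
      using consecutive[of 1] consecutive[of 2] len by (auto simp: numeral_2_eq_2 numeral_3_eq_3)
    moreover have "Suc 3 mod ?m \<noteq> 1" using len by (cases "?m = 4") auto
    ultimately show ?thesis using len by (intro chord[of 1 3]) auto
  next
    assume "cs ! 0 \<in> Q" "cs ! 2 \<in> Q"
    then show ?thesis using len by (intro chord[of 0 2]) auto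
  qed
qed

definition list_graph :: "'v list \<Rightarrow> ('v \<Rightarrow> 'v \<Rightarrow> bool) \<Rightarrow> nat graph" where
  "list_graph vl adj = \<lparr>verts = {..<length vl},
     edges = {{i, j} | i j. i < length vl \<and> j < length vl \<and> adj (vl ! i) (vl ! j)}\<rparr>"

lemma verts_list_graph [simp]: "verts (list_graph vl adj) = {..<length vl}"
  by (simp add: list_graph_def)

lemma edges_list_graph_iff:
  assumes "symp adj"
  shows "{i, j} \<in> edges (list_graph vl adj) \<longleftrightarrow>
    i < length vl \<and> j < length vl \<and> adj (vl ! i) (vl ! j)"
  using assms by (auto simp: list_graph_def doubleton_eq_iff dest: sympD)

lemma simple_graph_list_graph: "irreflp adj \<Longrightarrow> simple_graph (list_graph vl adj)"
  unfolding simple_graph_def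
  by (auto simp: list_graph_def irreflp_def) (metis lessThan_iff)

lemma graph_code_list_graph:
  assumes "symp adj"
  shows "graph_code (list_graph vl adj) =
    length vl # concat (map (\<lambda>v. map (\<lambda>w. of_bool (adj v w)) vl) vl)"
proof -
  have reindex: "map h vl = map (\<lambda>i. h (vl ! i)) [0..<length vl]" for h :: "'a \<Rightarrow> 'b"
    by (intro nth_equalityI) auto
  show ?thesis
    unfolding graph_code_def Let_def edges_list_graph_iff[OF assms] reindex
    by (auto intro!: arg_cong[of _ _ concat])
qed

lemma vector_code_list_graph: "vector_code (list_graph vl adj) (\<lambda>i. k (vl ! i)) = map k vl"
  by (intro nth_equalityI) (auto simp: vector_code_def)

definition split_adj ::
  "('v \<Rightarrow> bool) \<Rightarrow> ('v \<Rightarrow> bool) \<Rightarrow> ('v \<Rightarrow> 'v \<Rightarrow> bool) \<Rightarrow> 'v \<Rightarrow> 'v \<Rightarrow> bool" where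
  "split_adj universal weighted inc v w \<longleftrightarrow> v \<noteq> w \<and>
     (universal v \<or> universal w \<or> weighted v \<and> weighted w \<or>
      \<not> weighted v \<and> weighted w \<and> inc v w \<or> weighted v \<and> \<not> weighted w \<and> inc w v)"

lemma symp_split_adj: "symp (split_adj universal weighted inc)"
  by (auto simp: symp_def split_adj_def)

section \<open>Packing and covering by weights on the clique\<close>

datatype goal = Packing | Covering

fun complies :: "goal \<Rightarrow> nat \<Rightarrow> nat \<Rightarrow> bool" where
  "complies Packing s b \<longleftrightarrow> s \<le> b"
| "complies Covering s b \<longleftrightarrow> b \<le> s"

fun attains :: "goal \<Rightarrow> 'a graph \<Rightarrow> ('a \<Rightarrow> nat) \<Rightarrow> ('a \<Rightarrow> nat) \<Rightarrow> nat \<Rightarrow> bool" where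
  "attains Packing G k u B \<longleftrightarrow> B \<le> gpf_max G k u"
| "attains Covering G k u B \<longleftrightarrow> gdf_min G k u \<le> enat B"

lemma gpf_max_ge_iff:
  assumes "finite (verts G)"
  shows "B \<le> gpf_max G k u \<longleftrightarrow> (\<exists>f. gpf_feasible G k u f \<and> B \<le> sum f (verts G))"
proof -
  let ?values = "{sum f (verts G) | f. gpf_feasible G k u f}"
  have "?values \<subseteq> {..sum u (verts G)}" by (auto simp: gpf_feasible_def intro: sum_mono)
  then have "finite ?values" using finite_subset by blast
  moreover have "gpf_feasible G k u (\<lambda>_. 0)" by (simp add: gpf_feasible_def)
  then have "?values \<noteq> {}" by blast
  ultimately show ?thesis unfolding gpf_max_def by (subst Max_ge_iff) auto
qed

lemma gdf_min_le_iff: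
  "gdf_min G k u \<le> enat B \<longleftrightarrow> (\<exists>f. gdf_feasible G k u f \<and> sum f (verts G) \<le> B)"
proof
  let ?values = "{enat (sum f (verts G)) | f. gdf_feasible G k u f}"
  assume attained: "gdf_min G k u \<le> enat B"
  then have "?values \<noteq> {}" unfolding gdf_min_def by (metis Inf_enat_def infinity_ileE)
  then have "Inf ?values \<in> ?values" by (metis (no_types, lifting) Inf_enat_def LeastI ex_in_conv)
  then show "\<exists>f. gdf_feasible G k u f \<and> sum f (verts G) \<le> B"
    using attained unfolding gdf_min_def by force
next
  assume "\<exists>f. gdf_feasible G k u f \<and> sum f (verts G) \<le> B"
  then show "gdf_min G k u \<le> enat B"
    unfolding gdf_min_def by (auto intro!: Inf_lower2)
qed

lemma attains_iff:
  assumes "finite (verts G)"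
  shows "attains gl G k u B \<longleftrightarrow>
    (\<exists>f. (\<forall>v\<in>verts G. f v \<le> u v \<and> complies gl (sum f (closed_nbhd G v)) (k v)) \<and>
       complies gl B (sum f (verts G)))"
  by (cases gl)
    (simp_all add: gpf_max_ge_iff[OF assms] gdf_min_le_iff gpf_feasible_def gdf_feasible_def)

lemma attains_cong:
  assumes "finite (verts G)" "\<And>v. v \<in> verts G \<Longrightarrow> k v = k' v" "\<And>v. v \<in> verts G \<Longrightarrow> u v = u' v"
  shows "attains gl G k u B \<longleftrightarrow> attains gl G k' u' B"
  using assms by (simp add: attains_iff)

lemma lpf_max_eq_gpf_max: "lpf_max l G k t = gpf_max G k (\<lambda>v. l * label_code (t v))"
proof -
  have "f v \<le> l \<and> (t v = Zero \<longrightarrow> f v = 0) \<longleftrightarrow> f v \<le> l * label_code (t v)" for f v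
    by (cases "t v") auto
  then have "lpf_feasible l G k t f \<longleftrightarrow> gpf_feasible G k (\<lambda>v. l * label_code (t v)) f" for f
    unfolding lpf_feasible_def gpf_feasible_def by (intro ball_cong refl) metis
  then show ?thesis by (simp add: lpf_max_def gpf_max_def)
qed

locale split_system =
  fixes vl :: "'v list" and universal weighted :: "'v \<Rightarrow> bool" and inc :: "'v \<Rightarrow> 'v \<Rightarrow> bool"
  assumes distinct_vl: "distinct vl" and exclusive: "\<not> (universal v \<and> weighted v)"
    and ex_universal: "\<exists>v\<in>set vl. universal v"
begin

abbreviation "G \<equiv> list_graph vl (split_adj universal weighted inc)"

definition carriers :: "'v set" where
  "carriers = {x \<in> set vl. weighted x}"

definition scope :: "'v \<Rightarrow> 'v set" where
  "scope v = (if universal v \<or> weighted v then carriers else {x \<in> carriers. inc v x})"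

lemma simple_graph_G: "simple_graph G"
  by (rule simple_graph_list_graph) (auto simp: irreflp_def split_adj_def)

lemma nth_eq_iff: "i < length vl \<Longrightarrow> j < length vl \<Longrightarrow> vl ! i = vl ! j \<longleftrightarrow> i = j"
  using distinct_vl by (rule nth_eq_iff_index_eq)

lemma doubly_chordal_G: "doubly_chordal G"
proof -
  note edge_iff = edges_list_graph_iff[OF symp_split_adj]
  obtain u where "u < length vl" "universal (vl ! u)"
    using ex_universal by (auto simp: in_set_conv_nth)
  then have "universal_vertex G u"
    by (auto simp: universal_vertex_def edge_iff split_adj_def nth_eq_iff)
  then have "dually_chordal G" by (intro dually_chordal_if_universal) auto
  moreover have "split_by G {i. universal (vl ! i) \<or> weighted (vl ! i)}"
    by (auto simp: split_by_def edge_iff split_adj_def nth_eq_iff)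
  ultimately show ?thesis by (auto simp: doubly_chordal_def intro: chordal_if_split)
qed

definition vertex_weights :: "('v \<Rightarrow> nat) \<Rightarrow> nat \<Rightarrow> nat" where
  "vertex_weights F i = (if weighted (vl ! i) then F (vl ! i) else 0)"

lemma sum_vertex_weights:
  "sum (vertex_weights F) {i. i < length vl \<and> P (vl ! i)} = sum F {x \<in> carriers. P x}"
proof -
  have "sum (vertex_weights F) {i. i < length vl \<and> P (vl ! i)} =
    (\<Sum>i | i < length vl \<and> weighted (vl ! i) \<and> P (vl ! i). F (vl ! i))"
    by (rule sum.mono_neutral_cong_right) (auto simp: vertex_weights_def)
  also have "\<dots> = sum F {x \<in> carriers. P x}"
    by (rule sum.reindex_bij_betw)
      (auto simp: bij_betw_def inj_on_def nth_eq_iff in_set_conv_nth carriers_def)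
  finally show ?thesis .
qed

lemma sum_vertex_weights_closed_nbhd:
  assumes "i < length vl"
  shows "sum (vertex_weights F) (closed_nbhd G i) = sum F (scope (vl ! i))"
proof -
  let ?near = "\<lambda>v. v = vl ! i \<or> split_adj universal weighted inc v (vl ! i)"
  have "closed_nbhd G i = {j. j < length vl \<and> ?near (vl ! j)}"
    using assms by (auto simp: closed_nbhd_def edges_list_graph_iff[OF symp_split_adj] nth_eq_iff)
  moreover have "{x \<in> carriers. ?near x} = scope (vl ! i)"
    using exclusive by (auto simp: scope_def split_adj_def carriers_def)
  ultimately show ?thesis using sum_vertex_weights[of F ?near] by simp
qed

lemma sum_all_vertex_weights: "sum (vertex_weights F) {..<length vl} = sum F carriers"
  using sum_vertex_weights[of F "\<lambda>_. True"] by (simp add: lessThan_def)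

lemma ex_vertex_weights:
  assumes "\<And>i. i < length vl \<Longrightarrow> \<not> weighted (vl ! i) \<Longrightarrow> f i = 0"
  obtains F where "\<And>i. i < length vl \<Longrightarrow> f i = vertex_weights F i"
proof
  have inj: "inj_on (\<lambda>i. vl ! i) {..<length vl}" by (auto simp: inj_on_def nth_eq_iff)
  fix i assume "i < length vl"
  then show "f i = vertex_weights (f \<circ> inv_into {..<length vl} (\<lambda>i. vl ! i)) i"
    using assms inv_into_f_f[OF inj, of i] by (simp add: vertex_weights_def)
qed

theorem attains_iff_ex_weights:
  "attains gl G (\<lambda>i. k (vl ! i)) (\<lambda>i. l * of_bool (weighted (vl ! i))) B \<longleftrightarrow>
    (\<exists>F. (\<forall>x\<in>carriers. F x \<le> l) \<and> (\<forall>v\<in>set vl. complies gl (sum F (scope v)) (k v)) \<and>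
       complies gl B (sum F carriers))" (is "_ \<longleftrightarrow> (\<exists>F. ?good F)")
proof -
  let ?feasible = "\<lambda>f. (\<forall>i<length vl. f i \<le> l * of_bool (weighted (vl ! i)) \<and>
      complies gl (sum f (closed_nbhd G i)) (k (vl ! i))) \<and> complies gl B (sum f {..<length vl})"
  have good_iff: "?good F \<longleftrightarrow> ?feasible (vertex_weights F)" for F
  proof -
    have "(\<forall>x\<in>carriers. F x \<le> l) \<longleftrightarrow>
        (\<forall>i<length vl. vertex_weights F i \<le> l * of_bool (weighted (vl ! i)))"
      by (auto simp: vertex_weights_def carriers_def in_set_conv_nth)
    then show ?thesis
      by (auto simp: sum_all_vertex_weights sum_vertex_weights_closed_nbhd all_set_conv_all_nth)
  qed
  have "\<exists>F. ?good F" if f: "?feasible f" for f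
  proof -
    have "f i = 0" if "i < length vl" "\<not> weighted (vl ! i)" for i
      using f that by fastforce
    then obtain F where F: "\<And>i. i < length vl \<Longrightarrow> f i = vertex_weights F i"
      using ex_vertex_weights by blast
    then have "sum f A = sum (vertex_weights F) A" if "A \<subseteq> {..<length vl}" for A
      using that by (intro sum.cong) auto
    then have "?feasible (vertex_weights F)"
      using f F by (simp add: closed_nbhd_def)
    then show ?thesis using good_iff by blast
  qed
  moreover have "attains gl G (\<lambda>i. k (vl ! i)) (\<lambda>i. l * of_bool (weighted (vl ! i))) B \<longleftrightarrow>
      (\<exists>f. ?feasible f)"
    by (subst attains_iff) (simp_all only: verts_list_graph lessThan_iff Ball_def finite_lessThan)
  ultimately show ?thesis using good_iff by blast
qed

end

definition transversal :: "('v \<Rightarrow> 'g) \<Rightarrow> 'v set \<Rightarrow> 'v set \<Rightarrow> bool" where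
  "transversal grp X A \<longleftrightarrow> A \<subseteq> X \<and> bij_betw grp A (grp ` X)"

lemma transversal_if_unit_group_sums:
  fixes F :: "'v \<Rightarrow> nat"
  assumes "finite X" and unit: "\<forall>g\<in>grp ` X. sum F {x \<in> X. grp x = g} = 1"
  shows "\<exists>A. transversal grp X A \<and> (\<forall>x\<in>X. F x = of_bool (x \<in> A))"
proof -
  have heaviest: "\<exists>y\<in>X. grp y = grp x \<and> F y = 1 \<and> (\<forall>z\<in>X. grp z = grp x \<longrightarrow> z \<noteq> y \<longrightarrow> F z = 0)"
    if "x \<in> X" for x
  proof -
    have "sum F {y \<in> X. grp y = grp x} = 1" using unit that by blast
    then show ?thesis using assms(1) by (auto simp: sum_eq_Suc0_iff)
  qed
  let ?A = "{x \<in> X. F x \<noteq> 0}"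
  have "x = y" if "x \<in> ?A" "y \<in> ?A" "grp x = grp y" for x y
    using heaviest[of x] that by (metis (mono_tags, lifting) mem_Collect_eq)
  then have "inj_on grp ?A" by (rule inj_onI)
  moreover have "grp x \<in> grp ` ?A" if "x \<in> X" for x
  proof -
    obtain y where "y \<in> X" "grp y = grp x" "F y = 1" using heaviest[OF \<open>x \<in> X\<close>] by blast
    then show ?thesis by (intro image_eqI[of _ _ y]) auto
  qed
  then have "grp ` ?A = grp ` X" by blast
  ultimately have "transversal grp X ?A" by (auto simp: transversal_def bij_betw_def)
  moreover have "F x = 0 \<or> F x = 1" if "x \<in> X" for x
    using heaviest[OF that] that by metis
  then have "\<forall>x\<in>X. F x = of_bool (x \<in> ?A)" by force
  ultimately show ?thesis by blast
qed

lemma group_sum_of_transversal: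
  fixes F :: "'v \<Rightarrow> nat"
  assumes "finite X" "transversal grp X A" "\<forall>x\<in>X. F x = of_bool (x \<in> A)" "g \<in> grp ` X"
  shows "sum F {x \<in> X. grp x = g} = 1"
proof -
  have A: "A \<subseteq> X" "inj_on grp A" "grp ` A = grp ` X"
    using assms(2) by (auto simp: transversal_def bij_betw_def)
  then obtain a where a: "a \<in> A" "grp a = g" using assms(4) by (metis imageE)
  then have "sum F {x \<in> X. grp x = g} = sum F {a}"
    using A assms(1,3) by (intro sum.mono_neutral_right) (auto dest: inj_onD)
  then show ?thesis using a A(1) assms(3) by auto
qed

lemma complies_sum_if_group_sums:
  fixes F :: "'v \<Rightarrow> nat"
  assumes fin: "finite X" and groups: "\<And>g. g \<in> grp ` X \<Longrightarrow> complies gl (sum F {x \<in> X. grp x = g}) 1"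
  shows "complies gl (sum F X) (card (grp ` X))"
proof -
  have "sum F X = (\<Sum>g\<in>grp ` X. sum F {x \<in> X. grp x = g})" by (rule sum.image_gen[OF fin, of F grp])
  moreover have "complies gl (\<Sum>g\<in>grp ` X. sum F {x \<in> X. grp x = g}) (\<Sum>g\<in>grp ` X. 1)"
  proof (cases gl)
    case Packing
    then show ?thesis using groups by (simp only: complies.simps) (intro sum_mono)
  next
    case Covering
    then show ?thesis using groups by (simp only: complies.simps) (intro sum_mono)
  qed
  ultimately show ?thesis by simp
qed

text \<open>The group sums add up to the total weight, so the bound on the total leaves no slack.\<close>

lemma group_sums_eq_1:
  fixes F :: "'v \<Rightarrow> nat"
  assumes fin: "finite X" and groups: "\<And>g. g \<in> grp ` X \<Longrightarrow> complies gl (sum F {x \<in> X. grp x = g}) 1"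
    and total: "complies gl (card (grp ` X)) (sum F X)" and g: "g \<in> grp ` X"
  shows "sum F {x \<in> X. grp x = g} = 1"
proof -
  have "sum F X = card (grp ` X)"
    using total complies_sum_if_group_sums[OF fin groups] by (cases gl) auto
  then have total_eq: "(\<Sum>g\<in>grp ` X. sum F {x \<in> X. grp x = g}) = (\<Sum>g\<in>grp ` X. 1)"
    using sum.image_gen[OF fin, of F grp] by simp
  show ?thesis
  proof (cases gl)
    case Packing
    then have at_most_1: "sum F {x \<in> X. grp x = h} \<le> 1" if "h \<in> grp ` X" for h
      using groups[OF that] by simp
    from sum_mono_inv[OF total_eq at_most_1 g] show ?thesis using fin by simp
  next
    case Covering
    then have at_least_1: "1 \<le> sum F {x \<in> X. grp x = h}" if "h \<in> grp ` X" for h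
      using groups[OF that] by simp
    from sum_mono_inv[OF total_eq[symmetric] at_least_1 g] show ?thesis using fin by simp
  qed
qed

definition opponents :: "('v \<Rightarrow> 'g) \<Rightarrow> 'v set \<Rightarrow> 'v set \<Rightarrow> 'v set" where
  "opponents grp X N = {y \<in> X. \<exists>x\<in>N. grp y = grp x \<and> y \<noteq> x}"

fun clause_scope :: "goal \<Rightarrow> ('v \<Rightarrow> 'g) \<Rightarrow> 'v set \<Rightarrow> 'v set \<Rightarrow> 'v set" where
  "clause_scope Packing grp X N = N"
| "clause_scope Covering grp X N = opponents grp X N"

fun clause_bound :: "goal \<Rightarrow> 'v set \<Rightarrow> nat" where
  "clause_bound Packing N = card N - 1"
| "clause_bound Covering N = 1"

lemma complies_clause_iff_not_subset:
  assumes "finite X" "transversal grp X A" "N \<subseteq> X" "N \<noteq> {}"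
  shows "complies gl (\<Sum>x\<in>clause_scope gl grp X N. of_bool (x \<in> A)) (clause_bound gl N) \<longleftrightarrow> \<not> N \<subseteq> A"
proof (cases gl)
  case Packing
  have fin: "finite N" using assms finite_subset by blast
  then have "0 < card N" using assms(4) by (simp add: card_gt_0_iff)
  then have "card (N \<inter> A) \<le> card N - 1 \<longleftrightarrow> card (N \<inter> A) < card N" by linarith
  also have "\<dots> \<longleftrightarrow> \<not> N \<subseteq> A"
    using psubset_card_mono[OF fin, of "N \<inter> A"] by (auto simp: Int_absorb2)
  finally show ?thesis using fin by (simp add: Packing)
next
  case Covering
  have A: "A \<subseteq> X" "inj_on grp A" "grp ` A = grp ` X"
    using assms(2) by (auto simp: transversal_def bij_betw_def)
  have "finite (opponents grp X N)" using assms(1) by (simp add: opponents_def)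
  then have "complies gl (\<Sum>x\<in>clause_scope gl grp X N. of_bool (x \<in> A)) (clause_bound gl N) \<longleftrightarrow>
    opponents grp X N \<inter> A \<noteq> {}"
    by (simp add: Covering Suc_le_eq card_gt_0_iff)
  also have "\<dots> \<longleftrightarrow> (\<exists>x\<in>N. x \<notin> A)"
  proof
    assume "opponents grp X N \<inter> A \<noteq> {}"
    then show "\<exists>x\<in>N. x \<notin> A" using A(2) by (auto simp: opponents_def dest: inj_onD)
  next
    assume "\<exists>x\<in>N. x \<notin> A"
    then obtain x where x: "x \<in> N" "x \<notin> A" by blast
    then have "grp x \<in> grp ` A" using A(3) assms(3) by blast
    then obtain y where "y \<in> A" "grp y = grp x" by (metis imageE)
    then show "opponents grp X N \<inter> A \<noteq> {}" using x A(1) by (auto simp: opponents_def)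
  qed
  finally show ?thesis by blast
qed

lemma complies_clauses_iff_no_subset:
  fixes N :: "'c \<Rightarrow> 'v set" and F :: "'v \<Rightarrow> nat"
  assumes fin: "finite X" and A: "transversal grp X A" and F: "\<forall>x\<in>X. F x = of_bool (x \<in> A)"
    and N: "\<forall>c\<in>C. N c \<subseteq> X \<and> N c \<noteq> {}"
  shows "(\<forall>c\<in>C. complies gl (sum F (clause_scope gl grp X (N c))) (clause_bound gl (N c))) \<longleftrightarrow>
    (\<forall>c\<in>C. \<not> N c \<subseteq> A)"
proof (intro ball_cong refl)
  fix c assume c: "c \<in> C"
  have "clause_scope gl grp X (N c) \<subseteq> X" using N c by (cases gl) (auto simp: opponents_def)
  then have "sum F (clause_scope gl grp X (N c)) =
      (\<Sum>x\<in>clause_scope gl grp X (N c). of_bool (x \<in> A))"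
    using F by (intro sum.cong) auto
  then show "complies gl (sum F (clause_scope gl grp X (N c))) (clause_bound gl (N c)) \<longleftrightarrow>
      \<not> N c \<subseteq> A"
    using complies_clause_iff_not_subset[OF fin A, of "N c"] N c by simp
qed

theorem ex_weights_iff_ex_transversal:
  fixes grp :: "'v \<Rightarrow> 'g" and N :: "'c \<Rightarrow> 'v set" and l :: nat
  assumes fin: "finite X" and l: "l \<ge> 1"
    and N: "\<forall>c\<in>C. N c \<subseteq> X \<and> N c \<noteq> {}"
  shows "(\<exists>F. (\<forall>x\<in>X. F x \<le> l) \<and> (\<forall>g\<in>grp ` X. complies gl (sum F {x \<in> X. grp x = g}) 1) \<and>
       (\<forall>c\<in>C. complies gl (sum F (clause_scope gl grp X (N c))) (clause_bound gl (N c))) \<and>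
       complies gl (card (grp ` X)) (sum F X)) \<longleftrightarrow>
    (\<exists>A. transversal grp X A \<and> (\<forall>c\<in>C. \<not> N c \<subseteq> A))" (is "(\<exists>F. ?good F) \<longleftrightarrow> ?rhs")
proof
  assume "\<exists>F. ?good F"
  then obtain F where good: "?good F" ..
  then have "\<forall>g\<in>grp ` X. sum F {x \<in> X. grp x = g} = 1"
    by (intro ballI group_sums_eq_1[OF fin, where gl = gl]) blast+
  then obtain A where A: "transversal grp X A" "\<forall>x\<in>X. F x = of_bool (x \<in> A)"
    using transversal_if_unit_group_sums[OF fin] by metis
  show ?rhs using good A(1) unfolding complies_clauses_iff_no_subset[OF fin A N] by blast
next
  assume ?rhs
  then obtain A where A: "transversal grp X A" "\<forall>c\<in>C. \<not> N c \<subseteq> A" by blast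
  define F :: "'v \<Rightarrow> nat" where "F x = of_bool (x \<in> A)" for x
  have F: "\<forall>x\<in>X. F x = of_bool (x \<in> A)" by (simp add: F_def)
  have unit: "sum F {x \<in> X. grp x = g} = 1" if "g \<in> grp ` X" for g
    by (rule group_sum_of_transversal[OF fin A(1) F that])
  have "sum F X = (\<Sum>g\<in>grp ` X. sum F {x \<in> X. grp x = g})"
    by (rule sum.image_gen[OF fin, of F grp])
  also have "\<dots> = (\<Sum>g\<in>grp ` X. 1)" by (rule sum.cong) (use unit in auto)
  finally have "sum F X = card (grp ` X)" by simp
  moreover have "complies gl s s" for s by (cases gl) auto
  moreover have "F x \<le> l" for x using l by (simp add: F_def)
  ultimately have "?good F"
    using unit A(2) unfolding complies_clauses_iff_no_subset[OF fin A(1) F N] by simp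
  then show "\<exists>F. ?good F" by (rule exI[of ?good F])
qed

section \<open>Computation tableaux\<close>

text \<open>A machine that can idle in the accepting state accepts within \<^term>\<open>T\<close> steps iff it accepts
  after exactly \<^term>\<open>T\<close> steps.\<close>

definition looping :: "tm \<Rightarrow> tm" where
  "looping M = M\<lparr>tm_trans := tm_trans M \<union> {(1, rs, 1, map (\<lambda>r. (r, MStay)) rs) | rs.
     length rs = tm_tapes M \<and> set rs \<subseteq> {..<tm_symbols M}}\<rparr>"

fun displacement :: "move \<Rightarrow> int" where
  "displacement MLeft = -1"
| "displacement MStay = 0"
| "displacement MRight = 1"

lemma displacement_cases: "displacement m = -1 \<or> displacement m = 0 \<or> displacement m = 1"
  by (cases m) auto

definition from_head :: "tape \<Rightarrow> int \<Rightarrow> nat" where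
  "from_head t j = fst t (snd t + j)"

lemma read_tape_eq_from_head: "read_tape t = from_head t 0"
  by (cases t) (simp add: from_head_def)

lemma from_head_act_tape:
  "from_head (act_tape a t) j =
    (if j + displacement (snd a) = 0 then fst a else from_head t (j + displacement (snd a)))"
proof -
  have "move_head m h = h + displacement m" for m h by (cases m) auto
  then show ?thesis by (cases a; cases t) (auto simp: from_head_def algebra_simps)
qed

lemma act_tape_idle: "act_tape (read_tape t, MStay) t = t"
  by (cases t) simp

lemma finite_UNIV_move: "finite (UNIV :: move set)"
  by (rule finite_subset[of _ "{MLeft, MStay, MRight}"]) (auto intro: move.exhaust)

locale tableau =
  fixes M :: tm
  assumes turing_machine_M: "turing_machine M"
begin

abbreviation "K \<equiv> tm_tapes M"
abbreviation "S \<equiv> tm_symbols M"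

lemma looping_trans_bounds:
  assumes "(q, rs, q', as) \<in> tm_trans (looping M)"
  shows "q < tm_states M" "q' < tm_states M" "length rs = K" "set rs \<subseteq> {..<S}"
    "length as = K" "fst ` set as \<subseteq> {..<S}"
  using assms turing_machine_M unfolding looping_def turing_machine_def by fastforce+

lemma finite_looping_trans: "finite (tm_trans (looping M))"
proof -
  let ?readings = "{rs. set rs \<subseteq> {..<S} \<and> length rs = K}"
  let ?actions = "{as. set as \<subseteq> {..<S} \<times> (UNIV :: move set) \<and> length as = K}"
  let ?all = "{..<tm_states M} \<times> ?readings \<times> {..<tm_states M} \<times> ?actions"
  have "tr \<in> ?all" if "tr \<in> tm_trans (looping M)" for tr
  proof -
    obtain q rs q' as where tr: "tr = (q, rs, q', as)" by (cases tr)
    then have "set as \<subseteq> {..<S} \<times> UNIV" using looping_trans_bounds(6)[of q rs q' as] that by force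
    then show ?thesis using looping_trans_bounds[of q rs q' as] that tr by simp
  qed
  moreover have "finite ?all"
    by (intro finite_cartesian_product finite_lists_length_eq finite_UNIV_move) auto
  ultimately show ?thesis using finite_subset[of "tm_trans (looping M)" ?all] by blast
qed

definition wf_config :: "config \<Rightarrow> bool" where
  "wf_config c \<longleftrightarrow> length (snd c) = K \<and> (\<forall>i<K. \<forall>j. from_head (snd c ! i) j < S)"

lemma tm_init_nth: "i < K \<Longrightarrow> snd (tm_init M x) ! i = (word_tape (if i = 0 then x else []), 0)"
  by (auto simp: tm_init_def nth_Cons split: nat.splits)

lemma length_tm_init: "length (snd (tm_init M x)) = K"
  using turing_machine_M by (simp add: tm_init_def turing_machine_def)

lemma wf_config_tm_init: "wf_config (tm_init M x)"
  using turing_machine_M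
  by (auto simp: wf_config_def length_tm_init tm_init_nth from_head_def word_tape_def
    turing_machine_def)

lemma wf_config_step:
  assumes "tm_step (looping M) c c'" "wf_config c"
  shows "wf_config c'"
proof -
  obtain q' as where tr: "(fst c, map read_tape (snd c), q', as) \<in> tm_trans (looping M)"
    and c': "c' = (q', map2 act_tape as (snd c))"
    using assms(1) unfolding tm_step_def by blast
  then have "length as = K" "\<And>i. i < K \<Longrightarrow> fst (as ! i) < S"
    using looping_trans_bounds(5,6)[OF tr] by (auto simp: image_subset_iff)
  then show ?thesis using assms(2) by (auto simp: wf_config_def c' from_head_act_tape)
qed

lemma looping_step_iff:
  assumes "wf_config c"
  shows "tm_step (looping M) c c' \<longleftrightarrow> tm_step M c c' \<or> fst c = 1 \<and> c' = c"
proof -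
  let ?idle = "map (\<lambda>r. (r, MStay)) (map read_tape (snd c))"
  have "read_tape t < S" if "t \<in> set (snd c)" for t
    using assms that by (metis in_set_conv_nth read_tape_eq_from_head wf_config_def)
  then have "set (map read_tape (snd c)) \<subseteq> {..<S}" "length (map read_tape (snd c)) = K"
    using assms by (simp_all add: wf_config_def image_subset_iff)
  then have trans: "(fst c, map read_tape (snd c), q', as) \<in> tm_trans (looping M) \<longleftrightarrow>
      (fst c, map read_tape (snd c), q', as) \<in> tm_trans M \<or> fst c = 1 \<and> q' = 1 \<and> as = ?idle"
      for q' as
    by (auto simp: looping_def)
  have "map2 act_tape ?idle (snd c) = snd c"
    by (rule nth_equalityI) (auto simp: act_tape_idle)
  then have "c' = (1, map2 act_tape ?idle (snd c)) \<longleftrightarrow> c' = c" if "fst c = 1"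
    using that by (simp add: prod_eq_iff)
  then show ?thesis unfolding tm_step_def trans by blast
qed

definition accepting_run :: "bool list \<Rightarrow> nat \<Rightarrow> (nat \<Rightarrow> config) \<Rightarrow> bool" where
  "accepting_run x T C \<longleftrightarrow> C 0 = tm_init M x \<and>
     (\<forall>\<tau>\<le>T. tm_step (looping M) (C \<tau>) (C (Suc \<tau>))) \<and> fst (C T) = 1"

lemma wf_config_run:
  assumes "accepting_run x T C" "\<tau> \<le> Suc T"
  shows "wf_config (C \<tau>)"
  using assms(2)
proof (induction \<tau>)
  case 0
  then show ?case using assms(1) wf_config_tm_init by (simp add: accepting_run_def)
next
  case (Suc \<tau>)
  then have "tm_step (looping M) (C \<tau>) (C (Suc \<tau>))" using assms(1) by (simp add: accepting_run_def)
  then show ?case using Suc wf_config_step by auto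
qed

lemma accepts_within_if_accepting_run:
  assumes run: "accepting_run x T C"
  shows "accepts_within M x T"
proof -
  have "\<exists>n\<le>\<tau>. (tm_step M ^^ n) (tm_init M x) (C \<tau>)" if "\<tau> \<le> T" for \<tau>
    using that
  proof (induction \<tau>)
    case 0
    then show ?case using run by (simp add: accepting_run_def)
  next
    case (Suc \<tau>)
    then obtain n where n: "n \<le> \<tau>" "(tm_step M ^^ n) (tm_init M x) (C \<tau>)" by auto
    have "tm_step (looping M) (C \<tau>) (C (Suc \<tau>))" "wf_config (C \<tau>)"
      using run wf_config_run[OF run] Suc.prems by (auto simp: accepting_run_def)
    then have "tm_step M (C \<tau>) (C (Suc \<tau>)) \<or> C (Suc \<tau>) = C \<tau>"
      using looping_step_iff by blast
    then show ?case
    proof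
      assume "tm_step M (C \<tau>) (C (Suc \<tau>))"
      then show ?thesis using n by (intro exI[of _ "Suc n"]) auto
    next
      assume "C (Suc \<tau>) = C \<tau>"
      then show ?thesis using n by (intro exI[of _ n]) auto
    qed
  qed
  from this[of T] show ?thesis
    using run unfolding accepts_within_def accepting_run_def by (metis order_refl prod.collapse)
qed

lemma accepting_run_if_accepts_within:
  assumes "accepts_within M x T"
  shows "\<exists>C. accepting_run x T C"
proof -
  obtain n ts where n: "n \<le> T" "(tm_step M ^^ n) (tm_init M x) (1, ts)"
    using assms unfolding accepts_within_def by blast
  then obtain f where f: "f 0 = tm_init M x" "f n = (1, ts)"
      "\<And>i. i < n \<Longrightarrow> tm_step M (f i) (f (Suc i))"
    unfolding relpowp_fun_conv by blast
  define C where "C \<tau> = f (min \<tau> n)" for \<tau>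
  have moves: "tm_step M (C \<tau>) (C (Suc \<tau>)) \<or> fst (C \<tau>) = 1 \<and> C (Suc \<tau>) = C \<tau>" for \<tau>
    using f(2,3) by (cases "\<tau> < n") (auto simp: C_def min_def)
  have "wf_config (C \<tau>)" for \<tau>
  proof (induction \<tau>)
    case 0
    then show ?case using f(1) wf_config_tm_init by (simp add: C_def)
  next
    case (Suc \<tau>)
    then show ?case using moves[of \<tau>] looping_step_iff wf_config_step by blast
  qed
  then have "\<forall>\<tau>\<le>T. tm_step (looping M) (C \<tau>) (C (Suc \<tau>))" using moves looping_step_iff by blast
  then show ?thesis using n f unfolding accepting_run_def
    by (intro exI[of _ C]) (simp add: C_def min_def)
qed

definition transitions :: "(nat \<times> nat list \<times> nat \<times> (nat \<times> move) list) list" where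
  "transitions = (SOME ts. set ts = tm_trans (looping M))"

lemma set_transitions: "set transitions = tm_trans (looping M)"
  unfolding transitions_def using finite_list[OF finite_looping_trans] by (rule someI_ex)

definition source :: "nat \<Rightarrow> nat" where
  "source a = fst (transitions ! a)"

definition scanned :: "nat \<Rightarrow> nat list" where
  "scanned a = fst (snd (transitions ! a))"

definition target :: "nat \<Rightarrow> nat" where
  "target a = fst (snd (snd (transitions ! a)))"

definition actions :: "nat \<Rightarrow> (nat \<times> move) list" where
  "actions a = snd (snd (snd (transitions ! a)))"

definition drift :: "nat \<Rightarrow> nat \<Rightarrow> int" where
  "drift a i = displacement (snd (actions a ! i))"

lemma transitions_nth: "transitions ! a = (source a, scanned a, target a, actions a)"
  by (simp add: source_def scanned_def target_def actions_def)

lemma transition_in_looping: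
  "a < length transitions \<Longrightarrow> (source a, scanned a, target a, actions a) \<in> tm_trans (looping M)"
  by (metis nth_mem set_transitions transitions_nth)

lemma length_scanned: "a < length transitions \<Longrightarrow> length (scanned a) = K"
  by (rule looping_trans_bounds(3)[OF transition_in_looping])

lemma length_actions: "a < length transitions \<Longrightarrow> length (actions a) = K"
  by (rule looping_trans_bounds(5)[OF transition_in_looping])

lemma drift_cases: "drift a i = -1 \<or> drift a i = 0 \<or> drift a i = 1"
  using displacement_cases by (simp add: drift_def)

lemma looping_step_iff_transition:
  "tm_step (looping M) c c' \<longleftrightarrow> (\<exists>a<length transitions. fst c = source a \<and>
     map read_tape (snd c) = scanned a \<and> c' = (target a, map2 act_tape (actions a) (snd c)))"
proof -
  have "(q, rs, q', as) \<in> tm_trans (looping M) \<longleftrightarrow>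
      (\<exists>a<length transitions. (q, rs, q', as) = (source a, scanned a, target a, actions a))"
      for q rs q' as
    unfolding set_transitions[symmetric] in_set_conv_nth transitions_nth by auto
  then show ?thesis unfolding tm_step_def by auto
qed

text \<open>The tableau of a computation of length \<^term>\<open>T\<close> has rows \<^term>\<open>\<tau> \<le> T\<close> and columns
  \<^term>\<open>z \<le> 2 * T\<close>. Group 0 at \<^term>\<open>(\<tau>, T)\<close> is the transition applied at time \<^term>\<open>\<tau>\<close>;
  group \<^term>\<open>Suc i\<close> at \<^term>\<open>(\<tau>, z)\<close> is the symbol on tape \<^term>\<open>i\<close> at distance
  \<^term>\<open>z - T\<close> from the head, so that heads never move and tapes do. The group 0 entries outside
  the central column carry no information.\<close>

definition domain_size :: "nat \<Rightarrow> nat" where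
  "domain_size g = (if g = 0 then length transitions else S)"

definition in_domain :: "nat \<Rightarrow> (nat \<Rightarrow> nat \<Rightarrow> nat \<Rightarrow> nat) \<Rightarrow> bool" where
  "in_domain T V \<longleftrightarrow> (\<forall>\<tau>\<le>T. \<forall>z\<le>2 * T. \<forall>g\<le>K. V \<tau> z g < domain_size g)"

definition initial_row :: "bool list \<Rightarrow> nat \<Rightarrow> (nat \<Rightarrow> nat \<Rightarrow> nat \<Rightarrow> nat) \<Rightarrow> bool" where
  "initial_row x T V \<longleftrightarrow>
     (\<forall>z\<le>2 * T. \<forall>i<K. V 0 z (Suc i) = (if i = 0 then word_tape x (int z - int T) else 0))"

definition scanned_entries :: "nat \<Rightarrow> (nat \<Rightarrow> nat \<Rightarrow> nat \<Rightarrow> nat) \<Rightarrow> bool" where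
  "scanned_entries T V \<longleftrightarrow> (\<forall>\<tau>\<le>T. \<forall>i<K. V \<tau> T (Suc i) = scanned (V \<tau> T 0) ! i)"

definition linked_states :: "nat \<Rightarrow> (nat \<Rightarrow> nat \<Rightarrow> nat \<Rightarrow> nat) \<Rightarrow> bool" where
  "linked_states T V \<longleftrightarrow> (\<forall>\<tau><T. source (V (Suc \<tau>) T 0) = target (V \<tau> T 0))"

definition shifted_rows :: "nat \<Rightarrow> (nat \<Rightarrow> nat \<Rightarrow> nat \<Rightarrow> nat) \<Rightarrow> bool" where
  "shifted_rows T V \<longleftrightarrow> (\<forall>\<tau><T. \<forall>z\<le>2 * T. \<forall>i<K. let a = V \<tau> T 0; z' = int z + drift a i in
     0 \<le> z' \<longrightarrow> z' \<le> 2 * int T \<longrightarrow>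
     V (Suc \<tau>) z (Suc i) = (if z' = int T then fst (actions a ! i) else V \<tau> (nat z') (Suc i)))"

definition legal :: "bool list \<Rightarrow> nat \<Rightarrow> (nat \<Rightarrow> nat \<Rightarrow> nat \<Rightarrow> nat) \<Rightarrow> bool" where
  "legal x T V \<longleftrightarrow> in_domain T V \<and> initial_row x T V \<and> source (V 0 T 0) = 0 \<and>
     source (V T T 0) = 1 \<and> scanned_entries T V \<and> linked_states T V \<and> shifted_rows T V"

lemma in_domainD: "in_domain T V \<Longrightarrow> \<tau> \<le> T \<Longrightarrow> z \<le> 2 * T \<Longrightarrow> g \<le> K \<Longrightarrow> V \<tau> z g < domain_size g"
  by (simp add: in_domain_def)

lemma in_domain_transition: "in_domain T V \<Longrightarrow> \<tau> \<le> T \<Longrightarrow> V \<tau> T 0 < length transitions"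
  using in_domainD[of T V \<tau> T 0] by (simp add: domain_size_def)

lemma in_domain_symbol: "in_domain T V \<Longrightarrow> \<tau> \<le> T \<Longrightarrow> z \<le> 2 * T \<Longrightarrow> i < K \<Longrightarrow> V \<tau> z (Suc i) < S"
  using in_domainD[of T V \<tau> z "Suc i"] by (simp add: domain_size_def)

definition recorded :: "nat \<Rightarrow> (nat \<Rightarrow> nat) \<Rightarrow> (nat \<Rightarrow> config) \<Rightarrow> nat \<Rightarrow> nat \<Rightarrow> nat \<Rightarrow> nat" where
  "recorded T A C \<tau> z g =
     (if g = 0 then A \<tau> else from_head (snd (C \<tau>) ! (g - 1)) (int z - int T))"

lemma recorded_simps [simp]:
  "recorded T A C \<tau> z 0 = A \<tau>"
  "recorded T A C \<tau> z (Suc i) = from_head (snd (C \<tau>) ! i) (int z - int T)"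
  by (simp_all add: recorded_def)

lemma legal_if_accepting_run:
  assumes run: "accepting_run x T C"
  shows "\<exists>V. legal x T V"
proof -
  have "\<exists>a<length transitions. fst (C \<tau>) = source a \<and> map read_tape (snd (C \<tau>)) = scanned a \<and>
      C (Suc \<tau>) = (target a, map2 act_tape (actions a) (snd (C \<tau>)))" if "\<tau> \<le> T" for \<tau>
    using run that by (auto simp: accepting_run_def looping_step_iff_transition)
  then obtain A where A: "\<And>\<tau>. \<tau> \<le> T \<Longrightarrow> A \<tau> < length transitions"
    "\<And>\<tau>. \<tau> \<le> T \<Longrightarrow> fst (C \<tau>) = source (A \<tau>)"
    "\<And>\<tau>. \<tau> \<le> T \<Longrightarrow> map read_tape (snd (C \<tau>)) = scanned (A \<tau>)"
    "\<And>\<tau>. \<tau> \<le> T \<Longrightarrow> C (Suc \<tau>) = (target (A \<tau>), map2 act_tape (actions (A \<tau>)) (snd (C \<tau>)))"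
    by metis
  have wf: "length (snd (C \<tau>)) = K" "\<And>i j. i < K \<Longrightarrow> from_head (snd (C \<tau>) ! i) j < S" if "\<tau> \<le> T" for \<tau>
    using wf_config_run[OF run, of \<tau>] that by (auto simp: wf_config_def)
  have init: "C 0 = tm_init M x" and final: "fst (C T) = 1"
    using run by (auto simp: accepting_run_def)
  let ?V = "recorded T A C"
  have "in_domain T ?V"
    using A(1) wf(2) by (auto simp: in_domain_def domain_size_def recorded_def)
  moreover have "initial_row x T ?V"
    by (auto simp: initial_row_def init tm_init_nth from_head_def word_tape_def)
  moreover have "source (?V 0 T 0) = 0" "source (?V T T 0) = 1"
    using A(2)[of 0] A(2)[of T] init final by (simp_all add: tm_init_def)
  moreover have "scanned_entries T ?V"
    using wf(1) by (auto simp: scanned_entries_def A(3)[symmetric] read_tape_eq_from_head)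
  moreover have "linked_states T ?V"
    using A(2)[of "Suc _"] A(4) by (auto simp: linked_states_def dest!: Suc_leI)
  moreover have "shifted_rows T ?V"
    unfolding shifted_rows_def Let_def
    using A(1,4) wf(1) length_actions
    by (auto simp: from_head_act_tape drift_def algebra_simps)
  ultimately show ?thesis unfolding legal_def by blast
qed

primrec replayed :: "bool list \<Rightarrow> (nat \<Rightarrow> nat) \<Rightarrow> nat \<Rightarrow> config" where
  "replayed x A 0 = tm_init M x"
| "replayed x A (Suc \<tau>) = (target (A \<tau>), map2 act_tape (actions (A \<tau>)) (snd (replayed x A \<tau>)))"

text \<open>Since the tapes may drift, row \<^term>\<open>\<tau>\<close> is only meaningful within distance
  \<^term>\<open>T - \<tau>\<close> from the heads.\<close>

definition depicts :: "nat \<Rightarrow> (nat \<Rightarrow> nat \<Rightarrow> nat \<Rightarrow> nat) \<Rightarrow> nat \<Rightarrow> config \<Rightarrow> bool" where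
  "depicts T V \<tau> c \<longleftrightarrow> fst c = source (V \<tau> T 0) \<and> length (snd c) = K \<and>
     (\<forall>i<K. \<forall>z. \<bar>int z - int T\<bar> \<le> int T - int \<tau> \<longrightarrow>
        V \<tau> z (Suc i) = from_head (snd c ! i) (int z - int T))"

lemma depicts_replayed:
  assumes legal: "legal x T V"
  shows "\<tau> \<le> T \<Longrightarrow> depicts T V \<tau> (replayed x (\<lambda>\<tau>. V \<tau> T 0) \<tau>)"
proof (induction \<tau>)
  case 0
  show ?case using legal
    by (auto simp: depicts_def legal_def initial_row_def length_tm_init tm_init_nth from_head_def
      word_tape_def)
      (simp add: tm_init_def)
next
  case (Suc \<tau>)
  let ?A = "\<lambda>\<tau>. V \<tau> T 0"
  have \<tau>: "\<tau> < T" using Suc.prems by simp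
  have depicted: "depicts T V \<tau> (replayed x ?A \<tau>)" using Suc by simp
  have acts: "length (actions (?A \<tau>)) = K"
    using legal \<tau> by (intro length_actions in_domain_transition) (auto simp: legal_def)
  have "V (Suc \<tau>) z (Suc i) = from_head (snd (replayed x ?A (Suc \<tau>)) ! i) (int z - int T)"
    if i: "i < K" and z: "\<bar>int z - int T\<bar> \<le> int T - int (Suc \<tau>)" for i z
  proof -
    let ?z' = "int z + drift (?A \<tau>) i"
    have z': "0 \<le> ?z'" "?z' \<le> 2 * int T" "\<bar>int (nat ?z') - int T\<bar> \<le> int T - int \<tau>"
      using z drift_cases[of "?A \<tau>" i] by auto
    have "V (Suc \<tau>) z (Suc i) =
        (if ?z' = int T then fst (actions (?A \<tau>) ! i) else V \<tau> (nat ?z') (Suc i))"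
      using legal \<tau> z' i z by (auto simp: legal_def shifted_rows_def Let_def)
    also have "V \<tau> (nat ?z') (Suc i) = from_head (snd (replayed x ?A \<tau>) ! i) (?z' - int T)"
      using depicted i z' by (simp add: depicts_def)
    finally show ?thesis using depicted acts i
      by (simp add: depicts_def from_head_act_tape drift_def algebra_simps)
  qed
  then show ?case using legal \<tau> depicted acts by (simp add: depicts_def legal_def linked_states_def)
qed

lemma accepting_run_if_legal:
  assumes legal: "legal x T V"
  shows "\<exists>C. accepting_run x T C"
proof -
  let ?A = "\<lambda>\<tau>. V \<tau> T 0"
  let ?C = "replayed x ?A"
  have "tm_step (looping M) (?C \<tau>) (?C (Suc \<tau>))" if \<tau>: "\<tau> \<le> T" for \<tau>
  proof -
    note depicted = depicts_replayed[OF legal \<tau>, unfolded depicts_def]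
    have a: "?A \<tau> < length transitions"
      using legal \<tau> by (intro in_domain_transition) (auto simp: legal_def)
    have "map read_tape (snd (?C \<tau>)) = scanned (?A \<tau>)"
    proof (rule nth_equalityI)
      show "length (map read_tape (snd (?C \<tau>))) = length (scanned (?A \<tau>))"
        using depicted length_scanned[OF a] by simp
      fix i assume "i < length (map read_tape (snd (?C \<tau>)))"
      then have i: "i < K" using depicted by simp
      then have "V \<tau> T (Suc i) = from_head (snd (?C \<tau>) ! i) (int T - int T)"
        using depicted \<tau> by (simp del: diff_self)
      then have "from_head (snd (?C \<tau>) ! i) 0 = scanned (?A \<tau>) ! i"
        using legal \<tau> i by (simp add: legal_def scanned_entries_def)
      then show "map read_tape (snd (?C \<tau>)) ! i = scanned (?A \<tau>) ! i"
        using i depicted by (simp add: read_tape_eq_from_head)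
    qed
    then show ?thesis
      using a depicted by (auto simp: looping_step_iff_transition)
  qed
  moreover have "fst (?C T) = 1"
    using depicts_replayed[OF legal, of T] legal by (simp add: depicts_def legal_def)
  ultimately show ?thesis by (intro exI[of _ ?C]) (simp add: accepting_run_def)
qed

theorem accepts_within_iff_legal: "accepts_within M x T \<longleftrightarrow> (\<exists>V. legal x T V)"
  using accepts_within_if_accepting_run accepting_run_if_accepts_within
    legal_if_accepting_run accepting_run_if_legal by blast

end

section \<open>Tableaux as transversals\<close>

text \<open>Reading it tells a head whether it stands at -1, 0, 1 or elsewhere.\<close>

definition marks :: "int \<Rightarrow> nat" where
  "marks j = (if j = -1 then 1 else if j = 0 then 2 else if j = 1 then 3 else 0)"

lemma marks_eq_2_iff [simp]: "marks j = 2 \<longleftrightarrow> j = 0"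
  by (auto simp: marks_def)

lemma marks_eq_iff: "k = -1 \<or> k = 0 \<or> k = 1 \<Longrightarrow> marks j = marks k \<longleftrightarrow> j = k"
  by (auto simp: marks_def)

text \<open>All that the clauses and the right-hand sides at an entry of the tableau depend on.\<close>

record observation =
  time_mark :: nat
  end_mark :: nat
  left_mark :: nat
  centre_mark :: nat
  right_mark :: nat
  input_symbol :: nat

definition observe :: "bool list \<Rightarrow> nat \<Rightarrow> nat \<Rightarrow> nat \<Rightarrow> observation" where
  "observe x T \<tau> z = \<lparr>
     time_mark = marks (int \<tau>),
     end_mark = marks (int \<tau> - int T),
     left_mark = marks (int z),
     centre_mark = marks (int z - int T),
     right_mark = marks (int z - 2 * int T),
     input_symbol = word_tape x (int z - int T)\<rparr>"

datatype place = Offset int | Centre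

fun column :: "nat \<Rightarrow> nat \<Rightarrow> place \<Rightarrow> nat" where
  "column T z (Offset d) = nat (int z + d)"
| "column T z Centre = T"

text \<open>The place of a literal is relative to the clause. A clause forbids that all its literals hold.\<close>

type_synonym literal = "nat \<times> place \<times> nat \<times> nat"

datatype clause =
    Initial nat nat
  | Start nat
  | Halt nat
  | Scan nat nat nat
  | Link nat nat
  | Drift nat nat nat nat

context tableau
begin

fun literals :: "clause \<Rightarrow> literal list" where
  "literals (Initial i s) = [(0, Offset 0, Suc i, s)]"
| "literals (Start a) = [(0, Centre, 0, a)]"
| "literals (Halt a) = [(0, Centre, 0, a)]"
| "literals (Scan i a s) = [(0, Centre, 0, a), (0, Centre, Suc i, s)]"
| "literals (Link a b) = [(0, Centre, 0, a), (1, Centre, 0, b)]"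
| "literals (Drift i a s s') =
     [(0, Centre, 0, a), (0, Offset (drift a i), Suc i, s), (1, Offset 0, Suc i, s')]"

fun active :: "observation \<Rightarrow> clause \<Rightarrow> bool" where
  "active ob (Initial i s) \<longleftrightarrow> time_mark ob = 2 \<and> s \<noteq> (if i = 0 then input_symbol ob else 0)"
| "active ob (Start a) \<longleftrightarrow> time_mark ob = 2 \<and> source a \<noteq> 0"
| "active ob (Halt a) \<longleftrightarrow> end_mark ob = 2 \<and> source a \<noteq> 1"
| "active ob (Scan i a s) \<longleftrightarrow> scanned a ! i \<noteq> s"
| "active ob (Link a b) \<longleftrightarrow> end_mark ob \<noteq> 2 \<and> target a \<noteq> source b"
| "active ob (Drift i a s s') \<longleftrightarrow> end_mark ob \<noteq> 2 \<and>
     (drift a i = -1 \<longrightarrow> left_mark ob \<noteq> 2) \<and> (drift a i = 1 \<longrightarrow> right_mark ob \<noteq> 2) \<and>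
     s' \<noteq> (if centre_mark ob = marks (- drift a i) then fst (actions a ! i) else s)"

fun valid_clause :: "clause \<Rightarrow> bool" where
  "valid_clause (Initial i s) \<longleftrightarrow> i < K \<and> s < S"
| "valid_clause (Start a) \<longleftrightarrow> a < length transitions"
| "valid_clause (Halt a) \<longleftrightarrow> a < length transitions"
| "valid_clause (Scan i a s) \<longleftrightarrow> i < K \<and> a < length transitions \<and> s < S"
| "valid_clause (Link a b) \<longleftrightarrow> a < length transitions \<and> b < length transitions"
| "valid_clause (Drift i a s s') \<longleftrightarrow> i < K \<and> a < length transitions \<and> s < S \<and> s' < S"

definition solves :: "bool list \<Rightarrow> nat \<Rightarrow> (nat \<Rightarrow> nat \<Rightarrow> nat \<Rightarrow> nat) \<Rightarrow> bool" where
  "solves x T V \<longleftrightarrow> in_domain T V \<and>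
     (\<forall>\<tau>\<le>T. \<forall>z\<le>2 * T. \<forall>c. valid_clause c \<longrightarrow> active (observe x T \<tau> z) c \<longrightarrow>
        \<not> (\<forall>(dt, p, g, v)\<in>set (literals c). V (\<tau> + dt) (column T z p) g = v))"

lemma active_Drift_iff:
  "active (observe x T \<tau> z) (Drift i a s s') \<longleftrightarrow> \<tau> \<noteq> T \<and>
     (drift a i = -1 \<longrightarrow> z \<noteq> 0) \<and> (drift a i = 1 \<longrightarrow> z \<noteq> 2 * T) \<and>
     s' \<noteq> (if int z + drift a i = int T then fst (actions a ! i) else s)"
proof -
  have "marks (int z - int T) = marks (- drift a i) \<longleftrightarrow> int z + drift a i = int T"
    using drift_cases[of a i] by (subst marks_eq_iff) auto
  then show ?thesis by (auto simp: observe_def)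
qed

lemma active_Drift_bounds:
  assumes "active (observe x T \<tau> z) (Drift i a s s')" "\<tau> \<le> T" "z \<le> 2 * T"
  shows "\<tau> < T" "0 \<le> int z + drift a i" "int z + drift a i \<le> 2 * int T"
  using assms drift_cases[of a i] by (auto simp: active_Drift_iff simp del: active.simps)

lemma legal_if_solves:
  assumes "solves x T V"
  shows "legal x T V"
proof -
  have in_dom: "in_domain T V" and inactive: "\<And>\<tau> z c. \<tau> \<le> T \<Longrightarrow> z \<le> 2 * T \<Longrightarrow> valid_clause c \<Longrightarrow>
      (\<forall>(dt, p, g, v)\<in>set (literals c). V (\<tau> + dt) (column T z p) g = v) \<Longrightarrow>
      \<not> active (observe x T \<tau> z) c"
    using assms unfolding solves_def by blast+
  note transition = in_domain_transition[OF in_dom] and symbol = in_domain_symbol[OF in_dom]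
  have "V 0 z (Suc i) = (if i = 0 then word_tape x (int z - int T) else 0)"
    if "z \<le> 2 * T" "i < K" for z i
    using inactive[of 0 z "Initial i (V 0 z (Suc i))"] symbol[of 0 z i] that
    by (simp add: observe_def split: if_splits)
  then have "initial_row x T V" by (simp add: initial_row_def)
  moreover have "source (V 0 T 0) = 0"
    using inactive[of 0 T "Start (V 0 T 0)"] transition[of 0] by (simp add: observe_def)
  moreover have "source (V T T 0) = 1"
    using inactive[of T T "Halt (V T T 0)"] transition[of T] by (simp add: observe_def)
  moreover have "V \<tau> T (Suc i) = scanned (V \<tau> T 0) ! i" if "\<tau> \<le> T" "i < K" for \<tau> i
    using inactive[of \<tau> T "Scan i (V \<tau> T 0) (V \<tau> T (Suc i))"] transition[of \<tau>] symbol[of \<tau> T i] that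
    by simp
  then have "scanned_entries T V" by (simp add: scanned_entries_def)
  moreover have "source (V (Suc \<tau>) T 0) = target (V \<tau> T 0)" if "\<tau> < T" for \<tau>
    using inactive[of \<tau> T "Link (V \<tau> T 0) (V (Suc \<tau>) T 0)"] transition[of \<tau>]
      transition[of "Suc \<tau>"] that
    by (simp add: observe_def)
  then have "linked_states T V" by (simp add: linked_states_def)
  moreover have "V (Suc \<tau>) z (Suc i) =
      (if z' = int T then fst (actions (V \<tau> T 0) ! i) else V \<tau> (nat z') (Suc i))"
    if "\<tau> < T" "z \<le> 2 * T" "i < K" "z' = int z + drift (V \<tau> T 0) i" "0 \<le> z'"
      "z' \<le> 2 * int T" for \<tau> z i z'
    using inactive[of \<tau> z "Drift i (V \<tau> T 0) (V \<tau> (nat z') (Suc i)) (V (Suc \<tau>) z (Suc i))"]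
      transition[of \<tau>] symbol[of \<tau> "nat z'" i] symbol[of "Suc \<tau>" z i] that
    by (simp add: active_Drift_iff nat_le_iff del: active.simps split: if_splits)
  then have "shifted_rows T V" by (simp add: shifted_rows_def Let_def)
  ultimately show ?thesis unfolding legal_def using in_dom by blast
qed

lemma solves_if_legal:
  assumes legal: "legal x T V"
  shows "solves x T V"
proof -
  have "\<not> (\<forall>(dt, p, g, v)\<in>set (literals c). V (\<tau> + dt) (column T z p) g = v)"
    if \<tau>: "\<tau> \<le> T" and z: "z \<le> 2 * T" and valid: "valid_clause c"
      and active: "active (observe x T \<tau> z) c"
    for \<tau> z c
  proof (cases c)
    case (Initial i s)
    then show ?thesis using legal z valid active
      by (auto simp: legal_def initial_row_def observe_def)
  next
    case (Drift i a s s')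
    note bounds = active_Drift_bounds[OF active[unfolded Drift] \<tau> z]
    have "shifted_rows T V" using legal by (simp add: legal_def)
    then have "V (Suc \<tau>) z (Suc i) = (if int z + drift a i = int T then fst (actions a ! i)
        else V \<tau> (nat (int z + drift a i)) (Suc i))" if "V \<tau> T 0 = a"
      using bounds z valid Drift that by (auto simp: shifted_rows_def Let_def)
    then show ?thesis using active Drift by (auto simp: active_Drift_iff simp del: active.simps)
  qed (use legal \<tau> valid active in
      \<open>auto simp: legal_def observe_def scanned_entries_def linked_states_def\<close>)
  then show ?thesis using legal unfolding solves_def legal_def by blast
qed

theorem accepts_within_iff_solvable: "accepts_within M x T \<longleftrightarrow> (\<exists>V. solves x T V)"
  using accepts_within_iff_legal legal_if_solves solves_if_legal by blast

end

datatype kind = Universal | Alternative nat nat | Group nat | Clause clause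

type_synonym vertex = "nat \<times> nat \<times> kind"

definition is_universal :: "vertex \<Rightarrow> bool" where
  "is_universal v \<longleftrightarrow> snd (snd v) = Universal"

fun is_alternative :: "kind \<Rightarrow> bool" where
  "is_alternative (Alternative g a) \<longleftrightarrow> True"
| "is_alternative _ \<longleftrightarrow> False"

definition is_weighted :: "vertex \<Rightarrow> bool" where
  "is_weighted v \<longleftrightarrow> is_alternative (snd (snd v))"

fun group_of :: "vertex \<Rightarrow> nat \<times> nat \<times> nat" where
  "group_of (\<tau>, z, Alternative g a) = (\<tau>, z, g)"
| "group_of (\<tau>, z, _) = (\<tau>, z, 0)"

fun placed :: "place \<Rightarrow> nat \<Rightarrow> nat \<Rightarrow> bool" where
  "placed (Offset d) column_mark centre \<longleftrightarrow> column_mark = marks d"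
| "placed Centre column_mark centre \<longleftrightarrow> centre = 2"

context tableau
begin

text \<open>The marks locate the second vertex in relation to the first one and to the central column.\<close>

fun incident :: "goal \<Rightarrow> observation \<Rightarrow> nat \<Rightarrow> nat \<Rightarrow> nat \<Rightarrow> kind \<Rightarrow> kind \<Rightarrow> bool" where
  "incident gl ob row_mark column_mark centre (Group g) (Alternative g' a) \<longleftrightarrow>
     g = g' \<and> row_mark = 2 \<and> column_mark = 2"
| "incident gl ob row_mark column_mark centre (Clause c) (Alternative g a) \<longleftrightarrow> active ob c \<and>
     (\<exists>(dt, p, g', a')\<in>set (literals c). row_mark = marks (int dt) \<and> placed p column_mark centre \<and>
        g' = g \<and> ((a = a') = (gl = Packing)))"
| "incident gl ob row_mark column_mark centre _ _ \<longleftrightarrow> False"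

fun inc :: "goal \<Rightarrow> bool list \<Rightarrow> nat \<Rightarrow> vertex \<Rightarrow> vertex \<Rightarrow> bool" where
  "inc gl x T (\<tau>, z, \<kappa>) (\<tau>', z', \<kappa>') \<longleftrightarrow> incident gl (observe x T \<tau> z)
     (marks (int \<tau>' - int \<tau>)) (marks (int z' - int z)) (marks (int z' - int T)) \<kappa> \<kappa>'"

fun valid_kind :: "kind \<Rightarrow> bool" where
  "valid_kind Universal \<longleftrightarrow> True"
| "valid_kind (Alternative g a) \<longleftrightarrow> g \<le> K \<and> a < domain_size g"
| "valid_kind (Group g) \<longleftrightarrow> g \<le> K"
| "valid_kind (Clause c) \<longleftrightarrow> valid_clause c"

lemma finite_valid_clause: "finite {c. valid_clause c}"
proof -
  let ?n = "length transitions"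
  let ?all = "(\<lambda>(i, s). Initial i s) ` ({..<K} \<times> {..<S}) \<union> Start ` {..<?n} \<union> Halt ` {..<?n} \<union>
    (\<lambda>(i, a, s). Scan i a s) ` ({..<K} \<times> {..<?n} \<times> {..<S}) \<union>
    (\<lambda>(a, b). Link a b) ` ({..<?n} \<times> {..<?n}) \<union>
    (\<lambda>(i, a, s, s'). Drift i a s s') ` ({..<K} \<times> {..<?n} \<times> {..<S} \<times> {..<S})"
  have "c \<in> ?all" if "valid_clause c" for c
    using that by (cases c) (auto simp: image_iff)
  then have "{c. valid_clause c} \<subseteq> ?all" by blast
  then show ?thesis by (rule finite_subset) auto
qed

lemma finite_valid_kind: "finite {\<kappa>. valid_kind \<kappa>}"
proof -
  let ?all = "{Universal} \<union> (\<lambda>(g, a). Alternative g a) ` (SIGMA g:{..K}. {..<domain_size g}) \<union>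
    Group ` {..K} \<union> Clause ` {c. valid_clause c}"
  have "\<kappa> \<in> ?all" if "valid_kind \<kappa>" for \<kappa>
    using that by (cases \<kappa>) (auto simp: image_iff)
  then have "{\<kappa>. valid_kind \<kappa>} \<subseteq> ?all" by blast
  then show ?thesis by (rule finite_subset) (auto simp: finite_valid_clause)
qed

definition kinds :: "kind list" where
  "kinds = (SOME \<kappa>s. distinct \<kappa>s \<and> set \<kappa>s = {\<kappa>. valid_kind \<kappa>})"

lemma set_kinds: "set kinds = {\<kappa>. valid_kind \<kappa>}" and distinct_kinds: "distinct kinds"
proof -
  have "\<exists>\<kappa>s. distinct \<kappa>s \<and> set \<kappa>s = {\<kappa>. valid_kind \<kappa>}"
    using finite_distinct_list[OF finite_valid_kind] by blast
  from someI_ex[OF this] show "set kinds = {\<kappa>. valid_kind \<kappa>}" "distinct kinds"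
    unfolding kinds_def by auto
qed

definition vertices :: "nat \<Rightarrow> vertex list" where
  "vertices T = List.product [0..<Suc T] (List.product [0..<2 * T + 1] kinds)"

lemma in_vertices_iff: "(\<tau>, z, \<kappa>) \<in> set (vertices T) \<longleftrightarrow> \<tau> \<le> T \<and> z \<le> 2 * T \<and> valid_kind \<kappa>"
  by (auto simp: vertices_def set_kinds)

lemma split_system_vertices: "split_system (vertices T) is_universal is_weighted"
proof
  show "distinct (vertices T)" by (simp add: vertices_def distinct_product distinct_kinds)
  show "\<exists>v\<in>set (vertices T). is_universal v"
    by (rule bexI[of _ "(0, 0, Universal)"]) (simp_all add: in_vertices_iff is_universal_def)
  show "\<not> (is_universal v \<and> is_weighted v)" for v
    by (auto simp: is_universal_def is_weighted_def)
qed

definition hard_graph :: "goal \<Rightarrow> bool list \<Rightarrow> nat \<Rightarrow> nat graph" where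
  "hard_graph gl x T = list_graph (vertices T) (split_adj is_universal is_weighted (inc gl x T))"

definition alternatives :: "nat \<Rightarrow> vertex set" where
  "alternatives T = {v \<in> set (vertices T). is_weighted v}"

lemma finite_alternatives: "finite (alternatives T)"
  by (simp add: alternatives_def)

lemma alternativesE:
  assumes "v \<in> alternatives T"
  obtains \<tau> z g a where "v = (\<tau>, z, Alternative g a)"
proof (cases v)
  case (fields \<tau> z \<kappa>)
  then show ?thesis using assms that by (cases \<kappa>) (auto simp: alternatives_def is_weighted_def)
qed

lemma Alternative_in_alternatives_iff:
  "(\<tau>, z, Alternative g a) \<in> alternatives T \<longleftrightarrow> \<tau> \<le> T \<and> z \<le> 2 * T \<and> g \<le> K \<and> a < domain_size g"
  by (auto simp: alternatives_def is_weighted_def in_vertices_iff)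

lemma domain_size_pos: "domain_size g > 0"
proof -
  let ?rs = "replicate K 0"
  have S: "S > 0" using turing_machine_M by (simp add: turing_machine_def)
  then have "(1, ?rs, 1, map (\<lambda>r. (r, MStay)) ?rs) \<in> tm_trans (looping M)"
    by (auto simp: looping_def)
  then have "transitions \<noteq> []" using set_transitions by force
  then show ?thesis using S by (simp add: domain_size_def)
qed

lemma groups_eq: "group_of ` alternatives T = {..T} \<times> {..2 * T} \<times> {..K}"
proof (intro equalityI subsetI)
  fix v assume "v \<in> group_of ` alternatives T"
  then obtain \<tau> z g a where "v = (\<tau>, z, g)" "(\<tau>, z, Alternative g a) \<in> alternatives T"
    by (metis alternativesE group_of.simps(1) imageE)
  then show "v \<in> {..T} \<times> {..2 * T} \<times> {..K}" by (simp add: Alternative_in_alternatives_iff)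
next
  fix v assume v: "v \<in> {..T} \<times> {..2 * T} \<times> {..K}"
  obtain \<tau> z g where v_eq: "v = (\<tau>, z, g)" by (cases v)
  then have "(\<tau>, z, Alternative g 0) \<in> alternatives T"
    using v domain_size_pos by (simp add: Alternative_in_alternatives_iff)
  then show "v \<in> group_of ` alternatives T" by (force simp: v_eq)
qed

definition groups_number :: "nat \<Rightarrow> nat" where
  "groups_number T = Suc T * ((2 * T + 1) * Suc K)"

lemma card_groups: "card (group_of ` alternatives T) = groups_number T"
  by (simp add: groups_eq card_cartesian_product groups_number_def)

fun place_literal :: "nat \<Rightarrow> nat \<Rightarrow> nat \<Rightarrow> literal \<Rightarrow> vertex" where
  "place_literal T \<tau> z (dt, p, g, v) = (\<tau> + dt, column T z p, Alternative g v)"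

definition active_clauses :: "bool list \<Rightarrow> nat \<Rightarrow> (nat \<times> nat \<times> clause) set" where
  "active_clauses x T =
     {(\<tau>, z, c). \<tau> \<le> T \<and> z \<le> 2 * T \<and> valid_clause c \<and> active (observe x T \<tau> z) c}"

lemma all_clauses_iff_ball_active:
  assumes "\<And>\<tau> z c. \<not> active (observe x T \<tau> z) c \<Longrightarrow> P \<tau> z c"
    and "\<And>\<tau> z c. (\<tau>, z, c) \<in> active_clauses x T \<Longrightarrow> P \<tau> z c \<longleftrightarrow> Q (\<tau>, z, c)"
  shows "(\<forall>\<tau>\<le>T. \<forall>z\<le>2 * T. \<forall>c. valid_clause c \<longrightarrow> P \<tau> z c) \<longleftrightarrow> (\<forall>c\<in>active_clauses x T. Q c)"
  using assms unfolding active_clauses_def by fast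

fun literal_vertices :: "nat \<Rightarrow> nat \<times> nat \<times> clause \<Rightarrow> vertex set" where
  "literal_vertices T (\<tau>, z, c) = place_literal T \<tau> z ` set (literals c)"

lemma active_literal_bounds:
  assumes "(\<tau>, z, c) \<in> active_clauses x T" "(dt, p, g, v) \<in> set (literals c)"
  shows "dt \<le> 1" "p = Offset d \<Longrightarrow> (d = -1 \<or> d = 0 \<or> d = 1) \<and> 0 \<le> int z + d"
    "place_literal T \<tau> z (dt, p, g, v) \<in> alternatives T"
proof -
  have "dt \<le> 1 \<and> (\<forall>d. p = Offset d \<longrightarrow> (d = -1 \<or> d = 0 \<or> d = 1) \<and> 0 \<le> int z + d) \<and>
      place_literal T \<tau> z (dt, p, g, v) \<in> alternatives T"
  proof (cases c)
    case (Drift i a s s')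
    then have "\<tau> < T" "0 \<le> int z + drift a i" "int z + drift a i \<le> 2 * int T"
      using assms(1) active_Drift_bounds by (auto simp: active_clauses_def simp del: active.simps)
    then show ?thesis using assms Drift drift_cases[of a i]
      by (auto simp: active_clauses_def Alternative_in_alternatives_iff domain_size_def nat_le_iff
          simp del: active.simps)
  qed (use assms in \<open>auto simp: active_clauses_def observe_def Alternative_in_alternatives_iff
      domain_size_def\<close>)
  then show "dt \<le> 1" "p = Offset d \<Longrightarrow> (d = -1 \<or> d = 0 \<or> d = 1) \<and> 0 \<le> int z + d"
    "place_literal T \<tau> z (dt, p, g, v) \<in> alternatives T" by auto
qed

lemma literal_vertices_subset: "c \<in> active_clauses x T \<Longrightarrow> literal_vertices T c \<subseteq> alternatives T"
  by (cases c) (auto dest: active_literal_bounds(3))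

lemma literal_vertices_nonempty: "literal_vertices T c \<noteq> {}"
proof (cases c)
  case (fields \<tau> z c)
  then show ?thesis by (cases c) auto
qed

lemma card_literal_vertices: "card (literal_vertices T (\<tau>, z, c)) = length (literals c)"
  by (cases c) (auto simp: card_insert_if)

lemma placed_iff:
  assumes "dt \<le> 1" "\<And>d. p = Offset d \<Longrightarrow> (d = -1 \<or> d = 0 \<or> d = 1) \<and> 0 \<le> int z + d"
  shows "marks (int \<tau>' - int \<tau>) = marks (int dt) \<and>
      placed p (marks (int z' - int z)) (marks (int z' - int T)) \<longleftrightarrow> \<tau>' = \<tau> + dt \<and> z' = column T z p"
proof -
  have "marks (int \<tau>' - int \<tau>) = marks (int dt) \<longleftrightarrow> \<tau>' = \<tau> + dt"
    using assms(1) by (subst marks_eq_iff) auto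
  moreover have "placed p (marks (int z' - int z)) (marks (int z' - int T)) \<longleftrightarrow> z' = column T z p"
  proof (cases p)
    case (Offset d)
    then show ?thesis using assms(2)[OF Offset] by (simp add: marks_eq_iff[of d]) linarith
  qed auto
  ultimately show ?thesis by blast
qed

lemma inc_Clause_iff:
  assumes "(\<tau>, z, c) \<in> active_clauses x T"
  shows "inc gl x T (\<tau>, z, Clause c) (\<tau>', z', Alternative g a) \<longleftrightarrow>
    (\<exists>(dt, p, g', a')\<in>set (literals c).
       \<tau>' = \<tau> + dt \<and> z' = column T z p \<and> g' = g \<and> ((a = a') = (gl = Packing)))"
proof -
  have "marks (int \<tau>' - int \<tau>) = marks (int dt) \<and>
      placed p (marks (int z' - int z)) (marks (int z' - int T)) \<longleftrightarrow> \<tau>' = \<tau> + dt \<and> z' = column T z p"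
    if "(dt, p, g', a') \<in> set (literals c)" for dt p g' a'
    by (rule placed_iff) (use active_literal_bounds[OF assms that] in blast)+
  moreover have "active (observe x T \<tau> z) c" using assms by (simp add: active_clauses_def)
  ultimately show ?thesis by (simp only: inc.simps incident.simps) blast
qed

lemma inc_Clause_eq_clause_scope:
  assumes "(\<tau>, z, c) \<in> active_clauses x T"
  shows "{v \<in> alternatives T. inc gl x T (\<tau>, z, Clause c) v} =
    clause_scope gl group_of (alternatives T) (literal_vertices T (\<tau>, z, c))"
proof (cases gl)
  case Packing
  have "v \<in> alternatives T \<and> inc gl x T (\<tau>, z, Clause c) v \<longleftrightarrow> v \<in> literal_vertices T (\<tau>, z, c)" for v
  proof
    assume v: "v \<in> alternatives T \<and> inc gl x T (\<tau>, z, Clause c) v"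
    then obtain \<tau>' z' g a where v_eq: "v = (\<tau>', z', Alternative g a)" by (blast elim: alternativesE)
    then show "v \<in> literal_vertices T (\<tau>, z, c)"
      using v Packing by (force simp: inc_Clause_iff[OF assms] simp del: inc.simps)
  next
    assume v: "v \<in> literal_vertices T (\<tau>, z, c)"
    then obtain dt p g a where "(dt, p, g, a) \<in> set (literals c)"
      "v = (\<tau> + dt, column T z p, Alternative g a)" by auto
    then have "inc gl x T (\<tau>, z, Clause c) v"
      using Packing by (force simp: inc_Clause_iff[OF assms] simp del: inc.simps)
    then show "v \<in> alternatives T \<and> inc gl x T (\<tau>, z, Clause c) v"
      using v literal_vertices_subset[OF assms] by blast
  qed
  then show ?thesis by (auto simp: Packing simp del: inc.simps literal_vertices.simps)
next
  case Covering
  have "inc gl x T (\<tau>, z, Clause c) v \<longleftrightarrow>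
      (\<exists>w\<in>literal_vertices T (\<tau>, z, c). group_of v = group_of w \<and> v \<noteq> w)"
      if v: "v \<in> alternatives T" for v
  proof -
    obtain \<tau>' z' g a where v_eq: "v = (\<tau>', z', Alternative g a)" using v by (rule alternativesE)
    show ?thesis unfolding v_eq inc_Clause_iff[OF assms] using Covering by force
  qed
  then show ?thesis
    by (auto simp: Covering opponents_def simp del: inc.simps literal_vertices.simps)
qed

definition assigned :: "nat \<Rightarrow> (nat \<Rightarrow> nat \<Rightarrow> nat \<Rightarrow> nat) \<Rightarrow> vertex set" where
  "assigned T V = {(\<tau>, z, Alternative g (V \<tau> z g)) | \<tau> z g. \<tau> \<le> T \<and> z \<le> 2 * T \<and> g \<le> K}"

lemma transversal_assigned:
  assumes "in_domain T V"
  shows "transversal group_of (alternatives T) (assigned T V)"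
  unfolding transversal_def bij_betw_def
proof (intro conjI)
  show "assigned T V \<subseteq> alternatives T"
    using assms by (auto simp: assigned_def Alternative_in_alternatives_iff in_domain_def)
  show "inj_on group_of (assigned T V)" by (auto simp: inj_on_def assigned_def)
  show "group_of ` assigned T V = group_of ` alternatives T"
    unfolding groups_eq by (force simp: assigned_def image_iff)
qed

lemma transversal_eq_assigned:
  assumes "transversal group_of (alternatives T) A"
  obtains V where "in_domain T V" "A = assigned T V"
proof
  have A: "A \<subseteq> alternatives T" "inj_on group_of A" "group_of ` A = {..T} \<times> {..2 * T} \<times> {..K}"
    using assms by (auto simp: transversal_def bij_betw_def groups_eq)
  define V where "V \<tau> z g = (SOME a. (\<tau>, z, Alternative g a) \<in> A)" for \<tau> z g
  have V: "(\<tau>, z, Alternative g (V \<tau> z g)) \<in> A" if "\<tau> \<le> T" "z \<le> 2 * T" "g \<le> K" for \<tau> z g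
  proof -
    have "(\<tau>, z, g) \<in> group_of ` A" using A(3) that by simp
    then obtain v where v: "v \<in> A" "group_of v = (\<tau>, z, g)" by (metis imageE)
    then obtain a where "v = (\<tau>, z, Alternative g a)"
      using A(1) by (metis (no_types, lifting) alternativesE group_of.simps(1) prod.inject subsetD)
    then show ?thesis unfolding V_def using v(1) someI by metis
  qed
  show "in_domain T V"
    unfolding in_domain_def using V A(1) Alternative_in_alternatives_iff by blast
  show "A = assigned T V"
  proof (intro equalityI subsetI)
    fix v assume v: "v \<in> A"
    then obtain \<tau> z g a where v_eq: "v = (\<tau>, z, Alternative g a)"
      using A(1) by (blast elim: alternativesE)
    have bounds: "\<tau> \<le> T" "z \<le> 2 * T" "g \<le> K"
      using v A(1) by (auto simp: v_eq Alternative_in_alternatives_iff)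
    then have "v = (\<tau>, z, Alternative g (V \<tau> z g))"
      using inj_onD[OF A(2) _ v V] by (simp add: v_eq)
    then show "v \<in> assigned T V" using bounds by (auto simp: assigned_def)
  qed (use V in \<open>auto simp: assigned_def\<close>)
qed

lemma literal_vertices_subset_assigned_iff:
  assumes "(\<tau>, z, c) \<in> active_clauses x T"
  shows "literal_vertices T (\<tau>, z, c) \<subseteq> assigned T V \<longleftrightarrow>
    (\<forall>(dt, p, g, v)\<in>set (literals c). V (\<tau> + dt) (column T z p) g = v)"
proof -
  have "place_literal T \<tau> z (dt, p, g, v) \<in> assigned T V \<longleftrightarrow> V (\<tau> + dt) (column T z p) g = v"
    if "(dt, p, g, v) \<in> set (literals c)" for dt p g v
    using active_literal_bounds(3)[OF assms that]
    by (auto simp: assigned_def Alternative_in_alternatives_iff)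
  then show ?thesis by fastforce
qed

theorem ex_transversal_iff_solvable:
  "(\<exists>A. transversal group_of (alternatives T) A \<and>
     (\<forall>c\<in>active_clauses x T. \<not> literal_vertices T c \<subseteq> A)) \<longleftrightarrow> (\<exists>V. solves x T V)"
proof -
  have active: "active (observe x T \<tau> z) c" if "(\<tau>, z, c) \<in> active_clauses x T" for \<tau> z c
    using that by (simp add: active_clauses_def)
  have "solves x T V \<longleftrightarrow> in_domain T V \<and>
      (\<forall>c\<in>active_clauses x T. \<not> literal_vertices T c \<subseteq> assigned T V)" for V
    unfolding solves_def
    by (intro conj_cong refl all_clauses_iff_ball_active)
      (simp_all add: active literal_vertices_subset_assigned_iff del: literal_vertices.simps)
  then show ?thesis
    using transversal_assigned transversal_eq_assigned by metis
qed

fun bound :: "goal \<Rightarrow> observation \<Rightarrow> kind \<Rightarrow> nat option" where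
  "bound gl ob (Group g) = Some 1"
| "bound gl ob (Clause c) =
     Some (case gl of Packing \<Rightarrow> length (literals c) - 1 | Covering \<Rightarrow> of_bool (active ob c))"
| "bound gl ob _ = None"

fun demand :: "goal \<Rightarrow> bool list \<Rightarrow> nat \<Rightarrow> vertex \<Rightarrow> nat" where
  "demand gl x T (\<tau>, z, \<kappa>) =
     (case bound gl (observe x T \<tau> z) \<kappa> of None \<Rightarrow> groups_number T | Some m \<Rightarrow> m)"

lemma ball_vertices_iff:
  "(\<forall>v\<in>set (vertices T). P v) \<longleftrightarrow>
     (\<forall>\<tau>\<le>T. \<forall>z\<le>2 * T. P (\<tau>, z, Universal)) \<and> (\<forall>v\<in>alternatives T. P v) \<and>
     (\<forall>\<tau>\<le>T. \<forall>z\<le>2 * T. \<forall>g\<le>K. P (\<tau>, z, Group g)) \<and>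
     (\<forall>\<tau>\<le>T. \<forall>z\<le>2 * T. \<forall>c. valid_clause c \<longrightarrow> P (\<tau>, z, Clause c))" (is "_ \<longleftrightarrow> ?parts")
proof
  assume ?parts
  have "P (\<tau>, z, \<kappa>)" if "(\<tau>, z, \<kappa>) \<in> set (vertices T)" for \<tau> z \<kappa>
    using that \<open>?parts\<close>
    by (cases \<kappa>) (auto simp: in_vertices_iff Alternative_in_alternatives_iff)
  then show "\<forall>v\<in>set (vertices T). P v" by auto
qed (auto simp: in_vertices_iff alternatives_def)

lemma scope_vertices:
  fixes gl x T
  defines "sc \<equiv> split_system.scope (vertices T) is_universal is_weighted (inc gl x T)"
  shows "sc (\<tau>, z, Universal) = alternatives T"
    "v \<in> alternatives T \<Longrightarrow> sc v = alternatives T"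
    "sc (\<tau>, z, Group g) = {v \<in> alternatives T. group_of v = (\<tau>, z, g)}"
    "sc (\<tau>, z, Clause c) = {v \<in> alternatives T. inc gl x T (\<tau>, z, Clause c) v}"
proof -
  interpret split_system "vertices T" is_universal is_weighted "inc gl x T"
    by (rule split_system_vertices)
  have carriers: "carriers = alternatives T" by (simp add: carriers_def alternatives_def)
  note simps = sc_def scope_def carriers is_universal_def is_weighted_def
  have "inc gl x T (\<tau>, z, Group g) v \<longleftrightarrow> group_of v = (\<tau>, z, g)" if "v \<in> alternatives T" for v
    using that by (auto elim!: alternativesE)
  then show "sc (\<tau>, z, Group g) = {v \<in> alternatives T. group_of v = (\<tau>, z, g)}"
    by (auto simp: simps simp del: inc.simps)
  show "sc (\<tau>, z, Universal) = alternatives T"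
    "sc (\<tau>, z, Clause c) = {v \<in> alternatives T. inc gl x T (\<tau>, z, Clause c) v}"
    by (simp_all add: simps)
  show "sc v = alternatives T" if "v \<in> alternatives T"
    using that by (auto simp: simps alternatives_def)
qed

lemma complies_clauses_iff:
  "(\<forall>\<tau>\<le>T. \<forall>z\<le>2 * T. \<forall>c. valid_clause c \<longrightarrow>
     complies gl (sum F {v \<in> alternatives T. inc gl x T (\<tau>, z, Clause c) v})
       (demand gl x T (\<tau>, z, Clause c))) \<longleftrightarrow>
   (\<forall>c\<in>active_clauses x T.
     complies gl (sum F (clause_scope gl group_of (alternatives T) (literal_vertices T c)))
       (clause_bound gl (literal_vertices T c)))"
proof (rule all_clauses_iff_ball_active)
  fix \<tau> z c assume inactive: "\<not> active (observe x T \<tau> z) c"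
  then have "{v \<in> alternatives T. inc gl x T (\<tau>, z, Clause c) v} = {}"
    by (auto elim!: alternativesE)
  then show "complies gl (sum F {v \<in> alternatives T. inc gl x T (\<tau>, z, Clause c) v})
      (demand gl x T (\<tau>, z, Clause c))"
    using inactive by (cases gl) (simp_all only: sum.empty, simp_all)
next
  fix \<tau> z c assume active: "(\<tau>, z, c) \<in> active_clauses x T"
  then have "demand gl x T (\<tau>, z, Clause c) = clause_bound gl (literal_vertices T (\<tau>, z, c))"
    using card_literal_vertices[of T \<tau> z c]
    by (cases gl) (simp_all add: active_clauses_def del: literal_vertices.simps)
  then show "complies gl (sum F {v \<in> alternatives T. inc gl x T (\<tau>, z, Clause c) v})
      (demand gl x T (\<tau>, z, Clause c)) \<longleftrightarrow>
    complies gl (sum F (clause_scope gl group_of (alternatives T) (literal_vertices T (\<tau>, z, c))))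
      (clause_bound gl (literal_vertices T (\<tau>, z, c)))"
    by (simp only: inc_Clause_eq_clause_scope[OF active])
qed

lemma complies_vertices_iff:
  fixes gl x T
  defines "sc \<equiv> split_system.scope (vertices T) is_universal is_weighted (inc gl x T)"
    and "X \<equiv> alternatives T" and "C \<equiv> active_clauses x T" and "N \<equiv> literal_vertices T"
  shows "(\<forall>v\<in>set (vertices T). complies gl (sum F (sc v)) (demand gl x T v)) \<longleftrightarrow>
    (\<forall>g\<in>group_of ` X. complies gl (sum F {v \<in> X. group_of v = g}) 1) \<and>
    (\<forall>c\<in>C. complies gl (sum F (clause_scope gl group_of X (N c))) (clause_bound gl (N c)))"
    (is "_ \<longleftrightarrow> ?groups \<and> ?clauses")
proof -
  have groups: "(\<forall>\<tau>\<le>T. \<forall>z\<le>2 * T. \<forall>g\<le>K. complies gl (sum F (sc (\<tau>, z, Group g)))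
      (demand gl x T (\<tau>, z, Group g))) \<longleftrightarrow> ?groups"
    unfolding sc_def X_def scope_vertices groups_eq by auto
  have clauses: "(\<forall>\<tau>\<le>T. \<forall>z\<le>2 * T. \<forall>c. valid_clause c \<longrightarrow>
      complies gl (sum F (sc (\<tau>, z, Clause c))) (demand gl x T (\<tau>, z, Clause c))) \<longleftrightarrow> ?clauses"
    unfolding sc_def X_def C_def N_def scope_vertices by (rule complies_clauses_iff)
  have total: "complies gl (sum F X) (groups_number T)" if ?groups
    unfolding X_def card_groups[symmetric]
    by (rule complies_sum_if_group_sums[OF finite_alternatives])
      (rule bspec[OF that[unfolded X_def]])
  have "sum F (sc v) = sum F X \<and> demand gl x T v = groups_number T" if "v \<in> X" for v
    using that scope_vertices(2) by (auto simp: sc_def X_def elim!: alternativesE)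
  moreover have "sum F (sc (\<tau>, z, Universal)) = sum F X \<and>
      demand gl x T (\<tau>, z, Universal) = groups_number T" for \<tau> z
    by (simp add: sc_def X_def scope_vertices)
  ultimately show ?thesis
    unfolding ball_vertices_iff groups clauses X_def[symmetric] using total by auto
qed

theorem attains_hard_graph_iff_accepts:
  assumes "l \<ge> 1"
  shows "attains gl (hard_graph gl x T) (\<lambda>i. demand gl x T (vertices T ! i))
      (\<lambda>i. l * of_bool (is_weighted (vertices T ! i))) (groups_number T) \<longleftrightarrow> accepts_within M x T"
proof -
  interpret split_system "vertices T" is_universal is_weighted "inc gl x T"
    by (rule split_system_vertices)
  let ?X = "alternatives T" and ?C = "active_clauses x T" and ?N = "literal_vertices T"
  have "attains gl (hard_graph gl x T) (\<lambda>i. demand gl x T (vertices T ! i))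
      (\<lambda>i. l * of_bool (is_weighted (vertices T ! i))) (groups_number T) \<longleftrightarrow>
    (\<exists>F. (\<forall>v\<in>?X. F v \<le> l) \<and> (\<forall>v\<in>set (vertices T). complies gl (sum F (scope v)) (demand gl x T v)) \<and>
       complies gl (groups_number T) (sum F ?X))"
    unfolding hard_graph_def attains_iff_ex_weights carriers_def alternatives_def ..
  also have "\<dots> \<longleftrightarrow> (\<exists>F. (\<forall>v\<in>?X. F v \<le> l) \<and>
      (\<forall>g\<in>group_of ` ?X. complies gl (sum F {v \<in> ?X. group_of v = g}) 1) \<and>
      (\<forall>c\<in>?C. complies gl (sum F (clause_scope gl group_of ?X (?N c))) (clause_bound gl (?N c))) \<and>
      complies gl (card (group_of ` ?X)) (sum F ?X))"
    unfolding complies_vertices_iff card_groups conj_assoc ..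
  also have "\<dots> \<longleftrightarrow> (\<exists>A. transversal group_of ?X A \<and> (\<forall>c\<in>?C. \<not> ?N c \<subseteq> A))"
    by (rule ex_weights_iff_ex_transversal[OF finite_alternatives assms])
      (use literal_vertices_subset literal_vertices_nonempty in blast)
  finally show ?thesis unfolding ex_transversal_iff_solvable accepts_within_iff_solvable .
qed

end

section \<open>Structured programs on multi-tape machines\<close>

type_synonym state = "nat \<Rightarrow> tape"
type_synonym readings = "nat \<Rightarrow> nat"

datatype prog =
    Skip
  | Act "readings \<Rightarrow> nat \<Rightarrow> nat \<times> move"
  | Seq prog prog
  | Cond "readings \<Rightarrow> bool" prog prog
  | While "readings \<Rightarrow> bool" prog

definition idle :: "readings \<Rightarrow> nat \<Rightarrow> nat \<times> move" where
  "idle r = (\<lambda>i. (r i, MStay))"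

definition reads :: "state \<Rightarrow> readings" where
  "reads s = (\<lambda>i. fst (s i) (snd (s i)))"

lemma read_tape_eq_reads: "read_tape (s i) = reads s i"
  by (cases "s i") (simp add: reads_def)

definition apply_act :: "(nat \<Rightarrow> nat \<times> move) \<Rightarrow> state \<Rightarrow> state" where
  "apply_act a s = (\<lambda>i. act_tape (a i) (s i))"

lemma apply_act_idle [simp]: "apply_act (idle (reads s)) s = s"
  by (rule ext) (simp add: apply_act_def idle_def read_tape_eq_reads[symmetric] act_tape_idle)

fun next_prog :: "prog \<Rightarrow> readings \<Rightarrow> prog" where
  "next_prog Skip r = Skip"
| "next_prog (Act f) r = Skip"
| "next_prog (Seq p q) r = (if p = Skip then q else Seq (next_prog p r) q)"
| "next_prog (Cond b p q) r = (if b r then p else q)"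
| "next_prog (While b p) r = (if b r then Seq p (While b p) else Skip)"

fun next_act :: "prog \<Rightarrow> readings \<Rightarrow> nat \<Rightarrow> nat \<times> move" where
  "next_act (Act f) r = f r"
| "next_act (Seq p q) r = (if p = Skip then idle r else next_act p r)"
| "next_act _ r = idle r"

definition prog_step :: "prog \<times> state \<Rightarrow> prog \<times> state" where
  "prog_step c = (next_prog (fst c) (reads (snd c)),
                  apply_act (next_act (fst c) (reads (snd c))) (snd c))"

inductive small_steps :: "nat \<Rightarrow> prog \<Rightarrow> state \<Rightarrow> prog \<Rightarrow> state \<Rightarrow> bool" where
  small_refl: "small_steps 0 p s p s"
| small_step: "p \<noteq> Skip \<Longrightarrow> prog_step (p, s) = (p', s') \<Longrightarrow> small_steps n p' s' p'' s''
    \<Longrightarrow> small_steps (Suc n) p s p'' s''"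

lemma small_steps_trans:
  "small_steps m p s p' s' \<Longrightarrow> small_steps n p' s' p'' s'' \<Longrightarrow> small_steps (m + n) p s p'' s''"
  by (induction rule: small_steps.induct) (auto intro: small_step)

lemma small_steps_Seq:
  "small_steps n p s p' s' \<Longrightarrow> small_steps n (Seq p q) s (Seq p' q) s'"
proof (induction rule: small_steps.induct)
  case (small_step p s p' s' n p'' s'')
  then show ?case by (intro small_steps.small_step[of _ _ "Seq p' q" s']) (auto simp: prog_step_def)
qed (rule small_refl)

definition runs :: "prog \<Rightarrow> state \<Rightarrow> state \<Rightarrow> nat \<Rightarrow> bool" where
  "runs p s s' t \<longleftrightarrow> (\<exists>n\<le>t. small_steps n p s Skip s')"

lemma runsE:
  assumes "runs p s s' t"
  obtains n where "n \<le> t" "small_steps n p s Skip s'"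
  using assms unfolding runs_def by blast

lemma runs_mono: "runs p s s' t \<Longrightarrow> t \<le> t' \<Longrightarrow> runs p s s' t'"
  unfolding runs_def using order_trans by blast

lemma runs_step:
  assumes "p \<noteq> Skip" "prog_step (p, s) = (p', s')" "runs p' s' s'' t"
  shows "runs p s s'' (Suc t)"
  using assms unfolding runs_def by (meson Suc_le_mono small_step)

lemma runs_Skip: "runs Skip s s t"
  unfolding runs_def using small_refl by blast

lemma runs_Act: "runs (Act f) s (apply_act (f (reads s)) s) 1"
  using runs_step[OF _ _ runs_Skip, of "Act f" s _ 0] by (simp add: prog_step_def)

lemma runs_Seq:
  assumes "runs p s s' t" "runs q s' s'' t'"
  shows "runs (Seq p q) s s'' (t + t' + 1)"
proof -
  obtain m where m: "m \<le> t" "small_steps m p s Skip s'" using assms(1) by (rule runsE)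
  have "runs (Seq Skip q) s' s'' (Suc t')"
    by (rule runs_step[OF _ _ assms(2)]) (auto simp: prog_step_def)
  then obtain n where n: "n \<le> Suc t'" "small_steps n (Seq Skip q) s' Skip s''" by (rule runsE)
  show ?thesis
    using small_steps_trans[OF small_steps_Seq[OF m(2)] n(2)] m(1) n(1)
    unfolding runs_def by (intro exI[of _ "m + n"]) simp
qed

lemma runs_Cond: "runs (if b (reads s) then p else q) s s' t \<Longrightarrow> runs (Cond b p q) s s' (t + 1)"
  using runs_step[of "Cond b p q" s "if b (reads s) then p else q" s s' t]
  by (simp add: prog_step_def)

lemma runs_While_False: "\<not> b (reads s) \<Longrightarrow> runs (While b p) s s 1"
  using runs_step[OF _ _ runs_Skip, of "While b p" s s 0] by (simp add: prog_step_def)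

lemma runs_While_True:
  assumes "b (reads s)" "runs p s s' t" "runs (While b p) s' s'' t'"
  shows "runs (While b p) s s'' (t + t' + 2)"
  using runs_step[OF _ _ runs_Seq[OF assms(2,3)], of "While b p" s] assms(1)
  by (simp add: prog_step_def)

lemma runs_While_iterate:
  assumes "\<And>j. j < N \<Longrightarrow> b (reads (st j))" "\<not> b (reads (st N))"
    and "\<And>j. j < N \<Longrightarrow> runs p (st j) (st (Suc j)) t"
  shows "runs (While b p) (st 0) (st N) (N * (t + 2) + 1)"
proof -
  have "runs (While b p) (st (N - k)) (st N) (k * (t + 2) + 1)" if "k \<le> N" for k
    using that
  proof (induction k)
    case 0
    then show ?case using runs_While_False assms(2) by simp
  next
    case (Suc k)
    then have next_index: "Suc (N - Suc k) = N - k" "N - Suc k < N" by auto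
    have "runs (While b p) (st (N - Suc k)) (st N) (t + (k * (t + 2) + 1) + 2)"
      using assms(1,3)[OF next_index(2)] Suc
      by (intro runs_While_True[of _ _ _ "st (N - k)"]) (auto simp: next_index(1))
    then show ?case by (rule runs_mono) simp
  qed
  from this[of N] show ?thesis by simp
qed

fun residuals :: "prog \<Rightarrow> prog set" where
  "residuals Skip = {Skip}"
| "residuals (Act f) = {Act f, Skip}"
| "residuals (Seq p q) = (\<lambda>p'. Seq p' q) ` residuals p \<union> residuals q"
| "residuals (Cond b p q) = insert (Cond b p q) (residuals p \<union> residuals q)"
| "residuals (While b p) = {Skip, While b p} \<union> (\<lambda>p'. Seq p' (While b p)) ` residuals p"

lemma finite_residuals: "finite (residuals p)"
  by (induction p) auto

lemma self_in_residuals: "p \<in> residuals p"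
  by (induction p) auto

lemma Skip_in_residuals: "Skip \<in> residuals p"
  by (induction p) auto

lemma next_prog_in_residuals: "q \<in> residuals p \<Longrightarrow> next_prog q r \<in> residuals p"
proof (induction p arbitrary: q)
  case (Seq p1 p2)
  then consider p' where "q = Seq p' p2" "p' \<in> residuals p1" | "q \<in> residuals p2" by auto
  then show ?case by cases (use Seq.IH in \<open>auto simp: self_in_residuals\<close>)
next
  case (While b p)
  then consider p' where "q = Seq p' (While b p)" "p' \<in> residuals p" | "q = Skip" | "q = While b p"
    by auto
  then show ?case by cases (use While.IH in \<open>auto simp: self_in_residuals\<close>)
qed (auto simp: self_in_residuals)

definition wf_act :: "nat \<Rightarrow> nat \<Rightarrow> (readings \<Rightarrow> nat \<Rightarrow> nat \<times> move) \<Rightarrow> bool" where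
  "wf_act K S f \<longleftrightarrow>
     (\<forall>r i. (\<forall>j. r j < S) \<longrightarrow> fst (f r i) < S \<and> (i \<ge> K \<longrightarrow> f r i = (r i, MStay)))"

fun wf_prog :: "nat \<Rightarrow> nat \<Rightarrow> prog \<Rightarrow> bool" where
  "wf_prog K S Skip \<longleftrightarrow> True"
| "wf_prog K S (Act f) \<longleftrightarrow> wf_act K S f"
| "wf_prog K S (Seq p q) \<longleftrightarrow> wf_prog K S p \<and> wf_prog K S q"
| "wf_prog K S (Cond b p q) \<longleftrightarrow> wf_prog K S p \<and> wf_prog K S q"
| "wf_prog K S (While b p) \<longleftrightarrow> wf_prog K S p"

lemma wf_residuals: "wf_prog K S p \<Longrightarrow> q \<in> residuals p \<Longrightarrow> wf_prog K S q"
proof (induction p arbitrary: q)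
  case (Seq p1 p2)
  from Seq.prems have wf: "wf_prog K S p1" "wf_prog K S p2" by simp_all
  show ?case using Seq.prems Seq.IH(1)[OF wf(1)] Seq.IH(2)[OF wf(2)] by auto
next
  case (Cond b p1 p2)
  from Cond.prems have wf: "wf_prog K S p1" "wf_prog K S p2" by simp_all
  show ?case using Cond.prems Cond.IH(1)[OF wf(1)] Cond.IH(2)[OF wf(2)] by auto
next
  case (While b p)
  from While.prems have wf: "wf_prog K S p" by simp
  show ?case using While.prems While.IH[OF wf] by auto
qed auto

lemma wf_next_act: "wf_prog K S p \<Longrightarrow> wf_act K S (next_act p)"
proof (induction p)
  case (Seq p q)
  then show ?case by (cases "p = Skip") (auto simp: wf_act_def idle_def)
qed (auto simp: wf_act_def idle_def)

definition init_state :: "bool list \<Rightarrow> state" where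
  "init_state x = (\<lambda>i. if i = 0 then (word_tape x, 0) else (word_tape [], 0))"

definition list_reads :: "nat list \<Rightarrow> readings" where
  "list_reads rs = (\<lambda>i. if i < length rs then rs ! i else 0)"

locale compilation =
  fixes prg :: prog and K S N :: nat and state_of :: "prog \<Rightarrow> nat"
  assumes wf: "wf_prog K S prg" and tapes: "K \<ge> 1" and symbols: "S \<ge> 3" and states: "N \<ge> 2"
    and inj_state_of: "inj_on state_of (residuals prg)" and state_of_prg: "state_of prg = 0"
    and state_of_Skip: "state_of Skip = 1"
    and state_of_less: "q \<in> residuals prg \<Longrightarrow> state_of q < N"
begin

definition machine :: tm where
  "machine = \<lparr>tm_tapes = K, tm_states = N, tm_symbols = S,
     tm_trans = {(state_of p, rs, state_of (next_prog p (list_reads rs)),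
       map (next_act p (list_reads rs)) [0..<K]) |
       p rs. p \<in> residuals prg \<and> p \<noteq> Skip \<and> length rs = K \<and> set rs \<subseteq> {..<S}}\<rparr>"

lemma machine_simps [simp]:
  "tm_tapes machine = K" "tm_states machine = N" "tm_symbols machine = S"
  by (simp_all add: machine_def)

lemma machineE:
  assumes "tr \<in> tm_trans machine"
  obtains p rs where "p \<in> residuals prg" "p \<noteq> Skip" "length rs = K" "set rs \<subseteq> {..<S}"
    "tr = (state_of p, rs, state_of (next_prog p (list_reads rs)),
        map (next_act p (list_reads rs)) [0..<K])"
  using assms by (auto simp: machine_def)

lemma turing_machine_machine: "turing_machine machine"
proof -
  have "case tr of (q, rs, q', as) \<Rightarrow> q < tm_states machine \<and> q \<noteq> 1 \<and> q' < tm_states machine \<and>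
      length rs = tm_tapes machine \<and> set rs \<subseteq> {..<tm_symbols machine} \<and>
      length as = tm_tapes machine \<and> fst ` set as \<subseteq> {..<tm_symbols machine}"
    if "tr \<in> tm_trans machine" for tr
    using that
  proof (rule machineE)
    fix p rs
    assume p: "p \<in> residuals prg" "p \<noteq> Skip" and rs: "length rs = K" "set rs \<subseteq> {..<S}"
      and tr: "tr = (state_of p, rs, state_of (next_prog p (list_reads rs)),
          map (next_act p (list_reads rs)) [0..<K])"
    have "state_of p \<noteq> 1"
      using p inj_state_of state_of_Skip Skip_in_residuals[of prg] unfolding inj_on_def by metis
    moreover have "\<forall>j. list_reads rs j < S"
      using rs symbols by (auto simp: list_reads_def subset_iff)
    then have "fst (next_act p (list_reads rs) i) < S" for i
      using wf_next_act[OF wf_residuals[OF wf p(1)]] by (auto simp: wf_act_def)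
    ultimately show ?thesis
      using p rs state_of_less next_prog_in_residuals[OF p(1)] by (auto simp: tr)
  qed
  then show ?thesis
    using tapes states symbols unfolding turing_machine_def by (intro conjI ballI) simp_all
qed

lemma deterministic_machine: "deterministic machine"
  unfolding deterministic_def machine_def using inj_state_of by (auto simp: inj_on_def)

definition confined :: "state \<Rightarrow> bool" where
  "confined s \<longleftrightarrow> (\<forall>i\<ge>K. reads s i = 0) \<and> (\<forall>i j. fst (s i) j < S)"

definition config_of :: "prog \<Rightarrow> state \<Rightarrow> config" where
  "config_of p s = (state_of p, map s [0..<K])"

lemma confined_init_state: "confined (init_state x)"
  using tapes symbols by (auto simp: confined_def init_state_def reads_def word_tape_def)

lemma config_of_init_state: "config_of prg (init_state x) = tm_init machine x"
proof -
  have "map (init_state x) [0..<K] = (word_tape x, 0) # replicate (K - 1) (word_tape [], 0)"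
    using tapes by (intro nth_equalityI) (auto simp: init_state_def nth_Cons split: nat.splits)
  then show ?thesis by (simp add: config_of_def tm_init_def state_of_prg)
qed

lemma
  assumes p: "p \<in> residuals prg" "p \<noteq> Skip" and s: "confined s"
    and step: "prog_step (p, s) = (p', s')"
  shows confined_prog_step: "confined s'"
    and tm_step_machine: "tm_step machine (config_of p s) (config_of p' s')"
proof -
  let ?r = "reads s" and ?rs = "map read_tape (map s [0..<K])"
  have p': "p' = next_prog p ?r" and s': "s' = apply_act (next_act p ?r) s"
    using step by (auto simp: prog_step_def)
  have r: "?r j < S" for j using s by (simp add: confined_def reads_def)
  then have act: "fst (next_act p ?r i) < S" "K \<le> i \<Longrightarrow> next_act p ?r i = (?r i, MStay)" for i
    using wf_next_act[OF wf_residuals[OF wf p(1)]] by (auto simp: wf_act_def)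
  have "s' i = s i" if "K \<le> i" for i
    by (simp add: s' apply_act_def act(2)[OF that] read_tape_eq_reads[symmetric] act_tape_idle)
  then have "\<forall>i\<ge>K. reads s' i = 0" using s by (simp add: confined_def reads_def)
  moreover have "fst (act_tape a t) j < S" if "fst a < S" "fst t j < S" for a t j
    using that by (cases a; cases t) auto
  then have "fst (s' i) j < S" for i j
    using act(1) s by (simp add: s' apply_act_def confined_def)
  ultimately show "confined s'" by (simp add: confined_def)
  have "list_reads ?rs = ?r"
    using s by (auto simp: list_reads_def read_tape_eq_reads confined_def)
  moreover have "set ?rs \<subseteq> {..<S}" using r by (auto simp: read_tape_eq_reads)
  ultimately have "(state_of p, ?rs, state_of p', map (next_act p ?r) [0..<K]) \<in> tm_trans machine"
    using p unfolding machine_def p' by (auto intro!: exI[of _ p] exI[of _ ?rs])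
  moreover have "map2 act_tape (map (next_act p ?r) [0..<K]) (map s [0..<K]) = map s' [0..<K]"
    by (intro nth_equalityI) (auto simp: s' apply_act_def)
  ultimately show "tm_step machine (config_of p s) (config_of p' s')"
    unfolding tm_step_def config_of_def
    by (intro exI[of _ "state_of p'"] exI[of _ "map (next_act p ?r) [0..<K]"]) simp
qed

lemma tm_steps_machine:
  "small_steps n p s p' s' \<Longrightarrow> p \<in> residuals prg \<Longrightarrow> confined s \<Longrightarrow>
    (tm_step machine ^^ n) (config_of p s) (config_of p' s')"
proof (induction rule: small_steps.induct)
  case (small_step p s p' s' n p'' s'')
  have "p' \<in> residuals prg"
    using small_step.hyps(2) small_step.prems(1) next_prog_in_residuals
    by (auto simp: prog_step_def)
  then have "(tm_step machine ^^ n) (config_of p' s') (config_of p'' s'')"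
    using small_step.IH confined_prog_step small_step.hyps(1,2) small_step.prems by blast
  then show ?case
    using tm_step_machine[OF small_step.prems(1) small_step.hyps(1) small_step.prems(2)
      small_step.hyps(2)]
    by (rule relpowp_Suc_I2[rotated])
qed simp

lemma outputs_within_machine:
  assumes "runs prg (init_state x) s t" "fst (s 0) = word_tape y"
  shows "outputs_within machine x y t"
proof -
  obtain n where n: "n \<le> t" "small_steps n prg (init_state x) Skip s" using assms(1) by (rule runsE)
  have "(tm_step machine ^^ n) (tm_init machine x) (1, map s [0..<K])"
    using tm_steps_machine[OF n(2) self_in_residuals confined_init_state]
    by (simp add: config_of_init_state, simp add: config_of_def state_of_Skip)
  moreover have "hd (map s [0..<K]) = s 0" using tapes by (simp add: hd_map)
  ultimately show ?thesis
    unfolding outputs_within_def using n(1) assms(2) by metis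
qed

end

lemma ex_compilation:
  assumes "wf_prog K S p" "K \<ge> 1" "S \<ge> 3" "p \<noteq> Skip"
  shows "\<exists>N state_of. compilation p K S N state_of"
proof -
  obtain h :: "prog \<Rightarrow> nat" where h: "inj_on h (residuals p)"
    using finite_imp_inj_to_nat_seg[OF finite_residuals[of p]] by blast
  define state_of where "state_of q = (if q = p then 0 else if q = Skip then 1 else h q + 2)" for q
  have "state_of q < Max (state_of ` residuals p) + 2" if "q \<in> residuals p" for q
    using Max_ge[of "state_of ` residuals p" "state_of q"] that finite_residuals by fastforce
  moreover have "inj_on state_of (residuals p)"
    using h assms(4) by (auto simp: inj_on_def state_of_def)
  ultimately have "compilation p K S (Max (state_of ` residuals p) + 2) state_of"
    using assms by unfold_locales (auto simp: state_of_def)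
  then show ?thesis by blast
qed

theorem polytime_computable_if_runs:
  fixes q :: "nat poly"
  assumes "wf_prog K S p" "K \<ge> 1" "S \<ge> 3" "p \<noteq> Skip"
    and runs: "\<And>x. \<exists>s. runs p (init_state x) s (poly q (length x)) \<and> fst (s 0) = word_tape (r x)"
  shows "polytime_computable r"
proof -
  obtain N state_of where "compilation p K S N state_of" using ex_compilation assms(1-4) by blast
  then interpret compilation p K S N state_of .
  have "outputs_within machine x (r x) (poly q (length x))" for x
    using runs[of x] outputs_within_machine by blast
  then show ?thesis
    unfolding polytime_computable_def using turing_machine_machine deterministic_machine by blast
qed

section \<open>Counting loops\<close>

definition shift :: "(nat \<Rightarrow> int) \<Rightarrow> int \<Rightarrow> state \<Rightarrow> state" where
  "shift u j s = (\<lambda>i. (fst (s i), snd (s i) + j * u i))"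

lemma shift_0 [simp]: "shift u 0 s = s"
  by (auto simp: shift_def)

lemma shift_commute: "shift u j (shift v k s) = shift v k (shift u j s)"
  by (auto simp: shift_def algebra_simps)

lemma shift_upd: "u i = 0 \<Longrightarrow> shift u j (s(i := v)) = (shift u j s)(i := v)"
  by (auto simp: shift_def)

definition dir_vec :: "(nat \<Rightarrow> int) \<Rightarrow> bool" where
  "dir_vec u \<longleftrightarrow> (\<forall>i. u i = -1 \<or> u i = 0 \<or> u i = 1)"

definition move_of :: "int \<Rightarrow> move" where
  "move_of k = (if k > 0 then MRight else if k < 0 then MLeft else MStay)"

definition Shift :: "(nat \<Rightarrow> int) \<Rightarrow> prog" where
  "Shift u = Act (\<lambda>r i. (r i, move_of (u i)))"

lemma runs_Shift:
  assumes "dir_vec u"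
  shows "runs (Shift u) (shift u j s) (shift u (j + 1) s) 1"
proof -
  let ?s = "shift u j s"
  have "apply_act (\<lambda>i. (reads ?s i, move_of (u i))) ?s i = shift u (j + 1) s i" for i
    using assms[unfolded dir_vec_def, rule_format, of i]
    by (auto simp: apply_act_def reads_def shift_def move_of_def algebra_simps)
  then show ?thesis
    unfolding Shift_def using runs_Act[of "\<lambda>r i. (r i, move_of (u i))" ?s] by presburger
qed

lemma runs_Shift_neg:
  assumes "dir_vec u"
  shows "runs (Shift (\<lambda>i. - u i)) (shift u j s) (shift u (j - 1) s) 1"
proof -
  have "dir_vec (\<lambda>i. - u i)" using assms by (auto simp: dir_vec_def)
  moreover have "shift (\<lambda>i. - u i) k s = shift u (- k) s" for k by (simp add: shift_def)
  ultimately show ?thesis using runs_Shift[of "\<lambda>i. - u i" "- j" s] by simp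
qed

abbreviation tape_of :: "bool list \<Rightarrow> tape" where
  "tape_of w \<equiv> (word_tape w, 0)"

definition is_block :: "tape \<Rightarrow> nat \<Rightarrow> bool" where
  "is_block t N \<longleftrightarrow> snd t = 0 \<and> (\<forall>i. fst t i \<noteq> 0 \<longleftrightarrow> 0 \<le> i \<and> i < int N)"

lemma is_block_tape_of [simp]: "is_block (tape_of w) (length w)"
  by (auto simp: is_block_def word_tape_def)

lemma reads_shift_block:
  assumes "is_block (s c) N" "u c = 1"
  shows "reads (shift u j s) c = 0 \<longleftrightarrow> \<not> (0 \<le> j \<and> j < int N)"
proof -
  have "fst (s c) j = 0 \<longleftrightarrow> \<not> (0 \<le> j \<and> j < int N)" using assms(1) unfolding is_block_def by blast
  then show ?thesis using assms by (simp add: reads_def shift_def is_block_def)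
qed

lemma runs_to_end:
  assumes u: "dir_vec u" "u c = 1" and block: "is_block (s c) N" and k: "k \<le> N"
  shows "runs (While (\<lambda>r. r c \<noteq> 0) (Shift u)) (shift u (int k) s) (shift u (int N) s)
      ((N - k) * 3 + 1)"
proof -
  let ?st = "\<lambda>j. shift u (int (k + j)) s"
  have "runs (While (\<lambda>r. r c \<noteq> 0) (Shift u)) (?st 0) (?st (N - k)) ((N - k) * (1 + 2) + 1)"
    using runs_Shift[OF u(1), of "int (k + _)" s]
    by (intro runs_While_iterate) (auto simp: reads_shift_block[of s c N u, OF block u(2)] ac_simps)
  then show ?thesis using k by (auto elim: runs_mono)
qed

definition rewind :: "nat \<Rightarrow> (nat \<Rightarrow> int) \<Rightarrow> prog" where
  "rewind c u = Seq (Shift (\<lambda>i. - u i)) (Seq (While (\<lambda>r. r c \<noteq> 0) (Shift (\<lambda>i. - u i))) (Shift u))"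

lemma runs_rewind:
  assumes u: "dir_vec u" "u c = 1" and block: "is_block (s c) N"
  shows "runs (rewind c u) (shift u (int N) s) s (N * 3 + 6)"
proof -
  let ?st = "\<lambda>k. shift u (int N - 1 - int k) s"
  have step_back: "runs (Shift (\<lambda>i. - u i)) (shift u (int N) s) (?st 0) 1"
    using runs_Shift_neg[OF u(1), of "int N"] by simp
  have to_left_end: "runs (While (\<lambda>r. r c \<noteq> 0) (Shift (\<lambda>i. - u i))) (?st 0) (?st N)
      (N * (1 + 2) + 1)"
    using runs_Shift_neg[OF u(1), of "int N - 1 - int _" s]
    by (intro runs_While_iterate) (auto simp: reads_shift_block[of s c N u, OF block u(2)]
      algebra_simps)
  have forward: "runs (Shift u) (?st N) s 1"
    using runs_Shift[OF u(1), of "-1" s] by simp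
  from runs_Seq[OF step_back runs_Seq[OF to_left_end forward]] show ?thesis
    unfolding rewind_def by (rule runs_mono) simp
qed

text \<open>The loop moves the heads along \<^term>\<open>u\<close> after every round, so the body can read off the
  tapes whether an affine function of the loop counters takes some fixed value.\<close>

definition For :: "nat \<Rightarrow> (nat \<Rightarrow> int) \<Rightarrow> prog \<Rightarrow> prog" where
  "For c u body = Seq (While (\<lambda>r. r c \<noteq> 0) (Seq body (Shift u))) (rewind c u)"

lemma runs_For:
  assumes u: "dir_vec u" "u c = 1" and block: "\<And>j. is_block (st j c) N"
    and body: "\<And>j. j < N \<Longrightarrow> runs body (shift u (int j) (st j)) (shift u (int j) (st (Suc j))) t"
  shows "runs (For c u body) (st 0) (st N) (N * (t + 7) + 8)"
proof -
  let ?st = "\<lambda>j. shift u (int j) (st j)"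
  have loop: "runs (While (\<lambda>r. r c \<noteq> 0) (Seq body (Shift u))) (?st 0) (?st N)
      (N * ((t + 1 + 1) + 2) + 1)"
  proof (rule runs_While_iterate)
    fix j assume j: "j < N"
    then show "reads (?st j) c \<noteq> 0" by (simp add: reads_shift_block[of "st j" c N u, OF block u(2)])
    have "runs (Shift u) (shift u (int j) (st (Suc j))) (?st (Suc j)) 1"
      using runs_Shift[OF u(1), of "int j" "st (Suc j)"] by (simp add: add.commute)
    with body[OF j] show "runs (Seq body (Shift u)) (?st j) (?st (Suc j)) (t + 1 + 1)"
      by (rule runs_Seq)
  next
    show "\<not> reads (?st N) c \<noteq> 0" by (simp add: reads_shift_block[of "st N" c N u, OF block u(2)])
  qed
  from runs_Seq[OF loop runs_rewind[of u c "st N" N, OF u block]] show ?thesis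
    unfolding For_def by (simp add: algebra_simps)
qed

definition axis :: "nat \<Rightarrow> nat \<Rightarrow> int" where
  "axis c = (\<lambda>i. if i = c then 1 else 0)"

lemma dir_vec_axis [simp]: "dir_vec (axis c)"
  by (auto simp: dir_vec_def axis_def)

lemma axis_same [simp]: "axis c c = 1"
  by (auto simp: axis_def)

lemma axis_other [simp]: "i \<noteq> c \<Longrightarrow> axis c i = 0"
  by (auto simp: axis_def)

definition seqs :: "prog list \<Rightarrow> prog" where
  "seqs ps = foldr Seq ps Skip"

lemma runs_replicate:
  assumes "\<And>k. a \<le> k \<Longrightarrow> k < a + n \<Longrightarrow> runs p (st k) (st (Suc k)) t"
  shows "runs (seqs (replicate n p)) (st a) (st (a + n)) (n * (t + 1))"
  using assms
proof (induction n arbitrary: a)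
  case (Suc n)
  have "runs (seqs (replicate n p)) (st (Suc a)) (st (Suc a + n)) (n * (t + 1))"
    by (rule Suc.IH) (use Suc.prems in auto)
  with Suc.prems[of a]
  have "runs (Seq p (seqs (replicate n p))) (st a) (st (Suc a + n)) (t + n * (t + 1) + 1)"
    by (intro runs_Seq) auto
  then show ?case by (simp add: seqs_def add.assoc add.left_commute)
qed (simp add: seqs_def runs_Skip)

text \<open>Horner's scheme, to repeat a program as often as the polynomial with the given coefficients
  says. Tape \<^term>\<open>d + i\<close> drives the \<^term>\<open>i\<close>-th nested loop.\<close>

fun poly_loop :: "nat \<Rightarrow> nat list \<Rightarrow> prog \<Rightarrow> prog" where
  "poly_loop d [] p = Skip"
| "poly_loop d (a # as) p = Seq (seqs (replicate a p)) (For d (axis d) (poly_loop (Suc d) as p))"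

context
  fixes st :: "state \<Rightarrow> nat \<Rightarrow> state" and p :: prog and d0 :: nat
  assumes shift_st: "\<And>s a d j. d \<ge> d0 \<Longrightarrow> st (shift (axis d) j s) a = shift (axis d) j (st s a)"
    and st_eq: "\<And>s a d. d \<ge> d0 \<Longrightarrow> st s a d = s d"
begin

lemma runs_For_poly_loop:
  assumes d: "d \<ge> d0" and blocks: "\<forall>i\<le>length as. is_block (s (d + i)) L"
    and inner: "\<And>s a. (\<forall>i<length as. is_block (s (Suc d + i)) L) \<Longrightarrow> a + n \<le> limit \<Longrightarrow>
      runs (poly_loop (Suc d) as p) (st s a) (st s (a + n)) t"
    and limit: "a + L * n \<le> limit"
  shows "runs (For d (axis d) (poly_loop (Suc d) as p)) (st s a) (st s (a + L * n))
      (L * (t + 7) + 8)"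
proof -
  let ?st = "\<lambda>j. st s (a + j * n)"
  have "runs (For d (axis d) (poly_loop (Suc d) as p)) (?st 0) (?st L) (L * (t + 7) + 8)"
  proof (rule runs_For)
    show "is_block (?st j d) L" for j
      using d blocks[rule_format, of 0] by (simp add: st_eq)
    fix j assume j: "j < L"
    let ?s = "shift (axis d) (int j) s"
    have "is_block (?s (Suc d + i)) L" if "i < length as" for i
      using blocks[rule_format, of "Suc i"] that by (simp add: shift_def)
    moreover have "Suc j * n \<le> L * n" using j by (intro mult_right_mono) auto
    then have "a + j * n + n \<le> limit" using limit by simp
    ultimately have "runs (poly_loop (Suc d) as p) (st ?s (a + j * n)) (st ?s (a + j * n + n)) t"
      by (intro inner) auto
    then show "runs (poly_loop (Suc d) as p) (shift (axis d) (int j) (?st j))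
        (shift (axis d) (int j) (?st (Suc j))) t"
      using d by (simp add: shift_st algebra_simps)
  qed auto
  then show ?thesis by simp
qed

lemma runs_poly_loop:
  fixes q :: "nat poly"
  assumes step: "\<And>s a L. a < limit L \<Longrightarrow> runs p (st s a) (st s (Suc a)) (poly q L)"
  shows "\<exists>q'. \<forall>d s a L. d \<ge> d0 \<longrightarrow> (\<forall>i<length as. is_block (s (d + i)) L) \<longrightarrow>
     a + poly (Poly as) L \<le> limit L \<longrightarrow>
     runs (poly_loop d as p) (st s a) (st s (a + poly (Poly as) L)) (poly q' L)"
proof (induction as)
  case Nil
  show ?case by (simp add: runs_Skip)
next
  case (Cons c as)
  then obtain q' where loops: "\<And>d s a L. d \<ge> d0 \<Longrightarrow> (\<forall>i<length as. is_block (s (d + i)) L) \<Longrightarrow>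
      a + poly (Poly as) L \<le> limit L \<Longrightarrow>
      runs (poly_loop d as p) (st s a) (st s (a + poly (Poly as) L)) (poly q' L)" by blast
  have "runs (poly_loop d (c # as) p) (st s a) (st s (a + poly (Poly (c # as)) L))
      (c * (poly q L + 1) + (L * (poly q' L + 7) + 8) + 1)"
    if d: "d \<ge> d0" and blocks: "\<forall>i<length (c # as). is_block (s (d + i)) L"
      and limit: "a + poly (Poly (c # as)) L \<le> limit L" for d s a L
  proof -
    have replicated: "runs (seqs (replicate c p)) (st s a) (st s (a + c)) (c * (poly q L + 1))"
      by (rule runs_replicate) (use step limit in auto)
    have "runs (For d (axis d) (poly_loop (Suc d) as p)) (st s (a + c))
        (st s (a + c + L * poly (Poly as) L)) (L * (poly q' L + 7) + 8)"
      by (rule runs_For_poly_loop[where limit = "limit L", OF d _ loops])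
        (use d blocks limit in \<open>auto simp: less_Suc_eq_le\<close>)
    from runs_Seq[OF replicated this] show ?thesis by (simp add: add.assoc)
  qed
  then show ?case
    by (intro exI[of _ "[:c:] * (q + 1) + ([:0, 1:] * (q' + [:7:]) + [:8:]) + 1"]) simp
qed

end

definition polytime_runs ::
  "'i set \<Rightarrow> ('i \<Rightarrow> nat) \<Rightarrow> prog \<Rightarrow> ('i \<Rightarrow> state) \<Rightarrow> ('i \<Rightarrow> state) \<Rightarrow> bool" where
  "polytime_runs I len p S S' \<longleftrightarrow> (\<exists>q. \<forall>i\<in>I. runs p (S i) (S' i) (poly q (len i)))"

lemma polytime_runsI:
  "(\<And>i. i \<in> I \<Longrightarrow> runs p (S i) (S' i) (poly q (len i))) \<Longrightarrow> polytime_runs I len p S S'"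
  unfolding polytime_runs_def by blast

lemma polytime_runsE:
  assumes "polytime_runs I len p S S'"
  obtains q where "\<And>i. i \<in> I \<Longrightarrow> runs p (S i) (S' i) (poly q (len i))"
  using assms unfolding polytime_runs_def by blast

lemma polytime_runs_const: "(\<And>i. i \<in> I \<Longrightarrow> runs p (S i) (S' i) t) \<Longrightarrow> polytime_runs I len p S S'"
  by (rule polytime_runsI[where q = "[:t:]"]) simp

lemma polytime_runs_reindex:
  assumes "polytime_runs I len p S S'"
    and "\<And>j. j \<in> J \<Longrightarrow> f j \<in> I \<and> len (f j) = len' j \<and> S (f j) = R j \<and> S' (f j) = R' j"
  shows "polytime_runs J len' p R R'"
  using assms unfolding polytime_runs_def by metis

lemma polytime_runs_Seq:
  assumes "polytime_runs I len p S M" "polytime_runs I len q M S'"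
  shows "polytime_runs I len (Seq p q) S S'"
proof -
  obtain a where a: "\<And>i. i \<in> I \<Longrightarrow> runs p (S i) (M i) (poly a (len i))"
    using polytime_runsE[OF assms(1)] by blast
  obtain b where b: "\<And>i. i \<in> I \<Longrightarrow> runs q (M i) (S' i) (poly b (len i))"
    using polytime_runsE[OF assms(2)] by blast
  show ?thesis by (rule polytime_runsI[where q = "a + b + 1"]) (use runs_Seq[OF a b] in simp)
qed

lemma polytime_runs_Cond:
  assumes "polytime_runs {i \<in> I. b (reads (S i))} len p S S'"
    and "polytime_runs {i \<in> I. \<not> b (reads (S i))} len q S S'"
  shows "polytime_runs I len (Cond b p q) S S'"
proof -
  obtain c where c: "\<And>i. i \<in> {i \<in> I. b (reads (S i))} \<Longrightarrow> runs p (S i) (S' i) (poly c (len i))"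
    using polytime_runsE[OF assms(1)] by blast
  obtain d where d: "\<And>i. i \<in> {i \<in> I. \<not> b (reads (S i))} \<Longrightarrow> runs q (S i) (S' i) (poly d (len i))"
    using polytime_runsE[OF assms(2)] by blast
  show ?thesis
  proof (rule polytime_runsI[where q = "c + d + 1"])
    fix i assume "i \<in> I"
    then have "runs (if b (reads (S i)) then p else q) (S i) (S' i)
        (poly c (len i) + poly d (len i))"
      using c[of i] d[of i] by (auto intro: runs_mono)
    from runs_Cond[of b "S i" p q "S' i", OF this]
    show "runs (Cond b p q) (S i) (S' i) (poly (c + d + 1) (len i))" by simp
  qed
qed

lemma polytime_runs_For:
  assumes u: "dir_vec u" "u c = 1" and block: "\<And>i j. i \<in> I \<Longrightarrow> is_block (st i j c) (N i)"
    and N: "\<And>i. i \<in> I \<Longrightarrow> N i \<le> poly qN (len i)"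
    and body: "polytime_runs {(i, j). i \<in> I \<and> j < N i} (\<lambda>(i, j). len i) body
      (\<lambda>(i, j). shift u (int j) (st i j)) (\<lambda>(i, j). shift u (int j) (st i (Suc j)))"
  shows "polytime_runs I len (For c u body) (\<lambda>i. st i 0) (\<lambda>i. st i (N i))"
proof -
  obtain q where q: "\<And>i j. i \<in> I \<Longrightarrow> j < N i \<Longrightarrow>
      runs body (shift u (int j) (st i j)) (shift u (int j) (st i (Suc j))) (poly q (len i))"
    using body unfolding polytime_runs_def by auto
  show ?thesis
  proof (rule polytime_runsI[where q = "qN * (q + [:7:]) + [:8:]"])
    fix i assume i: "i \<in> I"
    have "runs (For c u body) (st i 0) (st i (N i)) (N i * (poly q (len i) + 7) + 8)"
      by (rule runs_For[OF u block[OF i] q[OF i]])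
    then show "runs (For c u body) (st i 0) (st i (N i)) (poly (qN * (q + [:7:]) + [:8:]) (len i))"
      by (rule runs_mono) (use N[OF i] in simp)
  qed
qed

lemma polytime_runs_poly_loop:
  fixes pl q :: "nat poly"
  assumes step: "\<And>s a L. a < poly pl L \<Longrightarrow> runs p (st s a) (st s (Suc a)) (poly q L)"
    and comm: "\<And>s a c j. c \<ge> d \<Longrightarrow> st (shift (axis c) j s) a = shift (axis c) j (st s a)"
    and keep: "\<And>s a c. c \<ge> d \<Longrightarrow> st s a c = s c"
    and blocks: "\<And>i j. i \<in> I \<Longrightarrow> j < length (coeffs pl) \<Longrightarrow> is_block (S i (d + j)) (len i)"
  shows "polytime_runs I len (poly_loop d (coeffs pl) p) (\<lambda>i. st (S i) 0)
      (\<lambda>i. st (S i) (poly pl (len i)))"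
proof -
  obtain q' where q': "\<And>s L. (\<forall>i<length (coeffs pl). is_block (s (d + i)) L) \<Longrightarrow>
      runs (poly_loop d (coeffs pl) p) (st s 0) (st s (poly pl L)) (poly q' L)"
    using runs_poly_loop[of d st "poly pl" p q "coeffs pl", OF comm keep step]
    by (metis Poly_coeffs add_0 order_refl)
  show ?thesis by (rule polytime_runsI[where q = q']) (use q' blocks in blast)
qed

section \<open>Writing words and numbers\<close>

abbreviation bit_symbol :: "bool \<Rightarrow> nat" where
  "bit_symbol b \<equiv> (if b then 2 else 1)"

definition written :: "bool list \<Rightarrow> tape" where
  "written w = (word_tape w, int (length w))"

lemma shift_axis_tape_of: "shift (axis c) (int (length w)) (s(c := tape_of w)) = s(c := written w)"
  by (auto simp: shift_def axis_def written_def fun_eq_iff)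

definition write_move :: "nat set \<Rightarrow> nat \<Rightarrow> move \<Rightarrow> prog" where
  "write_move A a m = Act (\<lambda>r i. if i \<in> A then (a, m) else (r i, MStay))"

lemma runs_write_move:
  "runs (write_move A a m) s (\<lambda>i. if i \<in> A then act_tape (a, m) (s i) else s i) 1"
proof -
  have "apply_act (\<lambda>i. if i \<in> A then (a, m) else (reads s i, MStay)) s =
    (\<lambda>i. if i \<in> A then act_tape (a, m) (s i) else s i)"
    by (auto simp: apply_act_def read_tape_eq_reads[symmetric] act_tape_idle)
  then show ?thesis
    unfolding write_move_def
    using runs_Act[of "\<lambda>r i. if i \<in> A then (a, m) else (r i, MStay)" s] by simp
qed

lemma runs_write_move_single: "runs (write_move {c} a m) s (s(c := act_tape (a, m) (s c))) 1"
proof -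
  have "(\<lambda>i. if i \<in> {c} then act_tape (a, m) (s i) else s i) = s(c := act_tape (a, m) (s c))"
    by auto
  then show ?thesis using runs_write_move[of "{c}" a m s] by simp
qed

lemma word_tape_overwrite:
  "(word_tape (u @ v))(int (length u) := bit_symbol b) = word_tape (u @ b # tl v)"
proof (cases v)
  case Nil
  then show ?thesis by (auto simp: word_tape_def nth_append fun_eq_iff nat_less_iff)
next
  case (Cons a v')
  have "(word_tape w)(int j := bit_symbol b) = word_tape (w[j := b])" if "j < length w" for j w
    using that by (auto simp: word_tape_def nth_list_update fun_eq_iff)
  from this[of "length u" "u @ v"] show ?thesis by (simp add: Cons)
qed

lemma runs_write_bit:
  "runs (write_move {c} (bit_symbol b) MRight) (s(c := (word_tape (u @ v), int (length u))))
     (s(c := (word_tape (u @ b # tl v), int (Suc (length u))))) 1"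
  using runs_write_move_single[of c "bit_symbol b" MRight
      "s(c := (word_tape (u @ v), int (length u)))"]
  by (simp add: word_tape_overwrite add.commute)

text \<open>Tape 0 is the output tape.\<close>

definition emits :: "'i set \<Rightarrow> ('i \<Rightarrow> nat) \<Rightarrow> prog \<Rightarrow> ('i \<Rightarrow> state) \<Rightarrow> ('i \<Rightarrow> bool list) \<Rightarrow> bool" where
  "emits I len p S w \<longleftrightarrow> polytime_runs (I \<times> UNIV) (\<lambda>(i, y). len i) p
     (\<lambda>(i, y). (S i)(0 := written y)) (\<lambda>(i, y). (S i)(0 := written (y @ w i)))"

lemma emitsI:
  assumes "\<And>i y. i \<in> I \<Longrightarrow> runs p ((S i)(0 := written y)) ((S i)(0 := written (y @ w i)))
      (poly q (len i))"
  shows "emits I len p S w"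
  unfolding emits_def by (rule polytime_runsI[where q = q]) (use assms in auto)

lemma emitsE:
  assumes "emits I len p S w"
  obtains q where "\<And>i y. i \<in> I \<Longrightarrow>
    runs p ((S i)(0 := written y)) ((S i)(0 := written (y @ w i))) (poly q (len i))"
  using assms unfolding emits_def polytime_runs_def by auto

lemma emits_reindex:
  assumes "emits I len p S w"
    and "\<And>j. j \<in> J \<Longrightarrow> f j \<in> I \<and> len (f j) = len' j \<and> S (f j) = S' j \<and> w (f j) = w' j"
  shows "emits J len' p S' w'"
  using assms(1) unfolding emits_def
  by (rule polytime_runs_reindex[where f = "\<lambda>(j, y). (f j, y)"]) (use assms(2) in auto)

lemma emits_cong:
  assumes "emits I len p S w" "\<And>i. i \<in> I \<Longrightarrow> S i = S' i" "\<And>i. i \<in> I \<Longrightarrow> w i = w' i"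
  shows "emits I len p S' w'"
  using assms(1) by (rule emits_reindex[where f = id]) (use assms(2,3) in simp)

lemma emits_Skip: "emits I len Skip S (\<lambda>_. [])"
  by (rule emitsI[where q = 0]) (simp add: runs_Skip)

lemma emits_Seq:
  assumes "emits I len p S v" "emits I len q S w"
  shows "emits I len (Seq p q) S (\<lambda>i. v i @ w i)"
proof -
  obtain a where a: "\<And>i y. i \<in> I \<Longrightarrow>
      runs p ((S i)(0 := written y)) ((S i)(0 := written (y @ v i))) (poly a (len i))"
    using emitsE[OF assms(1)] by blast
  obtain b where b: "\<And>i y. i \<in> I \<Longrightarrow>
      runs q ((S i)(0 := written y)) ((S i)(0 := written (y @ w i))) (poly b (len i))"
    using emitsE[OF assms(2)] by blast
  show ?thesis by (rule emitsI[where q = "a + b + 1"]) (use runs_Seq[OF a b] in simp)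
qed

lemma emits_seqs:
  assumes "\<And>k. k \<in> set ks \<Longrightarrow> emits I len (P k) S (w k)"
  shows "emits I len (seqs (map P ks)) S (\<lambda>i. concat (map (\<lambda>k. w k i) ks))"
  using assms
proof (induction ks)
  case (Cons k ks)
  have "emits I len (Seq (P k) (seqs (map P ks))) S (\<lambda>i. w k i @ concat (map (\<lambda>k. w k i) ks))"
    by (rule emits_Seq) (use Cons in auto)
  then show ?case by (simp add: seqs_def)
qed (simp add: seqs_def emits_Skip)

lemma reads_upd_0: "reads (s(0 := v)) = (reads s)(0 := fst v (snd v))"
  by (auto simp: reads_def)

lemma emits_Cond:
  assumes "emits {i \<in> I. b (reads (S i))} len p S w" "emits {i \<in> I. \<not> b (reads (S i))} len q S w"
    and b: "\<And>r v. b (r(0 := v)) = b r"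
  shows "emits I len (Cond b p q) S w"
  unfolding emits_def
proof (rule polytime_runs_Cond)
  let ?S = "\<lambda>(i, y). (S i)(0 := written y)"
  have "{iy \<in> I \<times> UNIV. b (reads (?S iy))} = {i \<in> I. b (reads (S i))} \<times> UNIV"
    "{iy \<in> I \<times> UNIV. \<not> b (reads (?S iy))} = {i \<in> I. \<not> b (reads (S i))} \<times> UNIV"
    by (auto simp: reads_upd_0 b)
  then show "polytime_runs {iy \<in> I \<times> UNIV. b (reads (?S iy))} (\<lambda>(i, y). len i) p
      ?S (\<lambda>(i, y). (S i)(0 := written (y @ w i)))"
    "polytime_runs {iy \<in> I \<times> UNIV. \<not> b (reads (?S iy))} (\<lambda>(i, y). len i) q
      ?S (\<lambda>(i, y). (S i)(0 := written (y @ w i)))"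
    using assms(1,2) by (simp_all add: emits_def)
qed

lemma emits_For:
  assumes u: "dir_vec u" "u c = 1" "u 0 = 0" and block: "\<And>i. i \<in> I \<Longrightarrow> is_block (S i c) (N i)"
    and N: "\<And>i. i \<in> I \<Longrightarrow> N i \<le> poly qN (len i)"
    and body: "emits {(i, j). i \<in> I \<and> j < N i} (\<lambda>(i, j). len i) body
        (\<lambda>(i, j). shift u (int j) (S i)) w"
  shows "emits I len (For c u body) S (\<lambda>i. concat (map (\<lambda>j. w (i, j)) [0..<N i]))"
proof -
  have "c \<noteq> 0" using u by (metis zero_neq_one)
  let ?done = "\<lambda>i j. concat (map (\<lambda>j. w (i, j)) [0..<j])"
  let ?st = "\<lambda>(i, y) j. (S i)(0 := written (y @ ?done i j))"
  obtain q where q: "\<And>i j y. (i, j) \<in> {(i, j). i \<in> I \<and> j < N i} \<Longrightarrow>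
      runs body ((shift u (int j) (S i))(0 := written y))
        ((shift u (int j) (S i))(0 := written (y @ w (i, j)))) (poly q (len i))"
    using emitsE[OF body] by (metis (no_types, lifting) case_prod_conv)
  have "polytime_runs (I \<times> UNIV) (\<lambda>(i, y). len i) (For c u body) (\<lambda>iy. ?st iy 0)
      (\<lambda>iy. ?st iy (N (fst iy)))"
  proof (rule polytime_runs_For[where qN = qN])
    have "runs body (shift u (int j) (?st (i, y) j)) (shift u (int j) (?st (i, y) (Suc j)))
        (poly q (len i))"
      if "i \<in> I" "j < N i" for i y j
      using q[of i j "y @ ?done i j"] that by (simp add: shift_upd[of u 0, OF u(3)])
    then show "polytime_runs {(iy, j). iy \<in> I \<times> UNIV \<and> j < N (fst iy)}
        (\<lambda>(iy, j). case iy of (i, y) \<Rightarrow> len i)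
        body (\<lambda>(iy, j). shift u (int j) (?st iy j)) (\<lambda>(iy, j). shift u (int j) (?st iy (Suc j)))"
      by (intro polytime_runsI[where q = q]) auto
  qed (use u block N \<open>c \<noteq> 0\<close> in auto)
  then show ?thesis
    unfolding emits_def by (rule polytime_runs_reindex[where f = id]) auto
qed

definition emit_bit :: "bool \<Rightarrow> prog" where
  "emit_bit b = write_move {0} (bit_symbol b) MRight"

lemma emits_bit: "emits I len (emit_bit b) S (\<lambda>_. [b])"
  by (rule emitsI[where q = 1])
    (use runs_write_bit[of 0 b _ _ "[]"] in \<open>simp add: emit_bit_def written_def add.commute\<close>)

definition emit_word :: "bool list \<Rightarrow> prog" where
  "emit_word w = seqs (map emit_bit w)"

lemma emits_word: "emits I len (emit_word w) S (\<lambda>_. w)"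
  using emits_seqs[of w I len emit_bit S "\<lambda>b _. [b]", OF emits_bit]
  by (simp add: emit_word_def)

definition emit_copy :: "nat \<Rightarrow> prog" where
  "emit_copy c = Cond (\<lambda>r. r c = 2) (emit_bit True) (emit_bit False)"

lemma emits_copy:
  assumes "c \<noteq> 0" "\<And>i. i \<in> I \<Longrightarrow> reads (S i) c = bit_symbol (b i)"
  shows "emits I len (emit_copy c) S (\<lambda>i. [b i])"
  unfolding emit_copy_def
proof (rule emits_Cond)
  show "emits {i \<in> I. reads (S i) c = 2} len (emit_bit True) S (\<lambda>i. [b i])"
    by (rule emits_cong[OF emits_bit]) (use assms(2) in \<open>auto split: if_splits\<close>)
  show "emits {i \<in> I. reads (S i) c \<noteq> 2} len (emit_bit False) S (\<lambda>i. [b i])"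
    by (rule emits_cong[OF emits_bit]) (use assms(2) in \<open>auto split: if_splits\<close>)
qed (use assms(1) in simp)

definition emit_number :: "nat \<Rightarrow> prog" where
  "emit_number c = Seq (For c (axis c) (Seq (emit_bit True) (emit_copy c))) (emit_bit False)"

lemma length_binary_le: "length (binary n) \<le> n"
proof (induction n rule: less_induct)
  case (less n)
  show ?case using less[of "n div 2"] by (subst binary.simps) auto
qed

lemma emits_number:
  assumes c: "c \<noteq> 0" and S: "\<And>i. i \<in> I \<Longrightarrow> S i c = tape_of (binary (v i))"
    and v: "\<And>i. i \<in> I \<Longrightarrow> v i \<le> poly qv (len i)"
  shows "emits I len (emit_number c) S (\<lambda>i. encode_nat (v i))"
proof -
  let ?digits = "\<lambda>i. binary (v i)"
  have digit: "emits {(i, j). i \<in> I \<and> j < length (?digits i)} (\<lambda>(i, j). len i)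
     (Seq (emit_bit True) (emit_copy c)) (\<lambda>(i, j). shift (axis c) (int j) (S i))
     (\<lambda>ij. [True] @ [?digits (fst ij) ! snd ij])"
    using c
    by (intro emits_Seq emits_bit emits_copy) (auto simp: S shift_def reads_def word_tape_def)
  have "emits I len (For c (axis c) (Seq (emit_bit True) (emit_copy c))) S
     (\<lambda>i. concat (map (\<lambda>j. [True] @ [?digits (fst (i, j)) ! snd (i, j)]) [0..<length (?digits i)]))"
    by (rule emits_For[where qN = qv, OF _ _ _ _ _ digit])
      (use c S order_trans[OF length_binary_le v] in auto)
  moreover have "concat (map (\<lambda>j. [True] @ [bs ! j]) [0..<length bs]) =
      concat (map (\<lambda>b. [True, b]) bs)" for bs
    by (rule arg_cong[of _ _ concat], rule nth_equalityI) auto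
  ultimately have "emits I len (For c (axis c) (Seq (emit_bit True) (emit_copy c))) S
     (\<lambda>i. concat (map (\<lambda>b. [True, b]) (?digits i)))" by simp
  from emits_Seq[OF this emits_bit[of _ _ False]] show ?thesis
    by (simp add: emit_number_def encode_nat_def)
qed

section \<open>Preparing words, numbers and marks\<close>

definition make_block :: "nat \<Rightarrow> nat \<Rightarrow> nat poly \<Rightarrow> prog" where
  "make_block d c q = Seq (poly_loop d (coeffs q) (write_move {c} 1 MRight)) (rewind c (axis c))"

lemma polytime_runs_make_block:
  assumes c: "c < d" and S: "\<And>i. i \<in> I \<Longrightarrow> S i c = tape_of []"
    and blocks: "\<And>i j. i \<in> I \<Longrightarrow> j < length (coeffs q) \<Longrightarrow> is_block (S i (d + j)) (len i)"
  shows "polytime_runs I len (make_block d c q) S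
    (\<lambda>i. (S i)(c := tape_of (replicate (poly q (len i)) False)))"
  unfolding make_block_def
proof (rule polytime_runs_Seq)
  let ?st = "\<lambda>s a. s(c := written (replicate a False))"
  have "runs (write_move {c} 1 MRight) (?st s a) (?st s (Suc a)) (poly 1 L)" for s a and L :: nat
    using runs_write_bit[of c False s "replicate a False" "[]"]
    by (simp add: written_def replicate_append_same add.commute)
  then have "polytime_runs I len (poly_loop d (coeffs q) (write_move {c} 1 MRight))
      (\<lambda>i. ?st (S i) 0) (\<lambda>i. ?st (S i) (poly q (len i)))"
    by (rule polytime_runs_poly_loop[where st = ?st]) (use c blocks in \<open>auto simp: shift_upd\<close>)
  then show "polytime_runs I len (poly_loop d (coeffs q) (write_move {c} 1 MRight)) S
      (\<lambda>i. ?st (S i) (poly q (len i)))"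
    by (rule polytime_runs_reindex[where f = id]) (use S in \<open>auto simp: written_def\<close>)
next
  let ?w = "\<lambda>i. replicate (poly q (len i)) False"
  show "polytime_runs I len (rewind c (axis c)) (\<lambda>i. (S i)(c := written (?w i)))
      (\<lambda>i. (S i)(c := tape_of (?w i)))"
  proof (rule polytime_runsI[where q = "q * [:3:] + [:6:]"])
    fix i
    have "runs (rewind c (axis c)) (shift (axis c) (int (length (?w i)))
        ((S i)(c := tape_of (?w i))))
        ((S i)(c := tape_of (?w i))) (length (?w i) * 3 + 6)"
      by (rule runs_rewind) (auto simp del: length_replicate)
    then show "runs (rewind c (axis c)) ((S i)(c := written (?w i))) ((S i)(c := tape_of (?w i)))
        (poly (q * [:3:] + [:6:]) (len i))"
      by (simp only: shift_axis_tape_of) (simp add: mult.commute)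
  qed
qed

lemma binary_carry:
  obtains k r where "binary a = replicate k True @ r" "r = [] \<or> \<not> hd r"
    "binary (Suc a) = replicate k False @ True # tl r"
proof (induction a arbitrary: thesis rule: less_induct)
  case (less a)
  consider "a = 0" | "a > 0" "even a" | "odd a" by blast
  then show ?case
  proof cases
    assume "a = 0"
    then show ?thesis by (intro less.prems[of 0 "[]"]) (simp_all add: binary.simps)
  next
    assume "a > 0" "even a"
    then have "binary a = False # binary (a div 2)" "binary (Suc a) = True # binary (a div 2)"
      by (subst binary.simps, simp)+
    then show ?thesis by (intro less.prems[of 0 "False # binary (a div 2)"]) simp_all
  next
    assume odd: "odd a"
    then obtain m where m: "a = 2 * m + 1" by (rule oddE)
    have "binary a = True # binary (a div 2)" "binary (Suc a) = False # binary (Suc (a div 2))"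
      by (subst binary.simps, simp add: m)+
    moreover obtain k r where "binary (a div 2) = replicate k True @ r" "r = [] \<or> \<not> hd r"
      "binary (Suc (a div 2)) = replicate k False @ True # tl r"
      using less.IH[of "a div 2"] odd by (auto simp: odd_pos)
    ultimately show ?thesis by (intro less.prems[of "Suc k" r]) simp_all
  qed
qed

definition clear_ones :: "nat \<Rightarrow> prog" where
  "clear_ones c = While (\<lambda>r. r c = 2) (write_move {c} 1 MRight)"

lemma runs_clear_ones:
  assumes "r = [] \<or> \<not> hd r"
  shows "runs (clear_ones c) (s(c := tape_of (replicate k True @ r)))
     (s(c := (word_tape (replicate k False @ r), int k))) (3 * k + 1)"
proof -
  let ?word = "\<lambda>j. replicate j False @ replicate (k - j) True @ r"
  let ?st = "\<lambda>j. s(c := (word_tape (?word j), int j))"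
  have "runs (clear_ones c) (?st 0) (?st k) (k * (1 + 2) + 1)"
    unfolding clear_ones_def
  proof (rule runs_While_iterate)
    fix j assume j: "j < k"
    then show "reads (?st j) c = 2" by (simp add: reads_def word_tape_def nth_append)
    have "replicate (k - j) True = True # replicate (k - Suc j) True"
      using j by (metis Suc_diff_Suc replicate_Suc)
    then show "runs (write_move {c} 1 MRight) (?st j) (?st (Suc j)) 1"
      using runs_write_bit[of c False s "replicate j False" "replicate (k - j) True @ r"]
      by (simp add: replicate_app_Cons_same)
  next
    show "\<not> reads (?st k) c = 2"
      using assms by (cases r) (auto simp: reads_def word_tape_def nth_append)
  qed
  then show ?thesis by (auto elim: runs_mono)
qed

definition binary_inc :: "nat \<Rightarrow> prog" where
  "binary_inc c = Seq (clear_ones c) (Seq (write_move {c} 2 MRight)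
     (Seq (While (\<lambda>r. r c \<noteq> 0) (Shift (axis c))) (rewind c (axis c))))"

lemma runs_binary_inc:
  "runs (binary_inc c) (s(c := tape_of (binary a))) (s(c := tape_of (binary (Suc a)))) (9 * a + 20)"
proof -
  obtain k r where r: "binary a = replicate k True @ r" "r = [] \<or> \<not> hd r"
    and Suc_a: "binary (Suc a) = replicate k False @ True # tl r" by (rule binary_carry)
  let ?s = "s(c := tape_of (binary (Suc a)))" and ?n = "length (binary (Suc a))"
  have n: "?n = Suc k + length (tl r)" by (simp add: Suc_a)
  have block: "is_block (?s c) ?n" by simp
  have "shift (axis c) (int (Suc k)) ?s = s(c := (word_tape (binary (Suc a)), int (Suc k)))"
    by (auto simp: shift_def fun_eq_iff axis_def)
  then have set_bit: "runs (write_move {c} 2 MRight)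
      (s(c := (word_tape (replicate k False @ r), int k)))
      (shift (axis c) (int (Suc k)) ?s) 1"
    using runs_write_bit[of c True s "replicate k False" r] by (simp add: Suc_a)
  have forward: "runs (While (\<lambda>r. r c \<noteq> 0) (Shift (axis c))) (shift (axis c) (int (Suc k)) ?s)
      (shift (axis c) (int ?n) ?s) ((?n - Suc k) * 3 + 1)"
    by (rule runs_to_end) (use block in \<open>auto simp: n\<close>)
  have rewind: "runs (rewind c (axis c)) (shift (axis c) (int ?n) ?s) ?s (?n * 3 + 6)"
    by (rule runs_rewind) (use block in auto)
  have "k + length r \<le> a" using length_binary_le[of a] r(1) by simp
  then show ?thesis
    using runs_Seq[OF runs_clear_ones[OF r(2), of c s k] runs_Seq[OF set_bit
      runs_Seq[OF forward rewind]]] n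
    unfolding binary_inc_def r(1)[symmetric] by (elim runs_mono) simp
qed

definition make_number :: "nat \<Rightarrow> nat \<Rightarrow> nat poly \<Rightarrow> prog" where
  "make_number d c q = poly_loop d (coeffs q) (binary_inc c)"

lemma polytime_runs_make_number:
  assumes c: "c < d" and S: "\<And>i. i \<in> I \<Longrightarrow> S i c = tape_of []"
    and blocks: "\<And>i j. i \<in> I \<Longrightarrow> j < length (coeffs q) \<Longrightarrow> is_block (S i (d + j)) (len i)"
  shows "polytime_runs I len (make_number d c q) S
      (\<lambda>i. (S i)(c := tape_of (binary (poly q (len i)))))"
proof -
  let ?st = "\<lambda>s a. s(c := tape_of (binary a))"
  have "polytime_runs I len (make_number d c q) (\<lambda>i. ?st (S i) 0) (\<lambda>i. ?st (S i) (poly q (len i)))"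
    unfolding make_number_def
  proof (rule polytime_runs_poly_loop[where st = ?st and q = "[:9:] * q + [:20:]"])
    show "runs (binary_inc c) (?st s a) (?st s (Suc a)) (poly ([:9:] * q + [:20:]) L)"
      if "a < poly q L" for s a L
      by (rule runs_mono[OF runs_binary_inc]) (use that in simp)
  qed (use c blocks in \<open>auto simp: shift_upd\<close>)
  then show ?thesis
    by (rule polytime_runs_reindex[where f = id]) (use S in \<open>auto simp: binary.simps\<close>)
qed

definition make_offset :: "nat \<Rightarrow> (nat \<Rightarrow> int) \<Rightarrow> nat poly \<Rightarrow> prog" where
  "make_offset d u q = poly_loop d (coeffs q) (Shift u)"

lemma polytime_runs_make_offset:
  assumes u: "dir_vec u" "\<And>i. i \<ge> d \<Longrightarrow> u i = 0"
    and blocks: "\<And>i j. i \<in> I \<Longrightarrow> j < length (coeffs q) \<Longrightarrow> is_block (S i (d + j)) (len i)"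
  shows "polytime_runs I len (make_offset d u q) S (\<lambda>i. shift u (int (poly q (len i))) (S i))"
proof -
  let ?st = "\<lambda>s a. shift u (int a) s"
  have "polytime_runs I len (make_offset d u q) (\<lambda>i. ?st (S i) 0) (\<lambda>i. ?st (S i) (poly q (len i)))"
    unfolding make_offset_def
  proof (rule polytime_runs_poly_loop[where st = ?st and q = 1])
    show "runs (Shift u) (?st s a) (?st s (Suc a)) (poly 1 L)" for s a and L :: nat
      using runs_Shift[OF u(1), of "int a"] by (simp add: add.commute)
    show "?st (shift (axis c) j s) a = shift (axis c) j (?st s a)" for s a c j
      by (rule shift_commute)
    show "?st s a c = s c" if "d \<le> c" for s a c using u(2)[OF that] by (simp add: shift_def)
  qed (use blocks in auto)
  then show ?thesis by simp
qed

definition make_marks :: "nat set \<Rightarrow> prog" where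
  "make_marks A = Seq (write_move A 2 MRight) (Seq (write_move A 3 MLeft)
     (Seq (write_move A 2 MLeft) (write_move A 1 MRight)))"

lemma runs_make_marks:
  assumes "\<And>i. i \<in> A \<Longrightarrow> s i = tape_of []"
  shows "runs (make_marks A) s (\<lambda>i. if i \<in> A then (marks, 0) else s i) 7"
proof -
  let ?write = "\<lambda>a m s i. if i \<in> A then act_tape (a, m) (s i) else s i"
  let ?s = "?write 1 MRight (?write 2 MLeft (?write 3 MLeft (?write 2 MRight s)))"
  have "runs (make_marks A) s ?s (1 + (1 + (1 + 1 + 1) + 1) + 1)"
    unfolding make_marks_def by (intro runs_Seq) (rule runs_write_move)+
  then have "runs (make_marks A) s ?s 7" by (rule runs_mono) simp
  moreover have "?s = (\<lambda>i. if i \<in> A then (marks, 0) else s i)"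
    using assms by (auto simp: fun_eq_iff marks_def word_tape_def)
  ultimately show ?thesis by (simp only:)
qed

definition move_input :: "nat \<Rightarrow> nat set \<Rightarrow> prog" where
  "move_input c A = Seq
     (While (\<lambda>r. r 0 \<noteq> 0)
       (Act (\<lambda>r i. if i = 0 then (0, MRight) else if i \<in> A then (r 0, MRight) else (r i, MStay))))
     (rewind c (\<lambda>i. if i = 0 \<or> i \<in> A then 1 else 0))"

definition input_on :: "nat set \<Rightarrow> bool list \<Rightarrow> state" where
  "input_on A x = (\<lambda>i. if i \<in> A then tape_of x else tape_of [])"

lemma runs_move_input:
  assumes c: "c \<in> A" and A: "0 \<notin> A"
  shows "runs (move_input c A) (init_state x) (input_on A x) (7 * length x + 10)"
proof -
  let ?f = "\<lambda>r i. if i = 0 then (0, MRight) else if i \<in> A then (r 0, MRight) else (r i, MStay)"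
  let ?st = "\<lambda>j i. if i = 0 then (\<lambda>p. if p < int j then 0 else word_tape x p, int j)
     else if i \<in> A then written (take j x) else tape_of []"
  let ?u = "\<lambda>i. if i = 0 \<or> i \<in> A then 1 else (0::int)" and ?n = "length x"
  have copy: "runs (While (\<lambda>r. r 0 \<noteq> 0) (Act ?f)) (?st 0) (?st ?n) (?n * (1 + 2) + 1)"
  proof (rule runs_While_iterate)
    fix j assume j: "j < ?n"
    then have bit: "reads (?st j) 0 = bit_symbol (x ! j)" by (simp add: reads_def word_tape_def)
    then show "reads (?st j) 0 \<noteq> 0" by simp
    have "act_tape (bit_symbol (x ! j), MRight) (written (take j x)) = written (take (Suc j) x)"
      using word_tape_overwrite[of "take j x" "[]" "x ! j"] j
      by (simp add: written_def take_Suc_conv_app_nth)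
    then have "apply_act (?f (reads (?st j))) (?st j) i = ?st (Suc j) i" for i
      using A unfolding bit by (auto simp: apply_act_def fun_eq_iff reads_def)
    then show "runs (Act ?f) (?st j) (?st (Suc j)) 1" using runs_Act[of ?f "?st j"] by presburger
  qed (simp add: reads_def word_tape_def)
  have start: "?st 0 = init_state x"
    by (auto simp: init_state_def written_def fun_eq_iff word_tape_def)
  have finish: "?st ?n = shift ?u (int ?n) (input_on A x)"
    using A by (auto simp: fun_eq_iff shift_def input_on_def written_def word_tape_def)
  have "runs (rewind c ?u) (shift ?u (int ?n) (input_on A x)) (input_on A x) (?n * 3 + 6)"
    by (rule runs_rewind) (use c in \<open>auto simp: dir_vec_def input_on_def\<close>)
  from runs_Seq[OF copy[unfolded start finish] this] show ?thesis
    unfolding move_input_def by (rule runs_mono) simp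
qed

lemma wf_Shift [simp]: "(\<And>i. i \<ge> K \<Longrightarrow> u i = 0) \<Longrightarrow> wf_prog K S (Shift u)"
  by (auto simp: Shift_def wf_act_def move_of_def)

lemma wf_rewind [simp]: "(\<And>i. i \<ge> K \<Longrightarrow> u i = 0) \<Longrightarrow> wf_prog K S (rewind c u)"
  by (auto simp: rewind_def)

lemma wf_For: "(\<And>i. i \<ge> K \<Longrightarrow> u i = 0) \<Longrightarrow> wf_prog K S p \<Longrightarrow> wf_prog K S (For c u p)"
  by (auto simp: For_def)

lemma wf_seqs [simp]: "wf_prog K S (seqs ps) \<longleftrightarrow> (\<forall>p\<in>set ps. wf_prog K S p)"
  by (induction ps) (auto simp: seqs_def)

lemma wf_write_move [simp]: "A \<subseteq> {..<K} \<Longrightarrow> a < S \<Longrightarrow> wf_prog K S (write_move A a m)"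
  by (auto simp: write_move_def wf_act_def)

lemma wf_poly_loop: "wf_prog K S p \<Longrightarrow> d + length as \<le> K \<Longrightarrow> wf_prog K S (poly_loop d as p)"
  by (induction as arbitrary: d) (auto intro!: wf_For simp: axis_def)

lemma wf_emit_bit [simp]: "K \<ge> 1 \<Longrightarrow> S \<ge> 3 \<Longrightarrow> wf_prog K S (emit_bit b)"
  by (auto simp: emit_bit_def)

lemma wf_emit_word [simp]: "K \<ge> 1 \<Longrightarrow> S \<ge> 3 \<Longrightarrow> wf_prog K S (emit_word w)"
  by (auto simp: emit_word_def)

lemma wf_emit_number [simp]: "c < K \<Longrightarrow> S \<ge> 3 \<Longrightarrow> wf_prog K S (emit_number c)"
  by (auto simp: emit_number_def emit_copy_def axis_def intro!: wf_For)

lemma wf_binary_inc [simp]: "c < K \<Longrightarrow> S \<ge> 3 \<Longrightarrow> wf_prog K S (binary_inc c)"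
  by (auto simp: binary_inc_def clear_ones_def axis_def)

lemma wf_make_block:
  "c < K \<Longrightarrow> S \<ge> 3 \<Longrightarrow> d + length (coeffs q) \<le> K \<Longrightarrow> wf_prog K S (make_block d c q)"
  by (auto simp: make_block_def axis_def intro!: wf_poly_loop)

lemma wf_make_number:
  "c < K \<Longrightarrow> S \<ge> 3 \<Longrightarrow> d + length (coeffs q) \<le> K \<Longrightarrow> wf_prog K S (make_number d c q)"
  by (auto simp: make_number_def intro!: wf_poly_loop)

lemma wf_make_offset:
  "(\<And>i. i \<ge> K \<Longrightarrow> u i = 0) \<Longrightarrow> d + length (coeffs q) \<le> K \<Longrightarrow> wf_prog K S (make_offset d u q)"
  by (auto simp: make_offset_def intro!: wf_poly_loop)

lemma wf_make_marks: "A \<subseteq> {..<K} \<Longrightarrow> S \<ge> 4 \<Longrightarrow> wf_prog K S (make_marks A)"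
  by (simp add: make_marks_def)

lemma wf_move_input: "c < K \<Longrightarrow> A \<subseteq> {..<K} \<Longrightarrow> S \<ge> 3 \<Longrightarrow> wf_prog K S (move_input c A)"
  by (auto simp: move_input_def wf_act_def intro!: wf_rewind)

section \<open>The reduction as a program\<close>

lemma concat_map_product:
  "concat (map f (List.product xs ys)) = concat (map (\<lambda>x. concat (map (\<lambda>y. f (x, y)) ys)) xs)"
  by (induction xs) (simp_all add: comp_def)

definition dirs :: "nat set \<Rightarrow> nat set \<Rightarrow> nat \<Rightarrow> int" where
  "dirs A B = (\<lambda>i. if i \<in> A then 1 else if i \<in> B then -1 else 0)"

lemma dir_vec_dirs [simp]: "dir_vec (dirs A B)"
  by (auto simp: dir_vec_def dirs_def)

definition double_loop :: "nat \<Rightarrow> (nat \<Rightarrow> int) \<Rightarrow> nat \<Rightarrow> (nat \<Rightarrow> int) \<Rightarrow> prog \<Rightarrow> prog" where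
  "double_loop c u c' u' body = For c u (For c' u' body)"

lemma emits_double_loop:
  assumes u: "dir_vec u" "u c = 1" "u 0 = 0" "u c' = 0" and u': "dir_vec u'" "u' c' = 1" "u' 0 = 0"
    and blocks: "\<And>i. i \<in> I \<Longrightarrow> is_block (S i c) (N i)" "\<And>i. i \<in> I \<Longrightarrow> is_block (S i c') (N' i)"
    and N: "\<And>i. i \<in> I \<Longrightarrow> N i \<le> poly qN (len i)" "\<And>i. i \<in> I \<Longrightarrow> N' i \<le> poly qN' (len i)"
    and body: "emits {(i, j, j'). i \<in> I \<and> j < N i \<and> j' < N' i} (\<lambda>(i, j, j'). len i) body
      (\<lambda>(i, j, j'). shift u' (int j') (shift u (int j) (S i))) (\<lambda>(i, j, j'). w i j j')"
  shows "emits I len (double_loop c u c' u' body) S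
    (\<lambda>i. concat (map (\<lambda>j. concat (map (w i j) [0..<N' i])) [0..<N i]))"
proof -
  let ?I = "{(i, j). i \<in> I \<and> j < N i}"
  have "emits {(ij, j'). ij \<in> ?I \<and> j' < N' (fst ij)} (\<lambda>(ij, j'). case ij of (i, j) \<Rightarrow> len i) body
      (\<lambda>(ij, j'). shift u' (int j') (case ij of (i, j) \<Rightarrow> shift u (int j) (S i)))
      (\<lambda>(ij, j'). w (fst ij) (snd ij) j')"
    using body by (rule emits_reindex[where f = "\<lambda>((i, j), j'). (i, j, j')"]) auto
  then have "emits ?I (\<lambda>(i, j). len i) (For c' u' body) (\<lambda>(i, j). shift u (int j) (S i))
      (\<lambda>ij. concat (map (\<lambda>j'. case (ij, j') of (ij, j') \<Rightarrow> w (fst ij) (snd ij) j')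
        [0..<N' (fst ij)]))"
    by (intro emits_For[where qN = qN']) (use u u' blocks N in \<open>auto simp: shift_def\<close>)
  from emits_For[where qN = qN, OF u(1-3) blocks(1) N(1) this] show ?thesis
    unfolding double_loop_def by simp
qed

fun emit_upto :: "(readings \<Rightarrow> nat) \<Rightarrow> nat \<Rightarrow> prog" where
  "emit_upto f 0 = emit_word (encode_nat 0)"
| "emit_upto f (Suc n) = Cond (\<lambda>r. f r = Suc n) (emit_word (encode_nat (Suc n))) (emit_upto f n)"

lemma emits_upto:
  assumes "\<And>r v. f (r(0 := v)) = f r" "\<And>i. i \<in> I \<Longrightarrow> f (reads (S i)) \<le> n"
  shows "emits I len (emit_upto f n) S (\<lambda>i. encode_nat (f (reads (S i))))"
  using assms(2)
proof (induction n arbitrary: I)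
  case 0
  then show ?case by (auto intro: emits_cong[OF emits_word])
next
  case (Suc n)
  show ?case
    unfolding emit_upto.simps
  proof (rule emits_Cond)
    show "emits {i \<in> I. f (reads (S i)) = Suc n} len (emit_word (encode_nat (Suc n))) S
        (\<lambda>i. encode_nat (f (reads (S i))))"
      by (rule emits_cong[OF emits_word]) simp_all
    show "emits {i \<in> I. f (reads (S i)) \<noteq> Suc n} len (emit_upto f n) S
        (\<lambda>i. encode_nat (f (reads (S i))))"
      by (rule Suc.IH) (use Suc.prems in \<open>force simp: le_Suc_eq\<close>)
  qed (simp add: assms(1))
qed

lemma wf_emit_upto: "K \<ge> 1 \<Longrightarrow> S \<ge> 3 \<Longrightarrow> wf_prog K S (emit_upto f n)"
  by (induction n) auto

text \<open>A position in the adjacency matrix is given by two vertices \<^term>\<open>(\<tau>, z, \<kappa>)\<close> and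
  \<^term>\<open>(\<tau>', z', \<kappa>')\<close>; primed tapes belong to the second one. Besides the loop counters there are
  the tapes with marks, whose heads keep the positions \<^term>\<open>\<tau>' - \<tau>\<close>, \<^term>\<open>z' - z\<close> and those
  recorded in an observation.\<close>

abbreviation (input) "time_counter \<equiv> 1 :: nat"
abbreviation (input) "column_counter \<equiv> 2 :: nat"
abbreviation (input) "time_counter' \<equiv> 3 :: nat"
abbreviation (input) "column_counter' \<equiv> 4 :: nat"
abbreviation (input) "time_difference \<equiv> 5 :: nat"
abbreviation (input) "column_difference \<equiv> 6 :: nat"
abbreviation (input) "time_tape \<equiv> 7 :: nat"
abbreviation (input) "end_tape \<equiv> 8 :: nat"
abbreviation (input) "left_tape \<equiv> 9 :: nat"
abbreviation (input) "centre_tape \<equiv> 10 :: nat"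
abbreviation (input) "right_tape \<equiv> 11 :: nat"
abbreviation (input) "time_tape' \<equiv> 12 :: nat"
abbreviation (input) "end_tape' \<equiv> 13 :: nat"
abbreviation (input) "left_tape' \<equiv> 14 :: nat"
abbreviation (input) "centre_tape' \<equiv> 15 :: nat"
abbreviation (input) "right_tape' \<equiv> 16 :: nat"
abbreviation (input) "input_tape \<equiv> 17 :: nat"
abbreviation (input) "input_tape' \<equiv> 18 :: nat"
abbreviation (input) "vertices_tape \<equiv> 19 :: nat"
abbreviation (input) "groups_tape \<equiv> 20 :: nat"
abbreviation (input) "first_copy \<equiv> 21 :: nat"

definition mark_tapes :: "nat set" where
  "mark_tapes = {time_difference, column_difference, time_tape, end_tape, left_tape, centre_tape,
     right_tape, time_tape', end_tape', left_tape', centre_tape', right_tape'}"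

definition time_dirs :: "nat \<Rightarrow> int" where
  "time_dirs = dirs {time_counter, time_tape, end_tape} {time_difference}"

definition column_dirs :: "nat \<Rightarrow> int" where
  "column_dirs = dirs {column_counter, left_tape, centre_tape, right_tape, input_tape}
      {column_difference}"

definition time_dirs' :: "nat \<Rightarrow> int" where
  "time_dirs' = dirs {time_counter', time_difference, time_tape', end_tape'} {}"

definition column_dirs' :: "nat \<Rightarrow> int" where
  "column_dirs' =
     dirs {column_counter', column_difference, left_tape', centre_tape', right_tape',
       input_tape'} {}"

definition offset_dirs :: "nat \<Rightarrow> int" where
  "offset_dirs = dirs {} {end_tape, centre_tape, right_tape, end_tape', centre_tape', right_tape',
     input_tape, input_tape'}"

definition right_offset_dirs :: "nat \<Rightarrow> int" where
  "right_offset_dirs = dirs {} {right_tape, right_tape'}"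

lemmas dirs_defs = time_dirs_def column_dirs_def time_dirs'_def column_dirs'_def offset_dirs_def
  right_offset_dirs_def

lemma dir_vec_loops [simp]:
  "dir_vec time_dirs" "dir_vec column_dirs" "dir_vec time_dirs'" "dir_vec column_dirs'"
  "dir_vec offset_dirs" "dir_vec right_offset_dirs"
  by (simp_all add: dirs_defs)

lemma dirs_copies [simp]:
  assumes "i \<ge> first_copy"
  shows "time_dirs i = 0" "column_dirs i = 0" "time_dirs' i = 0" "column_dirs' i = 0"
    "offset_dirs i = 0" "right_offset_dirs i = 0"
  using assms by (auto simp: dirs_defs dirs_def)

lemma dirs_counters [simp]:
  "time_dirs (Suc 0) = 1" "time_dirs 0 = 0" "time_dirs column_counter = 0"
  "column_dirs column_counter = 1" "column_dirs 0 = 0"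
  "time_dirs' time_counter' = 1" "time_dirs' 0 = 0" "time_dirs' column_counter' = 0"
  "column_dirs' column_counter' = 1" "column_dirs' 0 = 0"
  by (simp_all add: dirs_defs dirs_def)

definition row_view :: "readings \<Rightarrow> observation" where
  "row_view r = \<lparr>time_mark = r time_tape, end_mark = r end_tape, left_mark = r left_tape,
     centre_mark = r centre_tape, right_mark = r right_tape, input_symbol = r input_tape\<rparr>"

definition column_view :: "readings \<Rightarrow> observation" where
  "column_view r = \<lparr>time_mark = r time_tape', end_mark = r end_tape', left_mark = r left_tape',
     centre_mark = r centre_tape', right_mark = r right_tape', input_symbol = r input_tape'\<rparr>"

definition flip :: "nat \<Rightarrow> nat" where
  "flip m = (if m = 1 then 3 else if m = 3 then 1 else m)"

lemma flip_marks: "flip (marks j) = marks (- j)"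
  by (auto simp: flip_def marks_def)

locale reduction = tableau M for M :: tm +
  fixes time_poly :: "nat poly"
begin

definition T :: "bool list \<Rightarrow> nat" where
  "T x = poly time_poly (length x)"

definition rows_poly :: "nat poly" where
  "rows_poly = time_poly + 1"

definition columns_poly :: "nat poly" where
  "columns_poly = [:2:] * time_poly + 1"

definition vertices_poly :: "nat poly" where
  "vertices_poly = rows_poly * (columns_poly * [:length kinds:])"

definition groups_poly :: "nat poly" where
  "groups_poly = rows_poly * (columns_poly * [:Suc K:])"

lemma poly_values:
  "poly rows_poly (length x) = Suc (T x)" "poly columns_poly (length x) = 2 * T x + 1"
  "poly vertices_poly (length x) = length (vertices (T x))"
  "poly groups_poly (length x) = groups_number (T x)"
  by (simp_all add: rows_poly_def columns_poly_def vertices_poly_def groups_poly_def T_def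
    vertices_def
      groups_number_def del: mult_Suc mult_Suc_right upt_Suc)

definition copies_number :: nat where
  "copies_number = length (coeffs time_poly) + length (coeffs rows_poly) +
      length (coeffs columns_poly) +
     length (coeffs vertices_poly) + length (coeffs groups_poly)"

lemma length_coeffs_le_copies_number:
  "length (coeffs time_poly) \<le> copies_number" "length (coeffs rows_poly) \<le> copies_number"
  "length (coeffs columns_poly) \<le> copies_number" "length (coeffs vertices_poly) \<le> copies_number"
  "length (coeffs groups_poly) \<le> copies_number"
  by (auto simp: copies_number_def)

definition copies :: "nat set" where
  "copies = {input_tape, input_tape'} \<union> {first_copy..<first_copy + copies_number}"

definition load_input :: prog where
  "load_input = Seq (move_input input_tape copies) (make_marks mark_tapes)"

definition loaded :: "bool list \<Rightarrow> state" where
  "loaded x = (\<lambda>i. if i \<in> mark_tapes then (marks, 0) else input_on copies x i)"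

lemma polytime_runs_load_input: "polytime_runs UNIV length load_input init_state loaded"
  unfolding load_input_def
proof (rule polytime_runs_Seq)
  show "polytime_runs UNIV length (move_input input_tape copies) init_state (input_on copies)"
    by (rule polytime_runsI[where q = "[:10, 7:]"])
      (use runs_move_input[of input_tape copies] in \<open>simp add: copies_def mult.commute add.commute\<close>)
  have "runs (make_marks mark_tapes) (input_on copies x) (loaded x) 7" for x
    unfolding loaded_def
    by (rule runs_make_marks) (auto simp: input_on_def copies_def mark_tapes_def)
  then show "polytime_runs UNIV length (make_marks mark_tapes) (input_on copies) loaded"
    by (rule polytime_runs_const)
qed

definition init_counters :: prog where
  "init_counters =
     Seq (make_block first_copy time_counter rows_poly)
     (Seq (make_block first_copy column_counter columns_poly)
     (Seq (make_block first_copy time_counter' rows_poly)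
     (Seq (make_block first_copy column_counter' columns_poly)
     (Seq (make_number first_copy vertices_tape vertices_poly)
     (make_number first_copy groups_tape groups_poly)))))"

definition counted :: "bool list \<Rightarrow> state" where
  "counted x = (loaded x)
     (time_counter := tape_of (replicate (Suc (T x)) False),
      column_counter := tape_of (replicate (2 * T x + 1) False),
      time_counter' := tape_of (replicate (Suc (T x)) False),
      column_counter' := tape_of (replicate (2 * T x + 1) False),
      vertices_tape := tape_of (binary (length (vertices (T x)))),
      groups_tape := tape_of (binary (groups_number (T x))))"

lemma loaded_copy: "j < copies_number \<Longrightarrow> loaded x (first_copy + j) = tape_of x"
  by (auto simp: loaded_def mark_tapes_def input_on_def copies_def)

lemma loaded_blank: "i \<in> {0, time_counter, column_counter, time_counter', column_counter',
    vertices_tape, groups_tape} \<Longrightarrow>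
    loaded x i = tape_of []"
  by (auto simp: loaded_def mark_tapes_def input_on_def copies_def)

lemma polytime_runs_init_counters: "polytime_runs UNIV length init_counters loaded counted"
  unfolding init_counters_def counted_def poly_values[symmetric]
  by (rule polytime_runs_Seq polytime_runs_make_block polytime_runs_make_number
      | use length_coeffs_le_copies_number in \<open>force simp: loaded_copy loaded_blank\<close>)+

definition prepare :: prog where
  "prepare = Seq load_input (Seq init_counters
     (Seq (make_offset first_copy offset_dirs time_poly)
       (make_offset first_copy right_offset_dirs time_poly)))"

definition ready :: "bool list \<Rightarrow> state" where
  "ready x = shift right_offset_dirs (int (T x)) (shift offset_dirs (int (T x)) (counted x))"

lemma polytime_runs_prepare: "polytime_runs UNIV length prepare init_state ready"
  unfolding prepare_def ready_def T_def
  by (rule polytime_runs_Seq polytime_runs_load_input polytime_runs_init_counters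
    polytime_runs_make_offset
      | use length_coeffs_le_copies_number in \<open>force simp: counted_def loaded_copy shift_def\<close>)+

definition at_vertex :: "bool list \<Rightarrow> nat \<Rightarrow> nat \<Rightarrow> state" where
  "at_vertex x \<tau> z = shift column_dirs (int z) (shift time_dirs (int \<tau>) (ready x))"

definition at_entry :: "bool list \<Rightarrow> nat \<Rightarrow> nat \<Rightarrow> nat \<Rightarrow> nat \<Rightarrow> state" where
  "at_entry x \<tau> z \<tau>' z' = shift column_dirs' (int z') (shift time_dirs' (int \<tau>') (at_vertex x \<tau> z))"

lemmas state_defs = at_entry_def at_vertex_def ready_def counted_def loaded_def mark_tapes_def
  shift_def dirs_defs dirs_def

lemma reads_at_entry:
  "row_view (reads (at_entry x \<tau> z \<tau>' z')) = observe x (T x) \<tau> z"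
  "column_view (reads (at_entry x \<tau> z \<tau>' z')) = observe x (T x) \<tau>' z'"
  "reads (at_entry x \<tau> z \<tau>' z') time_difference = marks (int \<tau>' - int \<tau>)"
  "reads (at_entry x \<tau> z \<tau>' z') column_difference = marks (int z' - int z)"
  "reads (at_entry x \<tau> z \<tau>' z') centre_tape = marks (int z - int (T x))"
  "reads (at_entry x \<tau> z \<tau>' z') centre_tape' = marks (int z' - int (T x))"
  by (simp_all add: row_view_def column_view_def observe_def reads_def state_defs input_on_def
    copies_def)

lemma row_view_at_vertex: "row_view (reads (at_vertex x \<tau> z)) = observe x (T x) \<tau> z"
  using reads_at_entry(1)[of x \<tau> z 0 0] by (simp add: at_entry_def)

lemma is_block_counters:
  "is_block (ready x time_counter) (Suc (T x))" "is_block (ready x column_counter) (2 * T x + 1)"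
  "is_block (at_vertex x \<tau> z time_counter') (Suc (T x))"
  "is_block (at_vertex x \<tau> z column_counter') (2 * T x + 1)"
  using is_block_tape_of[of "replicate (Suc (T x)) False"]
    is_block_tape_of[of "replicate (2 * T x + 1) False"]
  by (simp_all add: state_defs del: replicate_Suc)

lemma concat_map_vertices: "concat (map f (vertices t)) = concat (map (\<lambda>\<tau>. concat (map (\<lambda>z.
    concat (map (\<lambda>\<kappa>. f (\<tau>, z, \<kappa>)) kinds)) [0..<2 * t + 1])) [0..<Suc t])"
  by (simp only: vertices_def concat_map_product)

lemma emits_vertices_loop:
  assumes u: "dir_vec u" "u c = 1" "u 0 = 0" "u c' = 0" and u': "dir_vec u'" "u' c' = 1" "u' 0 = 0"
    and blocks: "\<And>i. i \<in> I \<Longrightarrow> is_block (st i c) (Suc (T (inp i)))"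
      "\<And>i. i \<in> I \<Longrightarrow> is_block (st i c') (2 * T (inp i) + 1)"
    and body: "\<And>\<kappa>. \<kappa> \<in> set kinds \<Longrightarrow>
      emits {(i, \<tau>, z). i \<in> I \<and> \<tau> < Suc (T (inp i)) \<and> z < 2 * T (inp i) + 1}
        (\<lambda>(i, \<tau>, z). length (inp i)) (P \<kappa>)
        (\<lambda>(i, \<tau>, z). shift u' (int z) (shift u (int \<tau>) (st i))) (\<lambda>(i, \<tau>, z). w i (\<tau>, z, \<kappa>))"
  shows "emits I (length \<circ> inp) (double_loop c u c' u' (seqs (map P kinds))) st
    (\<lambda>i. concat (map (w i) (vertices (T (inp i)))))"
  unfolding concat_map_vertices
proof (rule emits_double_loop[where qN = rows_poly and qN' = columns_poly, OF u u' blocks])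
  have "emits {(i, \<tau>, z). i \<in> I \<and> \<tau> < Suc (T (inp i)) \<and> z < 2 * T (inp i) + 1}
      (\<lambda>(i, \<tau>, z). length (inp i))
      (seqs (map P kinds)) (\<lambda>(i, \<tau>, z). shift u' (int z) (shift u (int \<tau>) (st i)))
      (\<lambda>j. concat (map (\<lambda>\<kappa>. case j of (i, \<tau>, z) \<Rightarrow> w i (\<tau>, z, \<kappa>)) kinds))"
    using body by (rule emits_seqs)
  then show "emits {(i, \<tau>, z). i \<in> I \<and> \<tau> < Suc (T (inp i)) \<and> z < 2 * T (inp i) + 1}
      (\<lambda>(i, \<tau>, z). (length \<circ> inp) i) (seqs (map P kinds))
      (\<lambda>(i, \<tau>, z). shift u' (int z) (shift u (int \<tau>) (st i)))
      (\<lambda>(i, \<tau>, z). concat (map (\<lambda>\<kappa>. w i (\<tau>, z, \<kappa>)) kinds))"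
    by (rule emits_reindex[where f = id]) auto
qed (simp_all add: poly_values)

definition vertex_loop :: "(kind \<Rightarrow> prog) \<Rightarrow> prog" where
  "vertex_loop P = double_loop time_counter time_dirs column_counter column_dirs
      (seqs (map P kinds))"

lemma emits_vertex_loop:
  assumes "\<And>\<kappa>. \<kappa> \<in> set kinds \<Longrightarrow> emits UNIV (\<lambda>(x, \<tau>, z). length x) (P \<kappa>)
    (\<lambda>(x, \<tau>, z). at_vertex x \<tau> z) (\<lambda>(x, \<tau>, z). w x (\<tau>, z, \<kappa>))"
  shows "emits UNIV length (vertex_loop P) ready (\<lambda>x. concat (map (w x) (vertices (T x))))"
proof -
  have "emits {(x, \<tau>, z). x \<in> UNIV \<and> \<tau> < Suc (T (id x)) \<and> z < 2 * T (id x) + 1}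
      (\<lambda>(x, \<tau>, z). length (id x)) (P \<kappa>)
      (\<lambda>(x, \<tau>, z). shift column_dirs (int z) (shift time_dirs (int \<tau>) (ready x)))
        (\<lambda>(x, \<tau>, z). w x (\<tau>, z, \<kappa>))"
    if "\<kappa> \<in> set kinds" for \<kappa>
    using assms[OF that] by (rule emits_reindex[where f = id]) (auto simp: at_vertex_def)
  then have "emits UNIV (length \<circ> id) (vertex_loop P) ready
      (\<lambda>x. concat (map (w x) (vertices (T (id x)))))"
    unfolding vertex_loop_def by (intro emits_vertices_loop) (use is_block_counters in auto)
  then show ?thesis by simp
qed

definition entry_loop :: "(kind \<Rightarrow> prog) \<Rightarrow> prog" where
  "entry_loop P = double_loop time_counter' time_dirs' column_counter' column_dirs'
      (seqs (map P kinds))"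

lemma emits_entry_loop:
  assumes "\<And>\<kappa>'. \<kappa>' \<in> set kinds \<Longrightarrow> emits UNIV (\<lambda>((x, \<tau>, z), \<tau>', z'). length x) (P \<kappa>')
    (\<lambda>((x, \<tau>, z), \<tau>', z'). at_entry x \<tau> z \<tau>' z') (\<lambda>((x, \<tau>, z), \<tau>', z'). w x \<tau> z (\<tau>', z', \<kappa>'))"
  shows "emits UNIV (\<lambda>(x, \<tau>, z). length x) (entry_loop P) (\<lambda>(x, \<tau>, z). at_vertex x \<tau> z)
    (\<lambda>(x, \<tau>, z). concat (map (w x \<tau> z) (vertices (T x))))"
proof -
  let ?S = "\<lambda>(x, \<tau>, z). at_vertex x \<tau> z" and ?w = "\<lambda>(x, \<tau>, z). w x \<tau> z"
  have "emits {(i, \<tau>', z'). i \<in> UNIV \<and> \<tau>' < Suc (T (fst i)) \<and> z' < 2 * T (fst i) + 1}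
      (\<lambda>(i, \<tau>', z'). length (fst i)) (P \<kappa>')
      (\<lambda>(i, \<tau>', z'). shift column_dirs' (int z') (shift time_dirs' (int \<tau>') (?S i)))
      (\<lambda>(i, \<tau>', z'). ?w i (\<tau>', z', \<kappa>'))" if "\<kappa>' \<in> set kinds" for \<kappa>'
    using assms[OF that] by (rule emits_reindex[where f = id]) (auto simp: at_entry_def)
  then have "emits UNIV (length \<circ> fst) (entry_loop P) ?S
      (\<lambda>i. concat (map (?w i) (vertices (T (fst i)))))"
    unfolding entry_loop_def by (intro emits_vertices_loop) (use is_block_counters in auto)
  then show ?thesis by (rule emits_reindex[where f = id]) auto
qed

definition adjacent :: "goal \<Rightarrow> kind \<Rightarrow> kind \<Rightarrow> readings \<Rightarrow> bool" where
  "adjacent gl \<kappa> \<kappa>' r \<longleftrightarrow>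
     \<not> (\<kappa> = \<kappa>' \<and> r time_difference = 2 \<and> r column_difference = 2) \<and>
     (\<kappa> = Universal \<or> \<kappa>' = Universal \<or> is_alternative \<kappa> \<and> is_alternative \<kappa>' \<or>
      \<not> is_alternative \<kappa> \<and> is_alternative \<kappa>' \<and>
        incident gl (row_view r) (r time_difference) (r column_difference) (r centre_tape') \<kappa> \<kappa>' \<or>
      is_alternative \<kappa> \<and> \<not> is_alternative \<kappa>' \<and>
        incident gl (column_view r) (flip (r time_difference)) (flip (r column_difference))
          (r centre_tape) \<kappa>' \<kappa>)"

lemma adjacent_at_entry:
  "adjacent gl \<kappa> \<kappa>' (reads (at_entry x \<tau> z \<tau>' z')) \<longleftrightarrow>
     split_adj is_universal is_weighted (inc gl x (T x)) (\<tau>, z, \<kappa>) (\<tau>', z', \<kappa>')"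
  unfolding adjacent_def split_adj_def reads_at_entry flip_marks is_weighted_def is_universal_def
    inc.simps
  by auto

definition emit_matrix :: "goal \<Rightarrow> prog" where
  "emit_matrix gl =
     vertex_loop (\<lambda>\<kappa>. entry_loop (\<lambda>\<kappa>'. emit_upto (\<lambda>r. of_bool (adjacent gl \<kappa> \<kappa>' r)) 1))"

lemma emits_matrix:
  "emits UNIV length (emit_matrix gl) ready
     (\<lambda>x. concat (map (\<lambda>v. concat (map (\<lambda>w.
        encode_nat (of_bool (split_adj is_universal is_weighted (inc gl x (T x)) v w)))
        (vertices (T x)))) (vertices (T x))))"
  unfolding emit_matrix_def
proof (intro emits_vertex_loop emits_entry_loop)
  fix \<kappa> \<kappa>'
  let ?S = "\<lambda>((x, \<tau>, z), \<tau>', z'). at_entry x \<tau> z \<tau>' z'"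
  have "emits UNIV (\<lambda>((x, \<tau>, z), \<tau>', z'). length x) (emit_upto (\<lambda>r. of_bool (adjacent gl \<kappa> \<kappa>' r)) 1)
      ?S (\<lambda>i. encode_nat (of_bool (adjacent gl \<kappa> \<kappa>' (reads (?S i)))))"
    by (rule emits_upto) (simp_all add: adjacent_def row_view_def column_view_def)
  then show "emits UNIV (\<lambda>((x, \<tau>, z), \<tau>', z'). length x)
      (emit_upto (\<lambda>r. of_bool (adjacent gl \<kappa> \<kappa>' r)) 1)
      ?S (\<lambda>((x, \<tau>, z), \<tau>', z').
        encode_nat (of_bool (split_adj is_universal is_weighted (inc gl x (T x)) (\<tau>, z, \<kappa>)
          (\<tau>', z', \<kappa>'))))"
    by (rule emits_cong) (auto simp: adjacent_at_entry)
qed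

definition emit_demand :: "goal \<Rightarrow> kind \<Rightarrow> prog" where
  "emit_demand gl \<kappa> = Cond (\<lambda>r. bound gl (row_view r) \<kappa> = None) (emit_number groups_tape)
     (emit_upto (\<lambda>r. the (bound gl (row_view r) \<kappa>)) 2)"

lemma bound_le_2: "bound gl ob \<kappa> = Some m \<Longrightarrow> m \<le> 2"
proof (cases \<kappa>)
  case (Clause c)
  then show "bound gl ob \<kappa> = Some m \<Longrightarrow> m \<le> 2" by (cases c; cases gl) auto
qed auto

lemma emits_demands:
  "emits UNIV length (vertex_loop (emit_demand gl)) ready
     (\<lambda>x. concat (map (\<lambda>v. encode_nat (demand gl x (T x) v)) (vertices (T x))))"
proof (rule emits_vertex_loop)
  fix \<kappa>
  let ?S = "\<lambda>(x, \<tau>, z). at_vertex x \<tau> z"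
  let ?bound = "\<lambda>i. bound gl (row_view (reads (?S i))) \<kappa>"
  let ?w = "\<lambda>(x, \<tau>, z). encode_nat (demand gl x (T x) (\<tau>, z, \<kappa>))"
  show "emits UNIV (\<lambda>(x, \<tau>, z). length x) (emit_demand gl \<kappa>) ?S ?w"
    unfolding emit_demand_def
  proof (rule emits_Cond)
    have "emits {i \<in> UNIV. ?bound i = None} (\<lambda>(x, \<tau>, z). length x) (emit_number groups_tape) ?S
        (\<lambda>i. encode_nat (groups_number (T (fst i))))"
      by (rule emits_number[where qv = groups_poly]) (auto simp: state_defs poly_values)
    then show "emits {i \<in> UNIV. ?bound i = None} (\<lambda>(x, \<tau>, z). length x)
        (emit_number groups_tape) ?S ?w"
      by (rule emits_cong) (auto simp: row_view_at_vertex)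
    have "emits {i \<in> UNIV. ?bound i \<noteq> None} (\<lambda>(x, \<tau>, z). length x)
        (emit_upto (\<lambda>r. the (bound gl (row_view r) \<kappa>)) 2) ?S (\<lambda>i. encode_nat (the (?bound i)))"
      by (rule emits_upto) (auto simp: row_view_def dest: bound_le_2)
    then show "emits {i \<in> UNIV. ?bound i \<noteq> None} (\<lambda>(x, \<tau>, z). length x)
        (emit_upto (\<lambda>r. the (bound gl (row_view r) \<kappa>)) 2) ?S ?w"
      by (rule emits_cong) (auto simp: row_view_at_vertex)
  qed (simp add: row_view_def)
qed

definition emit_weighted :: "kind \<Rightarrow> prog" where
  "emit_weighted \<kappa> = emit_word (encode_nat (of_bool (is_alternative \<kappa>)))"

lemma emits_weighted:
  "emits UNIV length (vertex_loop emit_weighted) ready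
     (\<lambda>x. concat (map (\<lambda>v. encode_nat (of_bool (is_weighted v))) (vertices (T x))))"
  by (rule emits_vertex_loop, unfold emit_weighted_def, rule emits_cong[OF emits_word])
    (auto simp: is_weighted_def)

definition emit_instance :: "goal \<Rightarrow> nat list \<Rightarrow> prog" where
  "emit_instance gl params = Seq (emit_number vertices_tape) (Seq (emit_matrix gl)
     (Seq (emit_word (encode_nats params)) (Seq (vertex_loop (emit_demand gl))
     (Seq (vertex_loop emit_weighted) (emit_number groups_tape)))))"

definition instance_string :: "goal \<Rightarrow> nat list \<Rightarrow> bool list \<Rightarrow> bool list" where
  "instance_string gl params x = encode_nats (graph_code (hard_graph gl x (T x)) @ params @
     map (demand gl x (T x)) (vertices (T x)) @ map (\<lambda>v. of_bool (is_weighted v)) (vertices (T x)) @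
     [groups_number (T x)])"

lemma emits_instance: "emits UNIV length (emit_instance gl params) ready
    (instance_string gl params)"
proof -
  have order: "emits UNIV length (emit_number vertices_tape) ready
      (\<lambda>x. encode_nat (length (vertices (T x))))"
    by (rule emits_number[where qv = vertices_poly]) (auto simp: state_defs poly_values)
  have groups: "emits UNIV length (emit_number groups_tape) ready
      (\<lambda>x. encode_nat (groups_number (T x)))"
    by (rule emits_number[where qv = groups_poly]) (auto simp: state_defs poly_values)
  have "encode_nats (concat (map f vs)) = concat (map (\<lambda>v. encode_nats (f v)) vs)"
    for f and vs :: "vertex list"
    by (induction vs) (auto simp: encode_nats_def)
  then have "instance_string gl params = (\<lambda>x. encode_nat (length (vertices (T x))) @
      concat (map (\<lambda>v. concat (map (\<lambda>w.
        encode_nat (of_bool (split_adj is_universal is_weighted (inc gl x (T x)) v w)))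
        (vertices (T x)))) (vertices (T x))) @
      encode_nats params @ concat (map (\<lambda>v. encode_nat (demand gl x (T x) v)) (vertices (T x))) @
      concat (map (\<lambda>v. encode_nat (of_bool (is_weighted v))) (vertices (T x))) @
      encode_nat (groups_number (T x)))"
    by (auto simp: instance_string_def hard_graph_def graph_code_list_graph[OF symp_split_adj]
        encode_nats_def comp_def)
  then show ?thesis
    unfolding emit_instance_def
    using emits_Seq[OF order emits_Seq[OF emits_matrix emits_Seq[OF emits_word
      emits_Seq[OF emits_demands
          emits_Seq[OF emits_weighted groups]]]]]
    by (simp only:)
qed

lemma wf_double_loop:
  "wf_prog (first_copy + copies_number) 4 (vertex_loop P) \<longleftrightarrow>
     (\<forall>\<kappa>\<in>set kinds. wf_prog (first_copy + copies_number) 4 (P \<kappa>))"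
  "wf_prog (first_copy + copies_number) 4 (entry_loop P) \<longleftrightarrow>
     (\<forall>\<kappa>\<in>set kinds. wf_prog (first_copy + copies_number) 4 (P \<kappa>))"
  by (auto simp: vertex_loop_def entry_loop_def double_loop_def For_def)

lemma wf_reduction: "wf_prog (first_copy + copies_number) 4 (Seq prepare (emit_instance gl params))"
proof -
  have "copies \<subseteq> {..<first_copy + copies_number}" "mark_tapes \<subseteq> {..<first_copy + copies_number}"
    by (auto simp: copies_def mark_tapes_def)
  then have "wf_prog (first_copy + copies_number) 4 prepare"
    using length_coeffs_le_copies_number
    by (simp add: prepare_def load_input_def init_counters_def wf_move_input wf_make_marks
      wf_make_block wf_make_number
        wf_make_offset)
  moreover have "wf_prog (first_copy + copies_number) 4 (emit_instance gl params)"
    by (simp add: emit_instance_def emit_matrix_def emit_demand_def emit_weighted_def wf_double_loop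
        wf_emit_upto)
  ultimately show ?thesis by simp
qed

theorem polytime_computable_instance_string: "polytime_computable (instance_string gl params)"
proof -
  let ?r = "instance_string gl params"
  obtain q where q: "\<And>x. runs prepare (init_state x) (ready x) (poly q (length x))"
    using polytime_runs_prepare by (auto simp: polytime_runs_def)
  obtain q' where q': "\<And>x y. runs (emit_instance gl params) ((ready x)(0 := written y))
      ((ready x)(0 := written (y @ ?r x))) (poly q' (length x))"
    using emitsE[OF emits_instance] by (metis UNIV_I)
  show ?thesis
  proof (rule polytime_computable_if_runs[OF wf_reduction, where q = "q + q' + 1"])
    fix x
    have "ready x 0 = written []"
      by (simp add: ready_def counted_def shift_def dirs_defs dirs_def loaded_blank written_def)
    then have "(ready x)(0 := written []) = ready x" by (metis fun_upd_triv)
    then have "runs (emit_instance gl params) (ready x) ((ready x)(0 := written (?r x)))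
        (poly q' (length x))"
      using q'[of x "[]"] by simp
    from runs_Seq[OF q this]
    show "\<exists>s. runs (Seq prepare (emit_instance gl params)) (init_state x) s
        (poly (q + q' + 1) (length x)) \<and>
        fst (s 0) = word_tape (?r x)"
      by (intro exI[of _ "(ready x)(0 := written (?r x))"]) (simp add: written_def)
  qed auto
qed

end

section \<open>Codes of instances\<close>

lemma binary_inject: "binary m = binary n \<Longrightarrow> m = n"
proof (induction m arbitrary: n rule: less_induct)
  case (less m)
  show ?case
  proof (cases "m = 0 \<or> n = 0")
    case True
    then show ?thesis using less.prems
      by (auto simp: binary.simps[of m] binary.simps[of n] binary.simps[of 0] split: if_splits)
  next
    case False
    then have "odd m = odd n" "binary (m div 2) = binary (n div 2)"
      using less.prems by (auto simp: binary.simps[of m] binary.simps[of n])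
    then have "m div 2 = n div 2" "m mod 2 = n mod 2"
      using less.IH[of "m div 2" "n div 2"] False by (auto simp: odd_iff_mod_2_eq_one parity_cases)
    then show ?thesis by (metis div_mult_mod_eq)
  qed
qed

lemma encode_nat_append_inject:
  assumes "encode_nat m @ u = encode_nat n @ v"
  shows "m = n \<and> u = v"
proof -
  have "bs = cs \<and> u = v"
    if "concat (map (\<lambda>b. [True, b]) bs) @ [False] @ u =
        concat (map (\<lambda>b. [True, b]) cs) @ [False] @ v" for bs cs
    using that
  proof (induction bs arbitrary: cs)
    case Nil
    then show ?case by (cases cs) auto
  next
    case (Cons b bs)
    then show ?case by (cases cs) auto
  qed
  from this[of "binary m" "binary n"] show ?thesis
    using assms binary_inject by (simp add: encode_nat_def)
qed

lemma encode_nats_inject: "encode_nats xs = encode_nats ys \<Longrightarrow> xs = ys"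
proof (induction xs arbitrary: ys)
  case Nil
  then show ?case by (cases ys) (auto simp: encode_nats_def encode_nat_def)
next
  case (Cons x xs)
  then obtain y ys' where ys: "ys = y # ys'"
    by (cases ys) (auto simp: encode_nats_def encode_nat_def)
  have "encode_nat x @ encode_nats xs = encode_nat y @ encode_nats ys'"
    using Cons.prems by (simp add: ys encode_nats_def)
  then show ?case using encode_nat_append_inject Cons.IH ys by blast
qed

definition input_graph :: "nat graph \<Rightarrow> bool" where
  "input_graph G \<longleftrightarrow> simple_graph G \<and> verts G = {..<card (verts G)}"

lemma input_graph_eqI:
  assumes G: "input_graph G" and H: "input_graph H" and card: "card (verts G) = card (verts H)"
    and edges: "\<And>i j. i \<in> verts G \<Longrightarrow> j \<in> verts G \<Longrightarrow> {i, j} \<in> edges G \<longleftrightarrow> {i, j} \<in> edges H"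
  shows "G = H"
proof -
  have verts: "verts G = verts H" using G H card by (metis input_graph_def)
  have ends: "\<exists>i\<in>verts G. \<exists>j\<in>verts G. e = {i, j}" if "e \<in> edges G \<or> e \<in> edges H" for e
    using that G H verts unfolding input_graph_def simple_graph_def by metis
  have "edges G = edges H" using ends edges by blast
  then show ?thesis using verts by (auto intro: graph.equality)
qed

lemma graph_code_append_inject:
  assumes G: "input_graph G" and H: "input_graph H" and same_code: "graph_code G @ u = graph_code H @ v"
  shows "G = H \<and> u = v"
proof -
  define n where "n = card (verts G)"
  define rows where
    "rows G = map (\<lambda>i. map (\<lambda>j. if {i, j} \<in> edges G then 1 else 0 :: nat) [0..<n]) [0..<n]"
    for G :: "nat graph"
  have card: "card (verts H) = n" using same_code by (simp add: graph_code_def Let_def n_def)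
  have "length (concat (rows G)) = length (concat (rows H))"
    by (simp add: rows_def length_concat comp_def)
  moreover have "concat (rows G) @ u = concat (rows H) @ v"
    using same_code card by (simp add: graph_code_def Let_def rows_def n_def)
  ultimately have concat_eq: "concat (rows G) = concat (rows H)" and "u = v" by simp_all
  have "rows G = rows H"
    using concat_eq by (subst (asm) concat_eq_concat_iff) (auto simp: rows_def in_set_zip)
  moreover have "{i, j} \<in> edges F \<longleftrightarrow> rows F ! i ! j = 1" if "i < n" "j < n" for F i j
    using that by (simp add: rows_def)
  ultimately have "{i, j} \<in> edges G \<longleftrightarrow> {i, j} \<in> edges H" if "i < n" "j < n" for i j
    using that by simp
  moreover have "verts G = {..<n}" using G by (simp add: input_graph_def n_def)
  ultimately have "G = H" using card by (intro input_graph_eqI[OF G H]) auto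
  then show ?thesis using \<open>u = v\<close> by blast
qed

lemma vector_code_append_inject:
  assumes "input_graph G" "vector_code G k @ u = vector_code G k' @ v"
  shows "(\<forall>i\<in>verts G. k i = k' i) \<and> u = v"
proof -
  have "vector_code G k = vector_code G k'" "u = v"
    using assms(2) by (auto simp: vector_code_def)
  moreover have "i \<in> verts G \<longleftrightarrow> i < card (verts G)" for i
    using assms(1) unfolding input_graph_def by blast
  ultimately show ?thesis by (auto simp: vector_code_def)
qed

section \<open>Hardness\<close>

lemma (in tableau) input_graph_hard_graph: "input_graph (hard_graph gl x t)"
  and doubly_chordal_hard_graph: "doubly_chordal (hard_graph gl x t)"
proof -
  interpret split_system "vertices t" is_universal is_weighted "inc gl x t"
    by (rule split_system_vertices)
  show "input_graph (hard_graph gl x t)" "doubly_chordal (hard_graph gl x t)"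
    using simple_graph_G doubly_chordal_G by (simp_all add: hard_graph_def input_graph_def)
qed

text \<open>The problems differ in the parameters that precede the vectors in the code and scale the
  upper bounds on the weights; \<^term>\<open>hard_params\<close> are those of the instances that the reduction
  produces.\<close>

locale coded_problem =
  fixes P :: "'i opt_problem" and gl :: goal and params :: "'i \<Rightarrow> nat list"
    and scale :: "nat list \<Rightarrow> nat"
    and bounds caps :: "'i \<Rightarrow> nat \<Rightarrow> nat" and hard_params :: "nat list"
  assumes code_of_eq: "code_of P i = graph_code (graph_of P i) @ params i @
      vector_code (graph_of P i) (bounds i) @ vector_code (graph_of P i) (caps i)"
    and length_params: "length (params i) = length (params j)"
    and meets_iff: "meets P i B \<longleftrightarrow>
      attains gl (graph_of P i) (bounds i) (\<lambda>v. scale (params i) * caps i v) B"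
    and scale_hard_params: "scale hard_params \<ge> 1"
    and ex_instance: "\<exists>i. graph_of P i = G \<and> params i = hard_params \<and> bounds i = k \<and>
      caps i = (\<lambda>v. of_bool (W v))"
begin

lemma meets_if_same_code:
  assumes G: "input_graph (graph_of P i)" and H: "input_graph (graph_of P j)"
    and code: "code_of P i @ [B] = code_of P j @ [B']" and meets: "meets P i B"
  shows "meets P j B'"
proof -
  let ?G = "graph_of P i"
  have "?G = graph_of P j \<and>
      params i @ vector_code ?G (bounds i) @ vector_code ?G (caps i) @ [B] =
      params j @ vector_code (graph_of P j) (bounds j) @ vector_code (graph_of P j) (caps j) @ [B']"
    by (rule graph_code_append_inject[OF G H]) (use code in \<open>simp add: code_of_eq\<close>)
  then have same_graph: "graph_of P j = ?G" and same_params: "params i = params j"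
    and vectors: "vector_code ?G (bounds i) @ vector_code ?G (caps i) @ [B] =
      vector_code ?G (bounds j) @ vector_code ?G (caps j) @ [B']"
    using length_params[of i j] by auto
  note bounds = vector_code_append_inject[OF G vectors]
  note caps = vector_code_append_inject[OF G conjunct2[OF bounds]]
  have "finite (verts ?G)" using G by (simp add: input_graph_def simple_graph_def)
  then have "attains gl ?G (bounds i) (\<lambda>v. scale (params i) * caps i v) B \<longleftrightarrow>
      attains gl ?G (bounds j) (\<lambda>v. scale (params i) * caps j v) B"
    using bounds caps by (intro attains_cong) auto
  then show ?thesis using meets caps by (simp add: meets_iff same_graph same_params)
qed

text \<open>Needed because a yes-string only requires some instance with that code to be a yes-instance.\<close>

lemma meets_if_in_yes_strings:
  assumes input: "input_graph (graph_of P i)"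
    and yes: "encode_nats (code_of P i @ [B]) \<in> yes_strings P C"
  shows "meets P i B"
proof -
  obtain j B' where j: "encode_nats (code_of P i @ [B]) = encode_nats (code_of P j @ [B'])"
    "j \<in> instances P C" "meets P j B'"
    using yes unfolding yes_strings_def by blast
  then have "input_graph (graph_of P j)" by (simp add: instances_def input_graph_def)
  then show ?thesis
    using meets_if_same_code[OF _ input _ j(3)] encode_nats_inject[OF j(1)] by simp
qed

lemma ex_hard_instance:
  assumes "turing_machine M"
  obtains i where "graph_of P i = tableau.hard_graph M gl x t"
    and "code_of P i = graph_code (tableau.hard_graph M gl x t) @ hard_params @
      map (tableau.demand M gl x t) (tableau.vertices M t) @
      map (\<lambda>v. of_bool (is_weighted v)) (tableau.vertices M t)"
    and "meets P i (tableau.groups_number M t) \<longleftrightarrow> accepts_within M x t"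
proof -
  interpret tableau M by unfold_locales (rule assms)
  obtain i where i: "graph_of P i = hard_graph gl x t" "params i = hard_params"
    "bounds i = (\<lambda>i. demand gl x t (vertices t ! i))"
    "caps i = (\<lambda>i. of_bool (is_weighted (vertices t ! i)))"
    using ex_instance[of "hard_graph gl x t" "\<lambda>i. demand gl x t (vertices t ! i)"
        "\<lambda>i. is_weighted (vertices t ! i)"] by blast
  show ?thesis
  proof
    show "graph_of P i = hard_graph gl x t" by (rule i)
    show "code_of P i = graph_code (hard_graph gl x t) @ hard_params @
        map (demand gl x t) (vertices t) @ map (\<lambda>v. of_bool (is_weighted v)) (vertices t)"
      unfolding code_of_eq i hard_graph_def vector_code_list_graph
        vector_code_list_graph[where k = "\<lambda>v. of_bool (is_weighted v)"] ..
    show "meets P i (groups_number t) \<longleftrightarrow> accepts_within M x t"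
      unfolding meets_iff i by (rule attains_hard_graph_iff_accepts[OF scale_hard_params])
  qed
qed

theorem NP_hard_on_if_doubly_chordal:
  assumes C: "\<And>G. doubly_chordal G \<Longrightarrow> C G"
  shows "NP_hard_on P C"
  unfolding NP_hard_on_def
proof
  fix L assume "L \<in> NP"
  then obtain M p where M: "turing_machine M"
    and L: "\<And>x. x \<in> L \<longleftrightarrow> accepts_within M x (poly p (length x))" unfolding NP_def by blast
  interpret reduction M p by unfold_locales (rule M)
  let ?r = "instance_string gl hard_params"
  have "?r x \<in> instance_strings P C \<and> (x \<in> L \<longleftrightarrow> ?r x \<in> yes_strings P C)" for x
  proof -
    let ?B = "groups_number (T x)"
    obtain i where graph: "graph_of P i = hard_graph gl x (T x)"
      and code: "code_of P i = graph_code (hard_graph gl x (T x)) @ hard_params @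
        map (demand gl x (T x)) (vertices (T x)) @
        map (\<lambda>v. of_bool (is_weighted v)) (vertices (T x))"
      and meets: "meets P i ?B \<longleftrightarrow> accepts_within M x (T x)"
      using ex_hard_instance[OF M] by blast
    have string: "?r x = encode_nats (code_of P i @ [?B])" by (simp add: instance_string_def code)
    have input: "input_graph (graph_of P i)" by (simp add: graph input_graph_hard_graph)
    then have "i \<in> instances P C"
      using C doubly_chordal_hard_graph by (simp add: instances_def input_graph_def graph)
    moreover have "meets P i ?B" if "?r x \<in> yes_strings P C"
      using meets_if_in_yes_strings[OF input] that string by simp
    ultimately show ?thesis
      unfolding instance_strings_def yes_strings_def
      using string meets L[of x] by (auto simp: T_def)
  qed
  then show "\<exists>r. polytime_computable r \<and>
      (\<forall>x. r x \<in> instance_strings P C \<and> (x \<in> L \<longleftrightarrow> r x \<in> yes_strings P C))"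
    using polytime_computable_instance_string by blast
qed

end

lemma ex_label_code: "\<exists>t. label_code \<circ> t = (\<lambda>v. of_bool (W v))"
  by (rule exI[of _ "\<lambda>v. if W v then Free else Zero"]) auto

lemma coded_problem_fixed_LPF:
  assumes "l \<ge> 1"
  shows "coded_problem (fixed_LPF l) Packing (\<lambda>_. []) (\<lambda>_. l) (\<lambda>(G, k, t). k)
      (\<lambda>(G, k, t). label_code \<circ> t) []"
  using assms ex_label_code
  by unfold_locales (auto simp: fixed_LPF_def lpf_max_eq_gpf_max)

lemma coded_problem_LPF:
  "coded_problem LPF Packing (\<lambda>(G, l, k, t). [l]) hd (\<lambda>(G, l, k, t). k)
      (\<lambda>(G, l, k, t). label_code \<circ> t) [1]"
  using ex_label_code
  by unfold_locales (auto simp: LPF_def lpf_max_eq_gpf_max)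

lemma coded_problem_GPF:
  "coded_problem GPF Packing (\<lambda>_. []) (\<lambda>_. 1) (\<lambda>(G, k, u). k) (\<lambda>(G, k, u). u) []"
  by unfold_locales (auto simp: GPF_def)

lemma coded_problem_GDF:
  "coded_problem GDF Covering (\<lambda>_. []) (\<lambda>_. 1) (\<lambda>(G, k, u). k) (\<lambda>(G, k, u). u) []"
  by unfold_locales (auto simp: GDF_def)

theorem theorem3:
  fixes l :: nat
  assumes "l \<ge> 1"
  shows "NP_hard_on (fixed_LPF l) dually_chordal \<and> NP_hard_on (fixed_LPF l) doubly_chordal \<and>
         NP_hard_on LPF dually_chordal \<and> NP_hard_on LPF doubly_chordal \<and>
         NP_hard_on GDF dually_chordal \<and> NP_hard_on GDF doubly_chordal \<and>
         NP_hard_on GPF dually_chordal \<and> NP_hard_on GPF doubly_chordal"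
proof -
  note hard = coded_problem.NP_hard_on_if_doubly_chordal
  show ?thesis
    by (intro conjI hard[OF coded_problem_fixed_LPF[OF assms]] hard[OF coded_problem_LPF]
        hard[OF coded_problem_GDF] hard[OF coded_problem_GPF])
      (simp_all add: doubly_chordal_def)
qed

end
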